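(* Let $n\ge3$ and let $B_n$ be the braid group with generating set $\{s_1,\dots,s_{n-1}\}$ and relations $s_is_js_i=s_js_is_j$ when $|i-j|=1$ and $s_is_j=s_js_i$ when $|i-j|\ge2$. Let $B_n^+$ be the associated braid monoid, and let $N:B_n^+\to[1,\infty)$ be the homomorphism $N(p)=\exp(\ell(p))$, where $\ell$ is the normalised length function on $B_n^+$. Then $(C^*(B_n^+),\sigma)$ has a gauge-invariant $\mathrm{KMS}_0$-state and has no $\mathrm{KMS}_\beta$-states for $\beta$ in the interval $(0,a)$, where $\exp(-a)=\sqrt5/2-1/2$.
   Context: $B_n^+$ is the monoid with the same generators and relations as $B_n$. $\ell$ is the monoid homomorphism $B_n^+\to\mathbb{N}$ with $\ell(s_i)=1$ for all $i$. For $P=B_n^+$, any $p,q\in P$ have a least common right multiple $p\vee q$, with $pP\cap qP=(p\vee q)P$. $C^*(P)$ is the full (Nica covariant) semigroup $C^*$-algebra: the universal unital $C^*$-algebra generated by isometries $v_p$, $p\in P$, with $v_e=1$, $v_pv_q=v_{pq}$ and $v_pv_p^*v_qv_q^*=v_{p\vee q}v_{p\vee q}^*$ (equivalently, the Nica-Toeplitz algebra of the product system over $P$ with all fibres $\mathbb{C}$). The dynamics $\sigma$ is given by $\sigma_t(v_p)=N(p)^{it}v_p$ for $p\in P$, $t\in\mathbb{R}$. A state $\phi$ is a $\mathrm{KMS}_\beta$-state if $\phi(xy)=\phi(y\sigma_{i\beta}(x))$ for all $x,y$ with $x$ $\sigma$-analytic. A state $\phi$ is gauge-invariant if $\phi(v_pv_q^*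 )=0$ whenever $p\ne q$. *)

theory Defs
  imports
    "HOL-Algebra.Coset"
    "HOL-Algebra.Module"
    "HOL-Library.Poly_Mapping"
    "HOL-Library.Nonpos_Ints"
    "HOL-Analysis.Complex_Transcendental"
begin

section \<open>Unital C*-algebras, states, dynamics and KMS states\<close>

definition complex_ring :: "complex ring" where
  "complex_ring = \<lparr>carrier = UNIV, monoid.mult = (*), one = 1, zero = 0, add = (+)\<rparr>"

record 'a star_algebra = "(complex, 'a) module" +
  adj :: "'a \<Rightarrow> 'a"
  nrm :: "'a \<Rightarrow> real"

locale cstar_algebra = ring A + scalar: Module.module complex_ring A for A (structure) +
  assumes smult_mult_left:
      "\<lbrakk>x \<in> carrier A; y \<in> carrier A\<rbrakk> \<Longrightarrow> (c \<odot> x) \<otimes> y = c \<odot> (x \<otimes> y)"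
    and smult_mult_right:
      "\<lbrakk>x \<in> carrier A; y \<in> carrier A\<rbrakk> \<Longrightarrow> x \<otimes> (c \<odot> y) = c \<odot> (x \<otimes> y)"
    and adj_closed: "x \<in> carrier A \<Longrightarrow> adj A x \<in> carrier A"
    and adj_add: "\<lbrakk>x \<in> carrier A; y \<in> carrier A\<rbrakk> \<Longrightarrow> adj A (x \<oplus> y) = adj A x \<oplus> adj A y"
    and adj_smult: "x \<in> carrier A \<Longrightarrow> adj A (c \<odot> x) = cnj c \<odot> adj A x"
    and adj_mult: "\<lbrakk>x \<in> carrier A; y \<in> carrier A\<rbrakk> \<Longrightarrow> adj A (x \<otimes> y) = adj A y \<otimes> adj A x"
    and adj_adj: "x \<in> carrier A \<Longrightarrow> adj A (adj A x) = x"
    and nrm_nonneg: "x \<in> carrier A \<Longrightarrow> 0 \<le> nrm A x"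
    and nrm_eq_0_iff: "x \<in> carrier A \<Longrightarrow> nrm A x = 0 \<longleftrightarrow> x = \<zero>"
    and nrm_triangle: "\<lbrakk>x \<in> carrier A; y \<in> carrier A\<rbrakk> \<Longrightarrow> nrm A (x \<oplus> y) \<le> nrm A x + nrm A y"
    and nrm_smult: "x \<in> carrier A \<Longrightarrow> nrm A (c \<odot> x) = cmod c * nrm A x"
    and nrm_mult: "\<lbrakk>x \<in> carrier A; y \<in> carrier A\<rbrakk> \<Longrightarrow> nrm A (x \<otimes> y) \<le> nrm A x * nrm A y"
    and nrm_cstar: "x \<in> carrier A \<Longrightarrow> nrm A (adj A x \<otimes> x) = (nrm A x)\<^sup>2"
    and complete:
      "\<lbrakk>\<And>k. X k \<in> carrier A; \<And>e. e > 0 \<Longrightarrow> \<exists>M. \<forall>i\<ge>M. \<forall>j\<ge>M. nrm A (X i \<ominus> X j) < e\<rbrakk>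
        \<Longrightarrow> \<exists>x\<in>carrier A. (\<lambda>k. nrm A (X (k::nat) \<ominus> x)) \<longlonglongrightarrow> 0"

definition star_hom ::
  "('a, 'm) star_algebra_scheme \<Rightarrow> ('b, 'k) star_algebra_scheme \<Rightarrow> ('a \<Rightarrow> 'b) \<Rightarrow> bool" where
  "star_hom A B h \<longleftrightarrow>
     (\<forall>x\<in>carrier A. h x \<in> carrier B) \<and>
     h \<one>\<^bsub>A\<^esub> = \<one>\<^bsub>B\<^esub> \<and>
     (\<forall>x\<in>carrier A. \<forall>y\<in>carrier A. h (x \<oplus>\<^bsub>A\<^esub> y) = h x \<oplus>\<^bsub>B\<^esub> h y) \<and>
     (\<forall>x\<in>carrier A. \<forall>y\<in>carrier A. h (x \<otimes>\<^bsub>A\<^esub> y) = h x \<otimes>\<^bsub>B\<^esub> h y) \<and>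
     (\<forall>c. \<forall>x\<in>carrier A. h (c \<odot>\<^bsub>A\<^esub> x) = c \<odot>\<^bsub>B\<^esub> h x) \<and>
     (\<forall>x\<in>carrier A. h (adj A x) = adj B (h x))"

definition state :: "('a, 'm) star_algebra_scheme \<Rightarrow> ('a \<Rightarrow> complex) \<Rightarrow> bool" where
  "state A \<phi> \<longleftrightarrow>
     (\<forall>x\<in>carrier A. \<forall>y\<in>carrier A. \<phi> (x \<oplus>\<^bsub>A\<^esub> y) = \<phi> x + \<phi> y) \<and>
     (\<forall>c. \<forall>x\<in>carrier A. \<phi> (c \<odot>\<^bsub>A\<^esub> x) = c * \<phi> x) \<and>
     (\<forall>x\<in>carrier A. \<phi> (adj A x \<otimes>\<^bsub>A\<^esub> x) \<in> \<real>\<^sub>\<ge>\<^sub>0) \<and>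
     \<phi> \<one>\<^bsub>A\<^esub> = 1"

text \<open>A dynamics is a strongly continuous one-parameter group of *-automorphisms;
  invertibility of each \<open>\<sigma> t\<close> follows from the group law.\<close>

definition dynamics ::
  "('a, 'm) star_algebra_scheme \<Rightarrow> (real \<Rightarrow> 'a \<Rightarrow> 'a) \<Rightarrow> bool" where
  "dynamics A \<sigma> \<longleftrightarrow>
     (\<forall>t. star_hom A A (\<sigma> t)) \<and>
     (\<forall>x\<in>carrier A. \<sigma> 0 x = x) \<and>
     (\<forall>s t. \<forall>x\<in>carrier A. \<sigma> (s + t) x = \<sigma> s (\<sigma> t x)) \<and>
     (\<forall>x\<in>carrier A. \<forall>t. ((\<lambda>s. nrm A (\<sigma> s x \<ominus>\<^bsub>A\<^esub> \<sigma> t x)) \<longlongrightarrow> 0) (at t))"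

definition entire_map :: "('a, 'm) star_algebra_scheme \<Rightarrow> (complex \<Rightarrow> 'a) \<Rightarrow> bool" where
  "entire_map A F \<longleftrightarrow>
     (\<forall>z. F z \<in> carrier A) \<and>
     (\<forall>z. \<exists>D\<in>carrier A.
        ((\<lambda>w. nrm A (inverse (w - z) \<odot>\<^bsub>A\<^esub> (F w \<ominus>\<^bsub>A\<^esub> F z) \<ominus>\<^bsub>A\<^esub> D)) \<longlongrightarrow> 0) (at z))"

text \<open>\<open>x\<close> is \<open>\<sigma>\<close>-analytic iff some \<open>F\<close> satisfies \<open>analytic_extension A \<sigma> x F\<close>; such an \<open>F\<close> is
  unique, and its value at \<open>z\<close> is what is written \<open>\<sigma>\<close>-sub-\<open>z\<close> of \<open>x\<close>.\<close>

definition analytic_extension ::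
  "('a, 'm) star_algebra_scheme \<Rightarrow> (real \<Rightarrow> 'a \<Rightarrow> 'a) \<Rightarrow> 'a \<Rightarrow> (complex \<Rightarrow> 'a) \<Rightarrow> bool" where
  "analytic_extension A \<sigma> x F \<longleftrightarrow>
     x \<in> carrier A \<and> entire_map A F \<and> (\<forall>t::real. F (complex_of_real t) = \<sigma> t x)"

definition KMS_state ::
  "('a, 'm) star_algebra_scheme \<Rightarrow> (real \<Rightarrow> 'a \<Rightarrow> 'a) \<Rightarrow> real \<Rightarrow> ('a \<Rightarrow> complex) \<Rightarrow> bool" where
  "KMS_state A \<sigma> \<beta> \<phi> \<longleftrightarrow>
     state A \<phi> \<and>
     (\<forall>x F. analytic_extension A \<sigma> x F \<longrightarrow>
        (\<forall>y\<in>carrier A. \<phi> (x \<otimes>\<^bsub>A\<^esub> y) = \<phi> (y \<otimes>\<^bsub>A\<^esub> F (\<i> * complex_of_real \<beta>))))"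


section \<open>Completing a *-algebra in a C*-seminorm\<close>

text \<open>Here \<open>S\<close> is a unital complex *-algebra inside the ring type, with scalar multiplication
  \<open>scal\<close> and involution \<open>star\<close>.\<close>

definition star_subalgebra ::
  "'x::ring_1 set \<Rightarrow> (complex \<Rightarrow> 'x \<Rightarrow> 'x) \<Rightarrow> ('x \<Rightarrow> 'x) \<Rightarrow> bool" where
  "star_subalgebra S scal star \<longleftrightarrow>
     1 \<in> S \<and>
     (\<forall>x\<in>S. \<forall>y\<in>S. x + y \<in> S \<and> x * y \<in> S \<and> star (x + y) = star x + star y \<and>
        star (x * y) = star y * star x) \<and>
     (\<forall>x\<in>S. star x \<in> S \<and> star (star x) = x) \<and>
     (\<forall>c. \<forall>x\<in>S. scal c x \<in> S \<and> star (scal c x) = scal (cnj c) (star x)) \<and>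
     (\<forall>c d. \<forall>x\<in>S. scal (c + d) x = scal c x + scal d x \<and> scal (c * d) x = scal c (scal d x)) \<and>
     (\<forall>c. \<forall>x\<in>S. \<forall>y\<in>S. scal c (x + y) = scal c x + scal c y \<and>
        scal c x * y = scal c (x * y) \<and> x * scal c y = scal c (x * y)) \<and>
     (\<forall>x\<in>S. scal 1 x = x)"

definition cstar_seminorm ::
  "'x::ring_1 set \<Rightarrow> (complex \<Rightarrow> 'x \<Rightarrow> 'x) \<Rightarrow> ('x \<Rightarrow> 'x) \<Rightarrow> ('x \<Rightarrow> real) \<Rightarrow> bool" where
  "cstar_seminorm S scal star \<rho> \<longleftrightarrow>
     (\<forall>x\<in>S. 0 \<le> \<rho> x) \<and>
     (\<forall>x\<in>S. \<forall>y\<in>S. \<rho> (x + y) \<le> \<rho> x + \<rho> y) \<and>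
     (\<forall>c. \<forall>x\<in>S. \<rho> (scal c x) = cmod c * \<rho> x) \<and>
     (\<forall>x\<in>S. \<forall>y\<in>S. \<rho> (x * y) \<le> \<rho> x * \<rho> y) \<and>
     (\<forall>x\<in>S. \<rho> (star x * x) = (\<rho> x)\<^sup>2)"

definition cauchy_seqs :: "'x::ring_1 set \<Rightarrow> ('x \<Rightarrow> real) \<Rightarrow> (nat \<Rightarrow> 'x) set" where
  "cauchy_seqs S \<rho> =
     {X. (\<forall>k. X k \<in> S) \<and> (\<forall>e>0. \<exists>M. \<forall>i\<ge>M. \<forall>j\<ge>M. \<rho> (X i - X j) < e)}"

definition cauchy_class :: "'x::ring_1 set \<Rightarrow> ('x \<Rightarrow> real) \<Rightarrow> (nat \<Rightarrow> 'x) \<Rightarrow> (nat \<Rightarrow> 'x) set" where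
  "cauchy_class S \<rho> X = {Y \<in> cauchy_seqs S \<rho>. (\<lambda>k. \<rho> (X k - Y k)) \<longlonglongrightarrow> 0}"

definition class_rep :: "(nat \<Rightarrow> 'x) set \<Rightarrow> nat \<Rightarrow> 'x" where
  "class_rep a = (SOME X. X \<in> a)"

definition cstar_completion ::
  "'x::ring_1 set \<Rightarrow> (complex \<Rightarrow> 'x \<Rightarrow> 'x) \<Rightarrow> ('x \<Rightarrow> 'x) \<Rightarrow> ('x \<Rightarrow> real) \<Rightarrow>
     (nat \<Rightarrow> 'x) set star_algebra" where
  "cstar_completion S scal star \<rho> =
     \<lparr>carrier = cauchy_class S \<rho> ` cauchy_seqs S \<rho>,
      monoid.mult = (\<lambda>a b. cauchy_class S \<rho> (\<lambda>k. class_rep a k * class_rep b k)),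
      one = cauchy_class S \<rho> (\<lambda>k. 1),
      zero = cauchy_class S \<rho> (\<lambda>k. 0),
      add = (\<lambda>a b. cauchy_class S \<rho> (\<lambda>k. class_rep a k + class_rep b k)),
      smult = (\<lambda>c a. cauchy_class S \<rho> (\<lambda>k. scal c (class_rep a k))),
      adj = (\<lambda>a. cauchy_class S \<rho> (\<lambda>k. star (class_rep a k))),
      nrm = (\<lambda>a. lim (\<lambda>k. \<rho> (class_rep a k)))\<rparr>"


section \<open>The semigroup C*-algebra of a monoid with least common right multiples\<close>

text \<open>\<open>r\<close> represents \<open>p \<or> q\<close>; it is unique when \<open>P\<close> is cancellative without non-trivial units.\<close>

definition is_rlcm :: "('p, 'm) monoid_scheme \<Rightarrow> 'p \<Rightarrow> 'p \<Rightarrow> 'p \<Rightarrow> bool" where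
  "is_rlcm P p q r \<longleftrightarrow>
     r \<in> carrier P \<and>
     (p <#\<^bsub>P\<^esub> carrier P) \<inter> (q <#\<^bsub>P\<^esub> carrier P) = r <#\<^bsub>P\<^esub> carrier P"

definition nica_representation ::
  "('p, 'm) monoid_scheme \<Rightarrow> ('b, 'k) star_algebra_scheme \<Rightarrow> ('p \<Rightarrow> 'b) \<Rightarrow> bool" where
  "nica_representation P B w \<longleftrightarrow>
     (\<forall>p\<in>carrier P. w p \<in> carrier B \<and> adj B (w p) \<otimes>\<^bsub>B\<^esub> w p = \<one>\<^bsub>B\<^esub>) \<and>
     w \<one>\<^bsub>P\<^esub> = \<one>\<^bsub>B\<^esub> \<and>
     (\<forall>p\<in>carrier P. \<forall>q\<in>carrier P. w p \<otimes>\<^bsub>B\<^esub> w q = w (p \<otimes>\<^bsub>P\<^esub> q)) \<and>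
     (\<forall>p\<in>carrier P. \<forall>q\<in>carrier P. \<forall>r. is_rlcm P p q r \<longrightarrow>
        w p \<otimes>\<^bsub>B\<^esub> adj B (w p) \<otimes>\<^bsub>B\<^esub> w q \<otimes>\<^bsub>B\<^esub> adj B (w q) = w r \<otimes>\<^bsub>B\<^esub> adj B (w r))"

text \<open>The free unital *-algebra on letters \<open>v p\<close> is the monoid algebra of the free monoid on the
  letters \<open>v p\<close> and \<open>v p\<close>-adjoint.  The library's monoid algebra is over an additively written
  monoid, so concatenation of words is written \<open>+\<close>.\<close>

datatype 'p letter = Isom 'p | Coisom 'p

datatype 'p word = Word (letters: "'p letter list")

instantiation word :: (type) monoid_add
begin
definition "0 = Word []"
definition "u + w = Word (letters u @ letters w)"
instance by standard (simp_all add: zero_word_def plus_word_def)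
end

primrec flip_letter :: "'p letter \<Rightarrow> 'p letter" where
  "flip_letter (Isom p) = Coisom p"
| "flip_letter (Coisom p) = Isom p"

primrec letter_index :: "'p letter \<Rightarrow> 'p" where
  "letter_index (Isom p) = p"
| "letter_index (Coisom p) = p"

definition word_adj :: "'p word \<Rightarrow> 'p word" where
  "word_adj u = Word (rev (map flip_letter (letters u)))"

type_synonym 'p star_poly = "'p word \<Rightarrow>\<^sub>0 complex"

definition poly_scal :: "complex \<Rightarrow> 'p star_poly \<Rightarrow> 'p star_poly" where
  "poly_scal c f = Poly_Mapping.single 0 c * f"

definition poly_star :: "'p star_poly \<Rightarrow> 'p star_poly" where
  "poly_star f = Poly_Mapping.map cnj (Poly_Mapping.map_key word_adj f)"

definition star_polys :: "('p, 'm) monoid_scheme \<Rightarrow> 'p star_poly set" where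
  "star_polys P = {f. \<forall>u\<in>Poly_Mapping.keys f. letter_index ` set (letters u) \<subseteq> carrier P}"

definition gen :: "'p \<Rightarrow> 'p star_poly" where
  "gen p = Poly_Mapping.single (Word [Isom p]) 1"

definition nica_relators :: "('p, 'm) monoid_scheme \<Rightarrow> 'p star_poly set" where
  "nica_relators P =
     {poly_star (gen p) * gen p - 1 | p. p \<in> carrier P} \<union>
     {gen \<one>\<^bsub>P\<^esub> - 1} \<union>
     {gen p * gen q - gen (p \<otimes>\<^bsub>P\<^esub> q) | p q. p \<in> carrier P \<and> q \<in> carrier P} \<union>
     {gen p * poly_star (gen p) * gen q * poly_star (gen q) - gen r * poly_star (gen r)
       | p q r. p \<in> carrier P \<and> q \<in> carrier P \<and> is_rlcm P p q r}"

text \<open>As usual for a C*-algebra given by generators and relations, the universal algebra is the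
  separated completion of the free unital *-algebra in the largest C*-seminorm that kills the
  relators (C*-seminorms killing the relators are exactly the functions \<open>x \<mapsto> \<parallel>\<pi> x\<parallel>\<close> for unital
  *-homomorphisms \<open>\<pi>\<close> into C*-algebras that satisfy the relations).\<close>

definition nica_seminorm :: "('p, 'm) monoid_scheme \<Rightarrow> ('p star_poly \<Rightarrow> real) \<Rightarrow> bool" where
  "nica_seminorm P \<rho> \<longleftrightarrow>
     cstar_seminorm (star_polys P) poly_scal poly_star \<rho> \<and> (\<forall>x\<in>nica_relators P. \<rho> x = 0)"

definition nica_norm :: "('p, 'm) monoid_scheme \<Rightarrow> 'p star_poly \<Rightarrow> real" where
  "nica_norm P x = (SUP \<rho>\<in>{\<rho>. nica_seminorm P \<rho>}. \<rho> x)"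

definition semigroup_cstar ::
  "('p, 'm) monoid_scheme \<Rightarrow> (nat \<Rightarrow> 'p star_poly) set star_algebra" where
  "semigroup_cstar P = cstar_completion (star_polys P) poly_scal poly_star (nica_norm P)"

definition isom :: "('p, 'm) monoid_scheme \<Rightarrow> 'p \<Rightarrow> (nat \<Rightarrow> 'p star_poly) set" where
  "isom P p = cauchy_class (star_polys P) (nica_norm P) (\<lambda>k. gen p)"

definition gauge_invariant ::
  "('p, 'm) monoid_scheme \<Rightarrow> ((nat \<Rightarrow> 'p star_poly) set \<Rightarrow> complex) \<Rightarrow> bool" where
  "gauge_invariant P \<phi> \<longleftrightarrow>
     (\<forall>p\<in>carrier P. \<forall>q\<in>carrier P. p \<noteq> q \<longrightarrow>
        \<phi> (isom P p \<otimes>\<^bsub>semigroup_cstar P\<^esub> adj (semigroup_cstar P) (isom P q)) = 0)"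


section \<open>The braid monoid\<close>

inductive presented_eq :: "('g list \<times> 'g list) set \<Rightarrow> 'g list \<Rightarrow> 'g list \<Rightarrow> bool"
  for R where
  rel: "(a, b) \<in> R \<Longrightarrow> presented_eq R (u @ a @ w) (u @ b @ w)"
| refl: "presented_eq R u u"
| sym: "presented_eq R u w \<Longrightarrow> presented_eq R w u"
| trans: "presented_eq R u w \<Longrightarrow> presented_eq R w z \<Longrightarrow> presented_eq R u z"

definition word_class :: "('g list \<times> 'g list) set \<Rightarrow> 'g list \<Rightarrow> 'g list set" where
  "word_class R u = {w. presented_eq R u w}"

definition presented_monoid :: "'g set \<Rightarrow> ('g list \<times> 'g list) set \<Rightarrow> 'g list set monoid" where
  "presented_monoid G R =
     \<lparr>carrier = word_class R ` lists G,
      monoid.mult = (\<lambda>p q. \<Union>u\<in>p. \<Union>w\<in>q. word_class R (u @ w)),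
      one = word_class R []\<rparr>"

text \<open>The natural number \<open>i\<close> with \<open>1 \<le> i \<le> n - 1\<close> stands for the generator \<open>s\<^sub>i\<close>.\<close>

definition braid_relations :: "nat \<Rightarrow> (nat list \<times> nat list) set" where
  "braid_relations n =
     {([i, j, i], [j, i, j]) | i j. i \<in> {1..<n} \<and> j \<in> {1..<n} \<and> \<bar>int i - int j\<bar> = 1} \<union>
     {([i, j], [j, i]) | i j. i \<in> {1..<n} \<and> j \<in> {1..<n} \<and> \<bar>int i - int j\<bar> \<ge> 2}"

definition braid_monoid :: "nat \<Rightarrow> nat list set monoid" where
  "braid_monoid n = presented_monoid {1..<n} (braid_relations n)"

text \<open>The relations are homogeneous, so all representatives of a positive braid have the same
  length.\<close>

definition braid_length :: "nat list set \<Rightarrow> nat" where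
  "braid_length p = (THE k. \<forall>u\<in>p. length u = k)"

definition braid_N :: "nat list set \<Rightarrow> real" where
  "braid_N p = exp (real (braid_length p))"


section \<open>The completion is a unital C*-algebra\<close>

locale cstar_seminormed =
  fixes S :: "'x::ring_1 set" and scal star \<rho>
  assumes sub: "star_subalgebra S scal star" and sn: "cstar_seminorm S scal star \<rho>"
begin

abbreviation "C \<equiv> cauchy_seqs S \<rho>"
abbreviation "cl \<equiv> cauchy_class S \<rho>"
abbreviation "A \<equiv> cstar_completion S scal star \<rho>"

lemma S1: "1 \<in> S"
  and S_add: "x \<in> S \<Longrightarrow> y \<in> S \<Longrightarrow> x + y \<in> S"
  and S_mult: "x \<in> S \<Longrightarrow> y \<in> S \<Longrightarrow> x * y \<in> S"
  and S_star: "x \<in> S \<Longrightarrow> star x \<in> S"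
  and S_scal: "x \<in> S \<Longrightarrow> scal c x \<in> S"
  and star_add: "x \<in> S \<Longrightarrow> y \<in> S \<Longrightarrow> star (x + y) = star x + star y"
  and star_mult: "x \<in> S \<Longrightarrow> y \<in> S \<Longrightarrow> star (x * y) = star y * star x"
  and star_star: "x \<in> S \<Longrightarrow> star (star x) = x"
  and star_scal: "x \<in> S \<Longrightarrow> star (scal c x) = scal (cnj c) (star x)"
  and scal_add_l: "x \<in> S \<Longrightarrow> scal (c + d) x = scal c x + scal d x"
  and scal_scal: "x \<in> S \<Longrightarrow> scal (c * d) x = scal c (scal d x)"
  and scal_add_r: "x \<in> S \<Longrightarrow> y \<in> S \<Longrightarrow> scal c (x + y) = scal c x + scal c y"
  and scal_mult_l: "x \<in> S \<Longrightarrow> y \<in> S \<Longrightarrow> scal c x * y = scal c (x * y)"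
  and scal_mult_r: "x \<in> S \<Longrightarrow> y \<in> S \<Longrightarrow> x * scal c y = scal c (x * y)"
  and scal_1: "x \<in> S \<Longrightarrow> scal 1 x = x"
  using sub unfolding star_subalgebra_def by blast+

lemma r_ge: "x \<in> S \<Longrightarrow> 0 \<le> \<rho> x"
  and r_add: "x \<in> S \<Longrightarrow> y \<in> S \<Longrightarrow> \<rho> (x + y) \<le> \<rho> x + \<rho> y"
  and r_scal: "x \<in> S \<Longrightarrow> \<rho> (scal c x) = cmod c * \<rho> x"
  and r_mult: "x \<in> S \<Longrightarrow> y \<in> S \<Longrightarrow> \<rho> (x * y) \<le> \<rho> x * \<rho> y"
  and r_cstar: "x \<in> S \<Longrightarrow> \<rho> (star x * x) = (\<rho> x)\<^sup>2"
  using sn unfolding cstar_seminorm_def by blast+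

lemma scal_0: "x \<in> S \<Longrightarrow> scal 0 x = 0"
  using scal_add_l[of x 0 0] by simp

lemma S0: "0 \<in> S" using scal_0[OF S1] S_scal[OF S1, of 0] by simp

lemma scal_m1: "x \<in> S \<Longrightarrow> scal (-1) x = - x"
  using scal_add_l[of x 1 "-1"] scal_1[of x] scal_0[of x]
  by (metis add.right_inverse add_eq_0_iff)

lemma S_minus: "x \<in> S \<Longrightarrow> - x \<in> S" using scal_m1 S_scal by metis
lemma S_diff: "x \<in> S \<Longrightarrow> y \<in> S \<Longrightarrow> x - y \<in> S"
  using S_add S_minus by (metis add_uminus_conv_diff)
lemma r_minus: "x \<in> S \<Longrightarrow> \<rho> (- x) = \<rho> x" using r_scal[of x "-1"] scal_m1 by simp
lemma r_0: "\<rho> 0 = 0" using r_scal[OF S1, of 0] scal_0[OF S1] by simp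
lemma r_diff_comm: "x \<in> S \<Longrightarrow> y \<in> S \<Longrightarrow> \<rho> (x - y) = \<rho> (y - x)"
  using r_minus[of "x - y"] S_diff by simp
lemma r_tri: "x \<in> S \<Longrightarrow> y \<in> S \<Longrightarrow> z \<in> S \<Longrightarrow> \<rho> (x - z) \<le> \<rho> (x - y) + \<rho> (y - z)"
  using r_add[of "x - y" "y - z"] S_diff by simp
lemma r_rev: "x \<in> S \<Longrightarrow> y \<in> S \<Longrightarrow> \<bar>\<rho> x - \<rho> y\<bar> \<le> \<rho> (x - y)"
  using r_add[of "x - y" y] r_add[of "y - x" x] S_diff r_diff_comm[of x y] by simp
lemma star_minus: "x \<in> S \<Longrightarrow> star (- x) = - star x"
  using star_scal[of x "-1"] scal_m1 S_star by simp
lemma star_diff: "x \<in> S \<Longrightarrow> y \<in> S \<Longrightarrow> star (x - y) = star x - star y"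
  using star_add[of x "- y"] S_minus star_minus by simp
lemma scal_diff: "x \<in> S \<Longrightarrow> y \<in> S \<Longrightarrow> scal c (x - y) = scal c x - scal c y"
  using scal_add_r[of "x - y" y c] S_diff by (simp add: algebra_simps)
lemma star_1: "star 1 = 1"
  using star_mult[OF S1 S_star[OF S1]] star_star[OF S1] by simp

lemma r_star_le: "x \<in> S \<Longrightarrow> \<rho> x \<le> \<rho> (star x)"
proof -
  assume x: "x \<in> S"
  have "\<rho> x * \<rho> x \<le> \<rho> (star x) * \<rho> x"
    using r_cstar[OF x] r_mult[OF S_star[OF x] x] by (simp add: power2_eq_square)
  then show ?thesis using r_ge[OF x] r_ge[OF S_star[OF x]]
    by (cases "\<rho> x = 0") auto
qed
lemma r_star: "x \<in> S \<Longrightarrow> \<rho> (star x) = \<rho> x"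
  using r_star_le[of x] r_star_le[of "star x"] star_star S_star by fastforce

definition eqv where "eqv X Y \<longleftrightarrow> (\<lambda>k. \<rho> (X k - Y k)) \<longlonglongrightarrow> (0::real)"

lemma C_S: "X \<in> C \<Longrightarrow> X k \<in> S" by (simp add: cauchy_seqs_def)
lemma C_cauchy: "X \<in> C \<Longrightarrow> e > 0 \<Longrightarrow> \<exists>M. \<forall>i\<ge>M. \<forall>j\<ge>M. \<rho> (X i - X j) < e"
  by (simp add: cauchy_seqs_def)
lemma C_I: "(\<And>k. X k \<in> S) \<Longrightarrow> (\<And>e. e > 0 \<Longrightarrow> \<exists>M. \<forall>i\<ge>M. \<forall>j\<ge>M. \<rho> (X i - X j) < e) \<Longrightarrow> X \<in> C"
  by (simp add: cauchy_seqs_def)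

lemma tends0: 
  assumes "\<And>k. 0 \<le> f k" "\<And>k. f k \<le> g k" "g \<longlonglongrightarrow> (0::real)" shows "f \<longlonglongrightarrow> 0"
  by (rule tendsto_sandwich[of "\<lambda>_. 0" f _ g]) (use assms in auto)

lemma eqv_refl: "X \<in> C \<Longrightarrow> eqv X X" by (simp add: eqv_def r_0)
lemma eqv_sym: "X \<in> C \<Longrightarrow> Y \<in> C \<Longrightarrow> eqv X Y \<Longrightarrow> eqv Y X"
  unfolding eqv_def using r_diff_comm C_S by (metis (no_types, lifting) ext)
lemma eqv_trans: assumes "X \<in> C" "Y \<in> C" "Z \<in> C" "eqv X Y" "eqv Y Z" shows "eqv X Z"
  unfolding eqv_def
proof (rule tends0)
  show "(\<lambda>k. \<rho> (X k - Y k) + \<rho> (Y k - Z k)) \<longlonglongrightarrow> 0"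
    using tendsto_add[OF assms(4,5)[unfolded eqv_def]] by simp
qed (use assms C_S S_diff r_tri r_ge in auto)

lemma cl_eq: "X \<in> C \<Longrightarrow> Y \<in> C \<Longrightarrow> cl X = cl Y \<longleftrightarrow> eqv X Y"
proof
  assume a: "X \<in> C" "Y \<in> C" "cl X = cl Y"
  have "Y \<in> cl Y" using eqv_refl[OF a(2)] a by (simp add: cauchy_class_def eqv_def)
  then have "Y \<in> cl X" using a by simp
  then show "eqv X Y" by (simp add: cauchy_class_def eqv_def)
next
  assume a: "X \<in> C" "Y \<in> C" "eqv X Y"
  show "cl X = cl Y"
    using eqv_trans eqv_sym a unfolding cauchy_class_def eqv_def[symmetric] by blast
qed

lemma rep: assumes "X \<in> C" shows rep_C: "class_rep (cl X) \<in> C" and rep_eqv: "eqv X (class_rep (cl X))"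
proof -
  have "X \<in> cl X" using eqv_refl[OF assms] assms by (simp add: cauchy_class_def eqv_def)
  then have "class_rep (cl X) \<in> cl X" unfolding class_rep_def by (rule someI[where P="\<lambda>Y. Y \<in> cl X"])
  then show "class_rep (cl X) \<in> C" "eqv X (class_rep (cl X))"
    by (auto simp: cauchy_class_def eqv_def)
qed

lemma const_C: "x \<in> S \<Longrightarrow> (\<lambda>k. x) \<in> C" by (rule C_I) (auto simp: r_0)

lemma C_bdd: assumes "X \<in> C" shows "\<exists>B>0. \<forall>k. \<rho> (X k) \<le> B"
proof -
  obtain M where M: "\<forall>i\<ge>M. \<forall>j\<ge>M. \<rho> (X i - X j) < 1" using C_cauchy[OF assms, of 1] by auto
  let ?B = "(\<Sum>i\<le>M. \<rho> (X i)) + 1"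
  have pos: "0 \<le> \<rho> (X i)" for i using r_ge C_S[OF assms] by auto
  have le: "\<rho> (X i) \<le> (\<Sum>i\<le>M. \<rho> (X i))" if "i \<le> M" for i
    by (rule member_le_sum) (use that pos in auto)
  have "\<rho> (X k) \<le> ?B" for k
  proof (cases "k \<le> M")
    case True then show ?thesis using le[OF True] by simp
  next
    case False
    then have "\<rho> (X k - X M) < 1" using M by simp
    then show ?thesis using r_rev[OF C_S[OF assms, of k] C_S[OF assms, of M]] le[of M] by simp
  qed
  moreover have "?B > 0" using pos sum_nonneg[of "{..M}" "\<lambda>i. \<rho> (X i)"] by (smt (verit))
  ultimately show ?thesis by blast
qed

lemma lip_C: assumes "X \<in> C" "\<And>x. x \<in> S \<Longrightarrow> f x \<in> S" "K \<ge> 0"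
    "\<And>x y. x \<in> S \<Longrightarrow> y \<in> S \<Longrightarrow> \<rho> (f x - f y) \<le> K * \<rho> (x - y)"
  shows "(\<lambda>k. f (X k)) \<in> C"
proof (rule C_I)
  fix e :: real assume e: "e > 0"
  then have "e / (K + 1) > 0" using assms(3) by simp
  then obtain M where M: "\<forall>i\<ge>M. \<forall>j\<ge>M. \<rho> (X i - X j) < e / (K + 1)" using C_cauchy[OF assms(1)] by blast
  have "\<rho> (f (X i) - f (X j)) < e" if "i \<ge> M" "j \<ge> M" for i j
  proof -
    have "\<rho> (f (X i) - f (X j)) \<le> K * \<rho> (X i - X j)" using assms C_S by auto
    also have "\<dots> \<le> K * (e / (K+1))" using M that assms(3) by (intro mult_left_mono) (auto intro: less_imp_le)
    also have "\<dots> < e" using e assms(3) by (simp add: field_simps)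
    finally show ?thesis .
  qed
  then show "\<exists>M. \<forall>i\<ge>M. \<forall>j\<ge>M. \<rho> (f (X i) - f (X j)) < e" by blast
qed (use assms C_S in auto)

lemma lip_eqv: assumes "X \<in> C" "Y \<in> C" "eqv X Y" "\<And>x. x \<in> S \<Longrightarrow> f x \<in> S" 
    "\<And>x y. x \<in> S \<Longrightarrow> y \<in> S \<Longrightarrow> \<rho> (f x - f y) \<le> K * \<rho> (x - y)"
  shows "eqv (\<lambda>k. f (X k)) (\<lambda>k. f (Y k))"
  unfolding eqv_def
proof (rule tends0)
  show "(\<lambda>k. K * \<rho> (X k - Y k)) \<longlonglongrightarrow> 0" 
    using tendsto_mult_right_zero[OF assms(3)[unfolded eqv_def]] by simp
qed (use assms C_S r_ge S_diff in auto)

lemma scal_C: "X \<in> C \<Longrightarrow> (\<lambda>k. scal c (X k)) \<in> C"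
  by (rule lip_C[of X _ "cmod c"]) (auto simp: S_scal scal_diff[symmetric] r_scal S_diff)
lemma scal_eqv: "X \<in> C \<Longrightarrow> Y \<in> C \<Longrightarrow> eqv X Y \<Longrightarrow> eqv (\<lambda>k. scal c (X k)) (\<lambda>k. scal c (Y k))"
  by (rule lip_eqv[of X _ _ "cmod c"]) (auto simp: S_scal scal_diff[symmetric] r_scal S_diff)
lemma star_C: "X \<in> C \<Longrightarrow> (\<lambda>k. star (X k)) \<in> C"
  by (rule lip_C[of X _ 1]) (auto simp: S_star star_diff[symmetric] r_star S_diff)
lemma star_eqv: "X \<in> C \<Longrightarrow> Y \<in> C \<Longrightarrow> eqv X Y \<Longrightarrow> eqv (\<lambda>k. star (X k)) (\<lambda>k. star (Y k))"
  by (rule lip_eqv[of X _ _ 1]) (auto simp: S_star star_diff[symmetric] r_star S_diff)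

lemma add_diff_le: "x \<in> S \<Longrightarrow> y \<in> S \<Longrightarrow> x' \<in> S \<Longrightarrow> y' \<in> S \<Longrightarrow>
   \<rho> ((x + y) - (x' + y')) \<le> \<rho> (x - x') + \<rho> (y - y')"
  using r_add[of "x - x'" "y - y'"] S_diff by (simp add: algebra_simps)

lemma mult_diff_le: assumes "x \<in> S" "y \<in> S" "x' \<in> S" "y' \<in> S"
  shows "\<rho> (x * y - x' * y') \<le> \<rho> (x - x') * \<rho> y + \<rho> x' * \<rho> (y - y')"
proof -
  have "x * y - x' * y' = (x - x') * y + x' * (y - y')" by (simp add: algebra_simps)
  then show ?thesis
    using r_add[of "(x - x') * y" "x' * (y - y')"] r_mult[of "x - x'" y] r_mult[of x' "y - y'"]
      assms S_diff S_mult by fastforce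
qed

lemma add_C: assumes "X \<in> C" "Y \<in> C" shows "(\<lambda>k. X k + Y k) \<in> C"
proof (rule C_I)
  fix e :: real assume e: "e > 0"
  then have e2: "e/2 > 0" by simp
  obtain M where M: "\<forall>i\<ge>M. \<forall>j\<ge>M. \<rho> (X i - X j) < e/2" using C_cauchy[OF assms(1) e2] by blast
  obtain M' where M': "\<forall>i\<ge>M'. \<forall>j\<ge>M'. \<rho> (Y i - Y j) < e/2" using C_cauchy[OF assms(2) e2] by blast
  have "\<rho> ((X i + Y i) - (X j + Y j)) < e" if "i \<ge> max M M'" "j \<ge> max M M'" for i j
    using add_diff_le[of "X i" "Y i" "X j" "Y j"] M[rule_format, of i j] M'[rule_format, of i j] that assms C_S by fastforce
  then show "\<exists>M. \<forall>i\<ge>M. \<forall>j\<ge>M. \<rho> ((X i + Y i) - (X j + Y j)) < e" by blast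
qed (use assms C_S S_add in auto)

lemma add_eqv: assumes "X \<in> C" "Y \<in> C" "X' \<in> C" "Y' \<in> C" "eqv X X'" "eqv Y Y'"
  shows "eqv (\<lambda>k. X k + Y k) (\<lambda>k. X' k + Y' k)"
  unfolding eqv_def
proof (rule tends0)
  show "(\<lambda>k. \<rho> (X k - X' k) + \<rho> (Y k - Y' k)) \<longlonglongrightarrow> 0"
    using tendsto_add[OF assms(5,6)[unfolded eqv_def]] by simp
qed (use assms C_S S_diff S_add add_diff_le r_ge in auto)

lemma mult_C: assumes "X \<in> C" "Y \<in> C" shows "(\<lambda>k. X k * Y k) \<in> C"
proof (rule C_I)
  fix e :: real assume e: "e > 0"
  obtain B where B: "B > 0" "\<And>k. \<rho> (X k) \<le> B" using C_bdd[OF assms(1)] by blast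
  obtain B' where B': "B' > 0" "\<And>k. \<rho> (Y k) \<le> B'" using C_bdd[OF assms(2)] by blast
  have e2: "e/(2*B) > 0" "e/(2*B') > 0" using e B B' by auto
  obtain M where M: "\<forall>i\<ge>M. \<forall>j\<ge>M. \<rho> (X i - X j) < e/(2*B')" using C_cauchy[OF assms(1) e2(2)] by blast
  obtain M' where M': "\<forall>i\<ge>M'. \<forall>j\<ge>M'. \<rho> (Y i - Y j) < e/(2*B)" using C_cauchy[OF assms(2) e2(1)] by blast
  have "\<rho> ((X i * Y i) - (X j * Y j)) < e" if ij: "i \<ge> max M M'" "j \<ge> max M M'" for i j
  proof -
    have "\<rho> ((X i * Y i) - (X j * Y j)) \<le> \<rho> (X i - X j) * \<rho> (Y i) + \<rho> (X j) * \<rho> (Y i - Y j)"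
      using mult_diff_le assms C_S by auto
    also have "\<dots> \<le> \<rho> (X i - X j) * B' + B * \<rho> (Y i - Y j)"
      using B B' r_ge C_S S_diff assms by (intro add_mono mult_mono) (auto intro: less_imp_le)
    also have "\<dots> < (e/(2*B')) * B' + B * (e/(2*B))"
      using M M' ij B(1) B'(1) by (intro add_strict_mono mult_strict_right_mono mult_strict_left_mono) auto
    also have "\<dots> = e" using B(1) B'(1) by simp
    finally show ?thesis .
  qed
  then show "\<exists>M. \<forall>i\<ge>M. \<forall>j\<ge>M. \<rho> ((X i * Y i) - (X j * Y j)) < e" by blast
qed (use assms C_S S_mult in auto)

lemma mult_eqv: assumes "X \<in> C" "Y \<in> C" "X' \<in> C" "Y' \<in> C" "eqv X X'" "eqv Y Y'"
  shows "eqv (\<lambda>k. X k * Y k) (\<lambda>k. X' k * Y' k)"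
proof -
  obtain B where B: "B > 0" "\<And>k. \<rho> (X' k) \<le> B" using C_bdd[OF assms(3)] by blast
  obtain B' where B': "B' > 0" "\<And>k. \<rho> (Y k) \<le> B'" using C_bdd[OF assms(2)] by blast
  show ?thesis unfolding eqv_def
  proof (rule tends0)
    show "(\<lambda>k. \<rho> (X k - X' k) * B' + B * \<rho> (Y k - Y' k)) \<longlonglongrightarrow> 0"
      using tendsto_add[OF tendsto_mult_left_zero[OF assms(5)[unfolded eqv_def], of B']
          tendsto_mult_right_zero[OF assms(6)[unfolded eqv_def], of B]] by simp
    fix k
    have "\<rho> ((X k * Y k) - (X' k * Y' k)) \<le> \<rho> (X k - X' k) * \<rho> (Y k) + \<rho> (X' k) * \<rho> (Y k - Y' k)"
      using mult_diff_le assms C_S by auto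
    also have "\<dots> \<le> \<rho> (X k - X' k) * B' + B * \<rho> (Y k - Y' k)"
      using B B' r_ge C_S S_diff assms by (intro add_mono mult_mono) (auto intro: less_imp_le)
    finally show "\<rho> ((X k * Y k) - (X' k * Y' k)) \<le> \<rho> (X k - X' k) * B' + B * \<rho> (Y k - Y' k)" .
  qed (use assms C_S S_diff S_mult r_ge in auto)
qed

lemma r_conv: assumes "X \<in> C" shows "convergent (\<lambda>k. \<rho> (X k))"
proof -
  have "Cauchy (\<lambda>k. \<rho> (X k))"
  proof (rule metric_CauchyI)
    fix e :: real assume "e > 0"
    then obtain M where M: "\<forall>i\<ge>M. \<forall>j\<ge>M. \<rho> (X i - X j) < e" using C_cauchy[OF assms] by blast
    then show "\<exists>M. \<forall>m\<ge>M. \<forall>n\<ge>M. dist (\<rho> (X m)) (\<rho> (X n)) < e"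
      using r_rev C_S[OF assms] by (metis dist_real_def order_le_less_trans)
  qed
  then show ?thesis by (simp add: Cauchy_convergent_iff)
qed

lemma r_eqv: assumes "X \<in> C" "Y \<in> C" "eqv X Y" shows "lim (\<lambda>k. \<rho> (X k)) = lim (\<lambda>k. \<rho> (Y k))"
proof -
  have "(\<lambda>k. \<bar>\<rho> (X k) - \<rho> (Y k)\<bar>) \<longlonglongrightarrow> 0"
    by (rule tends0[OF _ _ assms(3)[unfolded eqv_def]]) (use r_rev C_S assms in auto)
  then have "(\<lambda>k. \<rho> (X k) - \<rho> (Y k)) \<longlonglongrightarrow> 0" by (rule tendsto_rabs_zero_cancel)
  moreover have "(\<lambda>k. \<rho> (X k) - \<rho> (Y k)) \<longlonglongrightarrow> lim (\<lambda>k. \<rho> (X k)) - lim (\<lambda>k. \<rho> (Y k))"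
    using r_conv assms by (intro tendsto_diff) (auto simp: convergent_LIMSEQ_iff)
  ultimately show ?thesis using LIMSEQ_unique by fastforce
qed

lemma car: "carrier A = cl ` C" 
  and A_one: "\<one>\<^bsub>A\<^esub> = cl (\<lambda>k. 1)"
  and A_zero: "\<zero>\<^bsub>A\<^esub> = cl (\<lambda>k. 0)"
  by (simp_all add: cstar_completion_def)

lemma eqv_rep: "X \<in> C \<Longrightarrow> eqv (class_rep (cl X)) X"
  by (rule eqv_sym[OF _ rep_C rep_eqv])
lemma A_add: assumes X: "X \<in> C" and Y: "Y \<in> C" shows "cl X \<oplus>\<^bsub>A\<^esub> cl Y = cl (\<lambda>k. X k + Y k)"
  using add_eqv[OF rep_C[OF X] rep_C[OF Y] X Y eqv_rep[OF X] eqv_rep[OF Y]]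
    cl_eq[OF add_C[OF rep_C[OF X] rep_C[OF Y]] add_C[OF X Y]]
  by (simp add: cstar_completion_def)
lemma A_mult: assumes X: "X \<in> C" and Y: "Y \<in> C" shows "cl X \<otimes>\<^bsub>A\<^esub> cl Y = cl (\<lambda>k. X k * Y k)"
  using mult_eqv[OF rep_C[OF X] rep_C[OF Y] X Y eqv_rep[OF X] eqv_rep[OF Y]]
    cl_eq[OF mult_C[OF rep_C[OF X] rep_C[OF Y]] mult_C[OF X Y]]
  by (simp add: cstar_completion_def)
lemma A_smult: assumes X: "X \<in> C" shows "c \<odot>\<^bsub>A\<^esub> cl X = cl (\<lambda>k. scal c (X k))"
  using scal_eqv[OF rep_C[OF X] X eqv_rep[OF X]] cl_eq[OF scal_C[OF rep_C[OF X]] scal_C[OF X]]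
  by (simp add: cstar_completion_def)
lemma A_adj: assumes X: "X \<in> C" shows "adj A (cl X) = cl (\<lambda>k. star (X k))"
  using star_eqv[OF rep_C[OF X] X eqv_rep[OF X]] cl_eq[OF star_C[OF rep_C[OF X]] star_C[OF X]]
  by (simp add: cstar_completion_def)
lemma A_nrm: assumes X: "X \<in> C" shows "nrm A (cl X) = lim (\<lambda>k. \<rho> (X k))"
  using r_eqv[OF rep_C[OF X] X eqv_rep[OF X]]
  by (simp add: cstar_completion_def)
lemma A_nrm_lim: "X \<in> C \<Longrightarrow> (\<lambda>k. \<rho> (X k)) \<longlonglongrightarrow> nrm A (cl X)"
  using r_conv A_nrm by (simp add: convergent_LIMSEQ_iff)

lemmas A_simps = A_add A_mult A_smult A_adj A_one A_zero add_C mult_C scal_C star_C const_C S1 S0 C_S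

lemma minus_C: "X \<in> C \<Longrightarrow> (\<lambda>k. - X k) \<in> C" using scal_C[of X "-1"] C_S by (simp add: scal_m1)

lemma A_ring: "ring A"
proof (rule ringI)
  show "abelian_group A"
  proof (rule abelian_groupI)
    fix x assume "x \<in> carrier A"
    then obtain X where X: "X \<in> C" "x = cl X" by (auto simp: car)
    then show "\<exists>y\<in>carrier A. y \<oplus>\<^bsub>A\<^esub> x = \<zero>\<^bsub>A\<^esub>"
      by (intro bexI[of _ "cl (\<lambda>k. - X k)"]) (auto simp: A_simps minus_C car)
  qed (auto simp: car A_simps algebra_simps)
  show "Group.monoid A"
    by (rule monoidI) (auto simp: car A_simps algebra_simps)
qed (auto simp: car A_simps algebra_simps)

lemma A_minus: assumes "X \<in> C" shows "\<ominus>\<^bsub>A\<^esub> cl X = cl (\<lambda>k. - X k)"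
proof -
  interpret ring A by (rule A_ring)
  have "cl X \<oplus>\<^bsub>A\<^esub> cl (\<lambda>k. - X k) = \<zero>\<^bsub>A\<^esub>" using assms by (simp add: A_simps minus_C)
  moreover have "cl X \<in> carrier A" "cl (\<lambda>k. - X k) \<in> carrier A" using assms minus_C by (auto simp: car)
  ultimately show ?thesis using minus_equality a_comm by metis
qed
lemma A_diff: "X \<in> C \<Longrightarrow> Y \<in> C \<Longrightarrow> cl X \<ominus>\<^bsub>A\<^esub> cl Y = cl (\<lambda>k. X k - Y k)"
  by (simp add: a_minus_def A_minus minus_C A_add)
lemma diff_C: "X \<in> C \<Longrightarrow> Y \<in> C \<Longrightarrow> (\<lambda>k. X k - Y k) \<in> C"
  using add_C[of X "\<lambda>k. - Y k"] minus_C by simp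

lemma A_complete:
  fixes a :: "nat \<Rightarrow> (nat \<Rightarrow> 'x) set"
  assumes "\<And>k. a k \<in> carrier A" 
    and cau: "\<And>e. e > 0 \<Longrightarrow> \<exists>M. \<forall>i\<ge>M. \<forall>j\<ge>M. nrm A (a i \<ominus>\<^bsub>A\<^esub> a j) < e"
  shows "\<exists>x\<in>carrier A. (\<lambda>k. nrm A (a k \<ominus>\<^bsub>A\<^esub> x)) \<longlonglongrightarrow> 0"
proof -
  have "\<forall>k. \<exists>X. X \<in> C \<and> a k = cl X" using assms(1) car by (metis imageE)
  then obtain X where X: "\<And>k. X k \<in> C" "\<And>k. a k = cl (X k)" by metis
  have "\<forall>k. \<exists>m. \<forall>i\<ge>m. \<forall>j\<ge>m. \<rho> (X k i - X k j) < 1 / (real k + 1)"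
    using C_cauchy[OF X(1)] by simp
  then obtain m where m: "\<And>k i j. i \<ge> m k \<Longrightarrow> j \<ge> m k \<Longrightarrow> \<rho> (X k i - X k j) < 1 / (real k + 1)" by metis
  define Y where "Y k = X k (m k)" for k
  have YS: "Y k \<in> S" for k unfolding Y_def using C_S X by auto
  have nd: "(\<lambda>l. \<rho> (X i l - X j l)) \<longlonglongrightarrow> nrm A (a i \<ominus>\<^bsub>A\<^esub> a j)" for i j
    using A_nrm_lim[OF diff_C[OF X(1) X(1)]] by (simp add: X A_diff)
  have Yd: "\<rho> (Y i - Y j) \<le> 1 / (real i + 1) + nrm A (a i \<ominus>\<^bsub>A\<^esub> a j) + 1 / (real j + 1)" for i j
  proof (rule LIMSEQ_le_const)
    show "(\<lambda>l. 1 / (real i + 1) + \<rho> (X i l - X j l) + 1 / (real j + 1)) \<longlonglongrightarrow> 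
        1 / (real i + 1) + nrm A (a i \<ominus>\<^bsub>A\<^esub> a j) + 1 / (real j + 1)"
      by (intro tendsto_intros nd)
    have "\<rho> (Y i - Y j) \<le> 1 / (real i + 1) + \<rho> (X i l - X j l) + 1 / (real j + 1)" if "l \<ge> max (m i) (m j)" for l
    proof -
      have s: "X i l \<in> S" "X j l \<in> S" using C_S X by auto
      have "\<rho> (Y i - Y j) \<le> \<rho> (Y i - X i l) + (\<rho> (X i l - X j l) + \<rho> (X j l - Y j))"
        using r_tri[OF YS[of i] s(1) YS[of j]] r_tri[OF s(1) s(2) YS[of j]] by simp
      moreover have "\<rho> (Y i - X i l) < 1 / (real i + 1)" "\<rho> (X j l - Y j) < 1 / (real j + 1)"
        unfolding Y_def using m that by auto
      ultimately show ?thesis by linarith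
    qed
    then show "\<exists>N. \<forall>l\<ge>N. \<rho> (Y i - Y j) \<le> 1 / (real i + 1) + \<rho> (X i l - X j l) + 1 / (real j + 1)" by blast
  qed
  have YC: "Y \<in> C"
  proof (rule C_I[OF YS])
    fix e :: real assume e: "e > 0"
    then obtain M where M: "\<And>i j. i\<ge>M \<Longrightarrow> j\<ge>M \<Longrightarrow> nrm A (a i \<ominus>\<^bsub>A\<^esub> a j) < e/3" using cau[of "e/3"] by auto
    obtain K where K: "1 / (real K + 1) < e/3"
      using reals_Archimedean[of "e/3"] e by (auto simp: inverse_eq_divide add.commute)
    have KK: "1 / (real i + 1) < e/3" if "i \<ge> K" for i
    proof -
      have "1 / (real i + 1) \<le> 1 / (real K + 1)" using that by (intro divide_left_mono) auto
      then show ?thesis using K by simp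
    qed
    have "\<rho> (Y i - Y j) < e" if "i \<ge> max M K" "j \<ge> max M K" for i j
      using Yd[of i j] M[of i j] KK[of i] KK[of j] that by simp
    then show "\<exists>M. \<forall>i\<ge>M. \<forall>j\<ge>M. \<rho> (Y i - Y j) < e" by blast
  qed
  have key: "\<exists>M. \<forall>i\<ge>M. \<bar>nrm A (a i \<ominus>\<^bsub>A\<^esub> cl Y)\<bar> < e" if e: "e > 0" for e :: real
  proof -
    obtain M where M: "\<And>i j. i\<ge>M \<Longrightarrow> j\<ge>M \<Longrightarrow> \<rho> (Y i - Y j) < e/3" using C_cauchy[OF YC, of "e/3"] e by auto
    obtain K where K: "1 / (real K + 1) < e/3"
      using reals_Archimedean[of "e/3"] e by (auto simp: inverse_eq_divide add.commute)
    have "\<bar>nrm A (a i \<ominus>\<^bsub>A\<^esub> cl Y)\<bar> < e" if i: "i \<ge> max M K" for i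
    proof -
      have lim: "(\<lambda>l. \<rho> (X i l - Y l)) \<longlonglongrightarrow> nrm A (a i \<ominus>\<^bsub>A\<^esub> cl Y)"
        using A_nrm_lim[OF diff_C[OF X(1) YC]] by (simp add: X A_diff YC)
      have "1 / (real i + 1) \<le> 1 / (real K + 1)" using i by (intro divide_left_mono) auto
      then have Ki: "1 / (real i + 1) < e/3" using K by simp
      have b: "\<rho> (X i l - Y l) \<le> 2*e/3" if l: "l \<ge> max i (m i)" for l
      proof -
        have "\<rho> (X i l - Y l) \<le> \<rho> (X i l - Y i) + \<rho> (Y i - Y l)"
          using r_tri[OF C_S[OF X(1)] YS YS] .
        moreover have "\<rho> (X i l - Y i) < 1 / (real i + 1)" unfolding Y_def using m l by auto
        moreover have "\<rho> (Y i - Y l) < e/3" using M i l by auto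
        ultimately show ?thesis using Ki by linarith
      qed
      have "nrm A (a i \<ominus>\<^bsub>A\<^esub> cl Y) \<le> 2*e/3" by (rule LIMSEQ_le_const2[OF lim]) (use b in blast)
      moreover have "0 \<le> nrm A (a i \<ominus>\<^bsub>A\<^esub> cl Y)" by (rule LIMSEQ_le_const[OF lim]) (use r_ge S_diff C_S X YS in blast)
      ultimately show ?thesis using e by simp
    qed
    then show ?thesis by blast
  qed
  show ?thesis
  proof (intro bexI[of _ "cl Y"])
    show "(\<lambda>k. nrm A (a k \<ominus>\<^bsub>A\<^esub> cl Y)) \<longlonglongrightarrow> 0" using key by (simp add: LIMSEQ_iff)
  qed (auto simp: car YC)
qed

theorem completion_cstar: "cstar_algebra A"
proof -
  have cr: "cring complex_ring"
    by (rule cringI; (rule abelian_groupI comm_monoidI)?)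
       (auto simp: complex_ring_def algebra_simps intro: exI[of _ "- _"])
  have ag: "abelian_group A" using A_ring ring.is_abelian_group by blast
  have md: "Module.module complex_ring A"
    by (rule moduleI[OF cr ag])
       (auto simp: complex_ring_def car A_simps scal_add_l scal_add_r scal_scal scal_1)
  have cla: "cstar_algebra_axioms A"
  proof
    fix x assume "x \<in> carrier A"
    then obtain X where X: "X \<in> C" "x = cl X" by (auto simp: car)
    note lim = A_nrm_lim[OF X(1)]
    show n0: "0 \<le> nrm A x" unfolding X(2) by (rule LIMSEQ_le_const[OF lim]) (use r_ge C_S X in blast)
    show "nrm A x = 0 \<longleftrightarrow> x = \<zero>\<^bsub>A\<^esub>" 
    proof -
      have "x = \<zero>\<^bsub>A\<^esub> \<longleftrightarrow> (\<lambda>k. \<rho> (X k)) \<longlonglongrightarrow> 0" using X by (simp add: A_zero cl_eq const_C S0 eqv_def)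
      then show ?thesis using lim LIMSEQ_unique X by metis
    qed
    show "nrm A (c \<odot>\<^bsub>A\<^esub> x) = cmod c * nrm A x" for c
    proof -
      have "(\<lambda>k. \<rho> (scal c (X k))) \<longlonglongrightarrow> nrm A (c \<odot>\<^bsub>A\<^esub> x)" using A_nrm_lim[OF scal_C[OF X(1)]] X A_smult by simp
      moreover have "(\<lambda>k. \<rho> (scal c (X k))) \<longlonglongrightarrow> cmod c * nrm A x"
        using tendsto_mult_left[OF lim, of "cmod c"] X r_scal C_S by simp
      ultimately show ?thesis using LIMSEQ_unique by blast
    qed
    show "nrm A (adj A x \<otimes>\<^bsub>A\<^esub> x) = (nrm A x)\<^sup>2"
    proof -
      have "(\<lambda>k. \<rho> (star (X k) * X k)) \<longlonglongrightarrow> nrm A (adj A x \<otimes>\<^bsub>A\<^esub> x)" 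
        using A_nrm_lim[OF mult_C[OF star_C[OF X(1)] X(1)]] X star_C by (simp add: A_simps)
      moreover have "(\<lambda>k. \<rho> (star (X k) * X k)) \<longlonglongrightarrow> (nrm A x)\<^sup>2"
        using tendsto_power[OF lim, of 2] X r_cstar C_S by simp
      ultimately show ?thesis using LIMSEQ_unique by blast
    qed
    fix y assume "y \<in> carrier A"
    then obtain Y where Y: "Y \<in> C" "y = cl Y" by (auto simp: car)
    note limY = A_nrm_lim[OF Y(1)]
    show "nrm A (x \<oplus>\<^bsub>A\<^esub> y) \<le> nrm A x + nrm A y"
      using A_nrm_lim[OF add_C[OF X(1) Y(1)]] X Y r_add C_S
      by (auto simp: A_add intro!: LIMSEQ_le[OF _ tendsto_add[OF lim limY]])
    show "nrm A (x \<otimes>\<^bsub>A\<^esub> y) \<le> nrm A x * nrm A y"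
      using A_nrm_lim[OF mult_C[OF X(1) Y(1)]] X Y r_mult C_S
      by (auto simp: A_mult intro!: LIMSEQ_le[OF _ tendsto_mult[OF lim limY]])
  next
    fix X :: "nat \<Rightarrow> (nat \<Rightarrow> 'x) set" assume "\<And>k. X k \<in> carrier A" "(\<And>e. e > 0 \<Longrightarrow> \<exists>M. \<forall>i\<ge>M. \<forall>j\<ge>M. nrm A (X i \<ominus>\<^bsub>A\<^esub> X j) < e)"
    then show "\<exists>x\<in>carrier A. (\<lambda>k. nrm A (X k \<ominus>\<^bsub>A\<^esub> x)) \<longlonglongrightarrow> 0" by (rule A_complete)
  qed (auto simp: car A_simps scal_mult_l scal_mult_r star_add star_scal star_mult star_star)
  show ?thesis using A_ring md cla by (intro cstar_algebra.intro)
qed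

end


section \<open>The largest Nica seminorm and the C*-algebra it defines\<close>

abbreviation "lookup \<equiv> Poly_Mapping.lookup"

lemma flip_flip [simp]: "flip_letter (flip_letter l) = l" by (cases l) auto
lemma index_flip [simp]: "letter_index (flip_letter l) = letter_index l" by (cases l) auto
lemma word_adj_adj [simp]: "word_adj (word_adj u) = u"
  by (cases u) (simp add: word_adj_def rev_map comp_def)
lemma word_adj_plus: "word_adj (u + w) = word_adj w + word_adj u"
  by (simp add: word_adj_def plus_word_def)
lemma word_adj_0 [simp]: "word_adj 0 = 0" by (simp add: word_adj_def zero_word_def)
lemma inj_word_adj: "inj word_adj" by (metis injI word_adj_adj)

lemma lookup_poly_star: "lookup (poly_star f) u = cnj (lookup f (word_adj u))"
  by (simp add: poly_star_def map.rep_eq map_key.rep_eq inj_word_adj when_def)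

lemma poly_star_add: "poly_star (f + g) = poly_star f + poly_star g"
  by (rule poly_mapping_eqI) (simp add: lookup_poly_star lookup_add)
lemma poly_star_0: "poly_star 0 = 0"
  by (rule poly_mapping_eqI) (simp add: lookup_poly_star)
lemma poly_star_star: "poly_star (poly_star f) = f"
  by (rule poly_mapping_eqI) (simp add: lookup_poly_star)
lemma poly_star_single: "poly_star (Poly_Mapping.single u c) = Poly_Mapping.single (word_adj u) (cnj c)"
proof (rule poly_mapping_eqI)
  fix k
  have "u = word_adj k \<longleftrightarrow> word_adj u = k" by (metis word_adj_adj)
  then show "lookup (poly_star (Poly_Mapping.single u c)) k = lookup (Poly_Mapping.single (word_adj u) (cnj c)) k"
    by (simp add: lookup_poly_star lookup_single when_def)
qed
lemma poly_star_sum: "poly_star (sum f I) = (\<Sum>i\<in>I. poly_star (f i))"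
  by (induction I rule: infinite_finite_induct) (auto simp: poly_star_0 poly_star_add)

lemma poly_sum: "f = (\<Sum>u\<in>Poly_Mapping.keys f. Poly_Mapping.single u (lookup f u))"
proof (rule poly_mapping_eqI)
  fix k
  have "(\<Sum>u\<in>Poly_Mapping.keys f. lookup (Poly_Mapping.single u (lookup f u)) k)
     = (\<Sum>u\<in>Poly_Mapping.keys f. if u = k then lookup f k else 0)"
    by (rule sum.cong) (auto simp: lookup_single when_def)
  also have "\<dots> = lookup f k" by (auto simp: in_keys_iff)
  finally show "lookup f k = lookup (\<Sum>u\<in>Poly_Mapping.keys f. Poly_Mapping.single u (lookup f u)) k"
    by (simp add: lookup_sum)
qed

lemma poly_star_mult: "poly_star (f * g) = poly_star g * poly_star f"
proof -
  let ?s = "Poly_Mapping.single"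
  have "f * g = (\<Sum>u\<in>Poly_Mapping.keys f. ?s u (lookup f u)) * (\<Sum>w\<in>Poly_Mapping.keys g. ?s w (lookup g w))"
    using poly_sum[of f] poly_sum[of g] by simp
  also have "\<dots> = (\<Sum>u\<in>Poly_Mapping.keys f. \<Sum>w\<in>Poly_Mapping.keys g. ?s (u + w) (lookup f u * lookup g w))"
    by (simp add: sum_product mult_single)
  finally have "poly_star (f * g) = 
     (\<Sum>u\<in>Poly_Mapping.keys f. \<Sum>w\<in>Poly_Mapping.keys g. ?s (word_adj w) (cnj (lookup g w)) * ?s (word_adj u) (cnj (lookup f u)))"
    by (simp add: poly_star_sum poly_star_single word_adj_plus mult_single mult.commute)
  also have "\<dots> = (\<Sum>w\<in>Poly_Mapping.keys g. poly_star (?s w (lookup g w))) * (\<Sum>u\<in>Poly_Mapping.keys f. poly_star (?s u (lookup f u)))"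
    by (subst sum.swap) (simp add: sum_product poly_star_single)
  also have "\<dots> = poly_star g * poly_star f"
    using poly_sum[of f] poly_sum[of g] by (metis poly_star_sum)
  finally show ?thesis .
qed

lemma lookup_poly_scal: "lookup (poly_scal c f) u = c * lookup f u"
proof -
  have "poly_scal c f = Poly_Mapping.map ((*) c) f" by (simp add: poly_scal_def mult_map_scale_conv_mult)
  then show ?thesis by (simp add: map.rep_eq when_def)
qed

lemma star_polys_I: "(\<And>u. lookup f u \<noteq> 0 \<Longrightarrow> letter_index ` set (letters u) \<subseteq> carrier P) \<Longrightarrow> f \<in> star_polys P"
  unfolding star_polys_def by (auto simp: in_keys_iff)
lemma star_polys_D: "f \<in> star_polys P \<Longrightarrow> lookup f u \<noteq> 0 \<Longrightarrow> letter_index ` set (letters u) \<subseteq> carrier P"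
  unfolding star_polys_def by (auto simp: in_keys_iff)

lemma sp_mult: assumes "f \<in> star_polys P" "g \<in> star_polys P" shows "f * g \<in> star_polys P"
  using assms keys_mult[of f g] unfolding star_polys_def
  by (force simp: plus_word_def)

lemma sp_single: "letter_index ` set (letters u) \<subseteq> carrier P \<Longrightarrow> Poly_Mapping.single u c \<in> star_polys P"
  by (auto simp: star_polys_def split: if_splits)

lemma sp_subalgebra: "star_subalgebra (star_polys P) poly_scal poly_star"
  unfolding star_subalgebra_def
proof (intro conjI allI ballI)
  show "1 \<in> star_polys P" by (auto simp: star_polys_def zero_word_def)
  fix f assume f: "f \<in> star_polys P"
  show "poly_star f \<in> star_polys P"
    by (rule star_polys_I) (use star_polys_D[OF f] in \<open>fastforce simp: lookup_poly_star word_adj_def\<close>)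
  show "poly_scal c f \<in> star_polys P" for c
    by (rule star_polys_I) (use star_polys_D[OF f] in \<open>auto simp: lookup_poly_scal\<close>)
  show "poly_star (poly_scal c f) = poly_scal (cnj c) (poly_star f)" for c
    by (rule poly_mapping_eqI) (simp add: lookup_poly_star lookup_poly_scal)
  fix g assume g: "g \<in> star_polys P"
  show "f + g \<in> star_polys P"
    by (rule star_polys_I) (metis star_polys_D[OF f] star_polys_D[OF g] lookup_add add.right_neutral)
  show "f * poly_scal c g = poly_scal c (f * g)" for c
  proof -
    have "f * Poly_Mapping.single 0 c = Poly_Mapping.single 0 c * f"
    proof -
      have "f * Poly_Mapping.single 0 c = (\<Sum>u\<in>Poly_Mapping.keys f. Poly_Mapping.single u (lookup f u) * Poly_Mapping.single 0 c)"
        by (subst poly_sum[of f]) (simp add: sum_distrib_right)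
      also have "\<dots> = (\<Sum>u\<in>Poly_Mapping.keys f. Poly_Mapping.single 0 c * Poly_Mapping.single u (lookup f u))"
        by (simp add: mult_single mult.commute)
      also have "\<dots> = Poly_Mapping.single 0 c * f"
        by (subst (3) poly_sum[of f]) (simp add: sum_distrib_left)
      finally show ?thesis .
    qed
    then show ?thesis by (simp add: poly_scal_def mult.assoc[symmetric])
  qed
qed (auto simp: sp_mult poly_star_add poly_star_mult poly_star_star poly_scal_def
        distrib_left distrib_right single_add mult_single
      simp: mult.assoc[symmetric])

lemma sp_gen: "p \<in> carrier P \<Longrightarrow> gen p \<in> star_polys P"
  by (simp add: gen_def sp_single)

lemma seminormed: "nica_seminorm P \<rho> \<Longrightarrow> cstar_seminormed (star_polys P) poly_scal poly_star \<rho>"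
  by (simp add: nica_seminorm_def cstar_seminormed_def sp_subalgebra)

lemma seminorm_word_le:
  assumes "nica_seminorm P \<rho>" "letter_index ` set ls \<subseteq> carrier P"
  shows "\<rho> (Poly_Mapping.single (Word ls) 1) \<le> 1"
  using assms(2)
proof (induction ls)
  interpret cstar_seminormed "star_polys P" poly_scal poly_star \<rho> using seminormed assms by blast
  have r1: "\<rho> 1 \<le> 1"
  proof -
    have "\<rho> 1 = \<rho> 1 * \<rho> 1" using r_cstar[OF S1] star_1 by (simp add: power2_eq_square)
    then have "\<rho> 1 = 0 \<or> \<rho> 1 = 1" by auto
    then show ?thesis by auto
  qed
  {
    case Nil
    show ?case using r1 by (simp add: zero_word_def[symmetric])
  next
    case (Cons l ls)
    have g1: "\<rho> (gen p) \<le> 1" if "p \<in> carrier P" for p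
    proof -
      have g: "gen p \<in> star_polys P" using sp_gen that .
      have "poly_star (gen p) * gen p - 1 \<in> nica_relators P" using that by (auto simp: nica_relators_def)
      then have "\<rho> (poly_star (gen p) * gen p - 1) = 0" using assms(1) by (simp add: nica_seminorm_def)
      then have "\<rho> (poly_star (gen p) * gen p) \<le> \<rho> 1"
        using r_rev[of "poly_star (gen p) * gen p" 1] S_mult S_star g S1 by fastforce
      then have "(\<rho> (gen p))\<^sup>2 \<le> 1" using r_cstar[OF g] r1 by simp
      then show ?thesis using power2_le_imp_le[of "\<rho> (gen p)" 1] by simp
    qed
    have li: "letter_index l \<in> carrier P" using Cons by simp
    have l1: "\<rho> (Poly_Mapping.single (Word [l]) 1) \<le> 1"
    proof (cases l)
      case (Isom p) then show ?thesis using g1 li by (simp add: gen_def)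
    next
      case (Coisom p)
      then have "Poly_Mapping.single (Word [l]) 1 = poly_star (gen p)" by (simp add: gen_def poly_star_single word_adj_def)
      then show ?thesis using g1 li Coisom r_star[OF sp_gen, of p] by simp
    qed
    have "Poly_Mapping.single (Word (l # ls)) 1 = Poly_Mapping.single (Word [l]) (1::complex) * Poly_Mapping.single (Word ls) 1"
      by (simp add: mult_single plus_word_def)
    moreover have "Poly_Mapping.single (Word [l]) (1::complex) \<in> star_polys P" "Poly_Mapping.single (Word ls) (1::complex) \<in> star_polys P"
      using Cons by (auto intro!: sp_single)
    ultimately have "\<rho> (Poly_Mapping.single (Word (l # ls)) 1) \<le> \<rho> (Poly_Mapping.single (Word [l]) 1) * \<rho> (Poly_Mapping.single (Word ls) 1)"
      using r_mult by metis
    also have "\<dots> \<le> 1 * 1" using l1 Cons by (intro mult_mono) (auto intro!: r_ge sp_single)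
    finally show ?case by simp
  }
qed

definition l1 :: "'p star_poly \<Rightarrow> real" where "l1 f = (\<Sum>u\<in>Poly_Mapping.keys f. cmod (lookup f u))"

lemma seminorm_le_l1: assumes "nica_seminorm P \<rho>" "f \<in> star_polys P" shows "\<rho> f \<le> l1 f"
proof -
  interpret cstar_seminormed "star_polys P" poly_scal poly_star \<rho> using seminormed assms by blast
  have *: "finite I \<Longrightarrow> (\<forall>u\<in>I. letter_index ` set (letters u) \<subseteq> carrier P) \<Longrightarrow>
     (\<Sum>u\<in>I. Poly_Mapping.single u (c u)) \<in> star_polys P \<and>
     \<rho> (\<Sum>u\<in>I. Poly_Mapping.single u (c u)) \<le> (\<Sum>u\<in>I. cmod (c u))" for I and c :: "'a word \<Rightarrow> complex"
  proof (induction I rule: finite_induct)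
    case empty then show ?case using r_0 S0 by simp
  next
    case (insert u I)
    have e: "Poly_Mapping.single u (c u) = poly_scal (c u) (Poly_Mapping.single u 1)"
      by (simp add: poly_scal_def mult_single)
    have u: "letter_index ` set (letters u) \<subseteq> carrier P" using insert by auto
    have "\<rho> (Poly_Mapping.single u (c u)) = cmod (c u) * \<rho> (Poly_Mapping.single u 1)"
      unfolding e using r_scal sp_single[OF u] by blast
    also have "\<dots> \<le> cmod (c u) * 1"
      using seminorm_word_le[OF assms(1) u] by (intro mult_left_mono) auto
    finally show ?case using insert r_add[of "Poly_Mapping.single u (c u)" "\<Sum>u\<in>I. Poly_Mapping.single u (c u)"] 
        sp_single[OF u] S_add by fastforce
  qed
  show ?thesis using *[of "Poly_Mapping.keys f" "lookup f"] assms(2) poly_sum[of f]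
    by (simp add: l1_def star_polys_def)
qed

lemma nica_0: "nica_seminorm P (\<lambda>_. 0)"
  by (simp add: nica_seminorm_def cstar_seminorm_def)

lemma norm_ub: assumes "nica_seminorm P \<rho>" "f \<in> star_polys P" shows "\<rho> f \<le> nica_norm P f"
  unfolding nica_norm_def
  by (rule cSUP_upper) (use assms seminorm_le_l1[OF _ assms(2)] in \<open>auto intro!: bdd_aboveI2[of _ _ "l1 f"]\<close>)

lemma norm_least: assumes "\<And>\<rho>. nica_seminorm P \<rho> \<Longrightarrow> \<rho> f \<le> K" shows "nica_norm P f \<le> K"
  unfolding nica_norm_def by (rule cSUP_least) (use assms nica_0 in auto)

lemma nica_norm_seminorm: "nica_seminorm P (nica_norm P)"
  unfolding nica_seminorm_def cstar_seminorm_def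
proof (intro conjI ballI allI)
  note sa = sp_subalgebra[of P, unfolded star_subalgebra_def]
  have nn: "0 \<le> nica_norm P f" if "f \<in> star_polys P" for f using norm_ub[OF nica_0 that] .
  {
    fix f assume f: "f \<in> star_polys P"
    then show "0 \<le> nica_norm P f" using nn by blast
    have le: "nica_norm P (poly_scal c f) \<le> cmod c * nica_norm P f" if f: "f \<in> star_polys P" for c f
    proof (rule norm_least)
      fix \<rho> assume r: "nica_seminorm P \<rho>"
      then have "\<rho> (poly_scal c f) = cmod c * \<rho> f" using f by (simp add: nica_seminorm_def cstar_seminorm_def)
      then show "\<rho> (poly_scal c f) \<le> cmod c * nica_norm P f" using norm_ub[OF r f] by (simp add: mult_left_mono)
    qed
    show "nica_norm P (poly_scal c f) = cmod c * nica_norm P f" for c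
    proof (cases "c = 0")
      case True
      have "poly_scal c f \<in> star_polys P" using sa f by blast
      then show ?thesis using le[OF f, of c] nn[of "poly_scal c f"] True by simp
    next
      case False
      have pc: "poly_scal c f \<in> star_polys P" using sa f by blast
      have "f = poly_scal (inverse c) (poly_scal c f)" using sa f False by (metis left_inverse)
      then have "nica_norm P f \<le> cmod (inverse c) * nica_norm P (poly_scal c f)"
        using le[OF pc, of "inverse c"] by simp
      then have "cmod c * nica_norm P f \<le> nica_norm P (poly_scal c f)" 
        using False by (simp add: norm_divide field_simps)
      then show ?thesis using le[OF f, of c] by simp
    qed
    show "nica_norm P (poly_star f * f) = (nica_norm P f)\<^sup>2"
    proof (rule antisym)
      show "nica_norm P (poly_star f * f) \<le> (nica_norm P f)\<^sup>2"
      proof (rule norm_least)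
        fix \<rho> assume r: "nica_seminorm P \<rho>"
        then have "\<rho> (poly_star f * f) = (\<rho> f)\<^sup>2" "0 \<le> \<rho> f" using f by (auto simp: nica_seminorm_def cstar_seminorm_def)
        then show "\<rho> (poly_star f * f) \<le> (nica_norm P f)\<^sup>2" using norm_ub[OF r f] by (simp add: power_mono)
      qed
      have "nica_norm P f \<le> sqrt (nica_norm P (poly_star f * f))"
      proof (rule norm_least)
        fix \<rho> assume r: "nica_seminorm P \<rho>"
        then have "\<rho> (poly_star f * f) = (\<rho> f)\<^sup>2" using f by (auto simp: nica_seminorm_def cstar_seminorm_def)
        moreover have "poly_star f * f \<in> star_polys P" using sa f by blast
        ultimately have "(\<rho> f)\<^sup>2 \<le> nica_norm P (poly_star f * f)" using norm_ub[OF r] by metis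
        then show "\<rho> f \<le> sqrt (nica_norm P (poly_star f * f))" by (rule real_le_rsqrt)
      qed
      then have "(nica_norm P f)\<^sup>2 \<le> (sqrt (nica_norm P (poly_star f * f)))\<^sup>2" using nn[OF f] by (rule power_mono)
      then show "(nica_norm P f)\<^sup>2 \<le> nica_norm P (poly_star f * f)"
        using nn[of "poly_star f * f"] sa f by simp
    qed
    fix g assume g: "g \<in> star_polys P"
    show "nica_norm P (f + g) \<le> nica_norm P f + nica_norm P g"
    proof (rule norm_least)
      fix \<rho> assume r: "nica_seminorm P \<rho>"
      then have "\<rho> (f + g) \<le> \<rho> f + \<rho> g" using f g by (auto simp: nica_seminorm_def cstar_seminorm_def)
      then show "\<rho> (f + g) \<le> nica_norm P f + nica_norm P g" using norm_ub[OF r f] norm_ub[OF r g] by simp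
    qed
    show "nica_norm P (f * g) \<le> nica_norm P f * nica_norm P g"
    proof (rule norm_least)
      fix \<rho> assume r: "nica_seminorm P \<rho>"
      then have "\<rho> (f * g) \<le> \<rho> f * \<rho> g" "0 \<le> \<rho> g" using f g by (auto simp: nica_seminorm_def cstar_seminorm_def)
      then show "\<rho> (f * g) \<le> nica_norm P f * nica_norm P g" using norm_ub[OF r f] norm_ub[OF r g] nn[OF f]
        by (smt (verit) mult_mono)
    qed
  }
  fix x assume "x \<in> nica_relators P"
  then have "\<And>\<rho>. nica_seminorm P \<rho> \<Longrightarrow> \<rho> x = 0" by (simp add: nica_seminorm_def)
  then show "nica_norm P x = 0" unfolding nica_norm_def
    by (metis (mono_tags, lifting) SUP_cong cSUP_const empty_Collect_eq mem_Collect_eq nica_0)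
qed

theorem semigroup_cstar_is_cstar: "cstar_algebra (semigroup_cstar P)"
  unfolding semigroup_cstar_def
  by (rule cstar_seminormed.completion_cstar[OF seminormed[OF nica_norm_seminorm]])


section \<open>The generating isometries form a Nica covariant representation with dense span of words\<close>

lemma star_polys_induct [consumes 1, case_names one gen add mult scal star]:
  assumes f: "f \<in> star_polys P"
    and one: "Q 1" and gen: "\<And>p. p \<in> carrier P \<Longrightarrow> Q (gen p)"
    and add: "\<And>f g. f \<in> star_polys P \<Longrightarrow> g \<in> star_polys P \<Longrightarrow> Q f \<Longrightarrow> Q g \<Longrightarrow> Q (f + g)"
    and mult: "\<And>f g. f \<in> star_polys P \<Longrightarrow> g \<in> star_polys P \<Longrightarrow> Q f \<Longrightarrow> Q g \<Longrightarrow> Q (f * g)"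
    and scal: "\<And>c f. f \<in> star_polys P \<Longrightarrow> Q f \<Longrightarrow> Q (poly_scal c f)"
    and star: "\<And>f. f \<in> star_polys P \<Longrightarrow> Q f \<Longrightarrow> Q (poly_star f)"
  shows "Q f"
proof -
  have one_in: "1 \<in> star_polys P" by (auto simp: star_polys_def zero_word_def)
  have w: "letter_index ` set ls \<subseteq> carrier P \<Longrightarrow> Q (Poly_Mapping.single (Word ls) 1)" for ls
  proof (induction ls)
    case Nil then show ?case using one by (simp add: zero_word_def[symmetric])
  next
    case (Cons l ls)
    have l: "Poly_Mapping.single (Word [l]) (1::complex) \<in> star_polys P \<and> Q (Poly_Mapping.single (Word [l]) 1)"
    proof (cases l)
      case (Isom p) then show ?thesis using gen sp_gen[of p P] Cons by (auto simp: gen_def)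
    next
      case (Coisom p)
      then have "Poly_Mapping.single (Word [l]) 1 = poly_star (Defs.gen p)" by (simp add: Defs.gen_def poly_star_single word_adj_def)
      then show ?thesis using star[OF sp_gen, of p] gen[of p] Cons Coisom sp_single[of "Word [l]" P 1] by auto
    qed
    have "Poly_Mapping.single (Word (l # ls)) 1 = Poly_Mapping.single (Word [l]) (1::complex) * Poly_Mapping.single (Word ls) 1"
      by (simp add: mult_single plus_word_def)
    then show ?case using mult l Cons sp_single[of "Word ls" P] by auto
  qed
  have u: "Q (Poly_Mapping.single u c) \<and> Poly_Mapping.single u c \<in> star_polys P" if "letter_index ` set (letters u) \<subseteq> carrier P" for u c
  proof -
    have e: "Poly_Mapping.single u c = poly_scal c (Poly_Mapping.single u 1)"
      by (simp add: poly_scal_def mult_single)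
    show ?thesis using scal[OF sp_single[OF that], of 1 c] w[of "letters u"] that sp_single[OF that, of c] e by (metis word.collapse)
  qed
  have z: "Q 0" using scal[OF one_in one, of 0] by (simp add: poly_scal_def)
  have z_in: "0 \<in> star_polys P" by (simp add: star_polys_def)
  have *: "finite I \<Longrightarrow> (\<forall>u\<in>I. letter_index ` set (letters u) \<subseteq> carrier P) \<Longrightarrow>
     (\<Sum>u\<in>I. Poly_Mapping.single u (c u)) \<in> star_polys P \<and> Q (\<Sum>u\<in>I. Poly_Mapping.single u (c u))" for I and c :: "'a word \<Rightarrow> complex"
  proof (induction I rule: finite_induct)
    case empty then show ?case using z z_in by simp
  next
    case (insert v I)
    have "Poly_Mapping.single v (c v) + (\<Sum>u\<in>I. Poly_Mapping.single u (c u)) \<in> star_polys P"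
      using sp_subalgebra[of P] u[of v "c v"] insert unfolding star_subalgebra_def by auto
    then show ?case using insert u[of v "c v"] add by auto
  qed
  show ?thesis using *[of "Poly_Mapping.keys f" "lookup f"] f poly_sum[of f]
    by (simp add: star_polys_def)
qed

context cstar_algebra
begin

lemma nrm_zero: "nrm A \<zero> = 0" using nrm_eq_0_iff by blast
lemma smult_in: "x \<in> carrier A \<Longrightarrow> c \<odot> x \<in> carrier A" using scalar.smult_closed[of c x] by (simp add: complex_ring_def)
lemma smult_m1: "x \<in> carrier A \<Longrightarrow> (-1) \<odot> x = \<ominus> x"
proof -
  assume x: "x \<in> carrier A"
  have "\<zero>\<^bsub>complex_ring\<^esub> \<odot> x = \<zero>" using scalar.smult_l_null x .
  then have "0 \<odot> x = \<zero>" by (simp add: complex_ring_def)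
  moreover have "((-1) + 1) \<odot> x = (-1) \<odot> x \<oplus> 1 \<odot> x" using scalar.smult_l_distr[of "-1" 1 x] x by (simp add: complex_ring_def)
  moreover have "1 \<odot> x = x" using scalar.smult_one[OF x] by (simp add: complex_ring_def)
  ultimately have "(-1) \<odot> x \<oplus> x = \<zero>" by simp
  then show ?thesis using minus_equality[of "(-1) \<odot> x" x] x smult_in by simp
qed
lemma nrm_minus: "x \<in> carrier A \<Longrightarrow> nrm A (\<ominus> x) = nrm A x" using nrm_smult[of x "-1"] smult_m1 by simp
lemma d_comm: "x \<in> carrier A \<Longrightarrow> y \<in> carrier A \<Longrightarrow> nrm A (x \<ominus> y) = nrm A (y \<ominus> x)"
  using nrm_minus[of "x \<ominus> y"] by (simp add: a_minus_def minus_add a_comm)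
lemma diff_split: "x \<in> carrier A \<Longrightarrow> y \<in> carrier A \<Longrightarrow> z \<in> carrier A \<Longrightarrow> x \<ominus> z = (x \<ominus> y) \<oplus> (y \<ominus> z)"
  by (simp add: a_minus_def a_assoc[symmetric]) (simp add: a_assoc l_neg)
lemma d_tri: "x \<in> carrier A \<Longrightarrow> y \<in> carrier A \<Longrightarrow> z \<in> carrier A \<Longrightarrow> nrm A (x \<ominus> z) \<le> nrm A (x \<ominus> y) + nrm A (y \<ominus> z)"
  using nrm_triangle[of "x \<ominus> y" "y \<ominus> z"] diff_split[of x y z] by simp
lemma d_add: "x \<in> carrier A \<Longrightarrow> y \<in> carrier A \<Longrightarrow> x' \<in> carrier A \<Longrightarrow> y' \<in> carrier A \<Longrightarrow>
   nrm A ((x \<oplus> y) \<ominus> (x' \<oplus> y')) \<le> nrm A (x \<ominus> x') + nrm A (y \<ominus> y')"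
proof -
  assume a: "x \<in> carrier A" "y \<in> carrier A" "x' \<in> carrier A" "y' \<in> carrier A"
  have "(x \<oplus> y) \<ominus> (x' \<oplus> y') = (x \<ominus> x') \<oplus> (y \<ominus> y')"
    using a by (simp add: a_minus_def minus_add a_ac)
  then show ?thesis using a nrm_triangle by simp
qed
lemma d_mult: "x \<in> carrier A \<Longrightarrow> y \<in> carrier A \<Longrightarrow> x' \<in> carrier A \<Longrightarrow> y' \<in> carrier A \<Longrightarrow>
   nrm A ((x \<otimes> y) \<ominus> (x' \<otimes> y')) \<le> nrm A (x \<ominus> x') * nrm A y + nrm A x' * nrm A (y \<ominus> y')"
proof -
  assume a: "x \<in> carrier A" "y \<in> carrier A" "x' \<in> carrier A" "y' \<in> carrier A"
  have "(x \<otimes> y) \<ominus> (x' \<otimes> y') = ((x \<otimes> y) \<ominus> (x' \<otimes> y)) \<oplus> ((x' \<otimes> y) \<ominus> (x' \<otimes> y'))"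
    using a by (intro diff_split) simp_all
  also have "\<dots> = (x \<ominus> x') \<otimes> y \<oplus> x' \<otimes> (y \<ominus> y')" using a by (simp add: a_minus_def l_distr r_distr l_minus r_minus)
  finally show ?thesis using a nrm_triangle[of "(x \<ominus> x') \<otimes> y" "x' \<otimes> (y \<ominus> y')"] nrm_mult[of "x \<ominus> x'" y] nrm_mult[of x' "y \<ominus> y'"] by simp
qed
lemma d_smult: "x \<in> carrier A \<Longrightarrow> x' \<in> carrier A \<Longrightarrow> nrm A ((c \<odot> x) \<ominus> (c \<odot> x')) = cmod c * nrm A (x \<ominus> x')"
proof -
  assume a: "x \<in> carrier A" "x' \<in> carrier A"
  have "c \<odot> (x \<ominus> x') = (c \<odot> x) \<ominus> (c \<odot> x')"
  proof -
    have 1: "c \<odot> (x \<oplus> (-1) \<odot> x') = c \<odot> x \<oplus> c \<odot> ((-1) \<odot> x')"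
      using scalar.smult_r_distr[of c x "(-1) \<odot> x'"] a smult_in by (simp add: complex_ring_def)
    have 2: "c \<odot> ((-1) \<odot> x') = (-1) \<odot> (c \<odot> x')" 
      using scalar.smult_assoc1[of c "-1" x'] scalar.smult_assoc1[of "-1" c x'] a by (simp add: complex_ring_def)
    show ?thesis using 1 2 a smult_in smult_m1 by (simp add: a_minus_def)
  qed
  then show ?thesis using nrm_smult[of "x \<ominus> x'" c] a by simp
qed
lemma nrm_adj: "x \<in> carrier A \<Longrightarrow> nrm A (adj A x) = nrm A x"
proof -
  have le: "nrm A x \<le> nrm A (adj A x)" if x: "x \<in> carrier A" for x
  proof -
    have "nrm A x * nrm A x \<le> nrm A (adj A x) * nrm A x"
      using nrm_cstar[OF x] nrm_mult[OF adj_closed[OF x] x] by (simp add: power2_eq_square)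
    then show ?thesis using nrm_nonneg[OF x] nrm_nonneg[OF adj_closed[OF x]]
      by (cases "nrm A x = 0") auto
  qed
  show "x \<in> carrier A \<Longrightarrow> nrm A (adj A x) = nrm A x" using le[of x] le[of "adj A x"] adj_adj adj_closed by force
qed
lemma d_adj: "x \<in> carrier A \<Longrightarrow> x' \<in> carrier A \<Longrightarrow> nrm A (adj A x \<ominus> adj A x') = nrm A (x \<ominus> x')"
proof -
  assume a: "x \<in> carrier A" "x' \<in> carrier A"
  have "adj A (\<ominus> x') = \<ominus> adj A x'" using adj_smult[of x' "-1"] a adj_closed smult_m1 by simp
  then have "adj A (x \<ominus> x') = adj A x \<ominus> adj A x'" using a adj_add[of x "\<ominus> x'"] by (simp add: a_minus_def)
  then show ?thesis using nrm_adj[of "x \<ominus> x'"] a by simp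
qed
lemma d_self: "x \<in> carrier A \<Longrightarrow> nrm A (x \<ominus> x) = 0" by (simp add: nrm_zero a_minus_def r_neg)
lemma d_eq0: assumes x: "x \<in> carrier A" and y: "y \<in> carrier A" and 0: "nrm A (x \<ominus> y) = 0" shows "x = y"
proof -
  have "x \<ominus> y = \<zero>" using assms nrm_eq_0_iff by simp
  then have "x \<oplus> \<ominus> y = \<zero>" by (simp add: a_minus_def)
  then have "\<ominus> (\<ominus> y) = x" using x y by (intro minus_equality) simp_all
  then show ?thesis using y by simp
qed
lemma nrm_le_d: "x \<in> carrier A \<Longrightarrow> y \<in> carrier A \<Longrightarrow> nrm A x \<le> nrm A (x \<ominus> y) + nrm A y"
  using d_tri[of x y \<zero>] by (simp add: a_minus_def)
lemma adj_one: "adj A \<one> = \<one>"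
  using adj_mult[of \<one> "adj A \<one>"] adj_adj[of \<one>] adj_closed[of \<one>] by simp

definition cv where "cv X x F \<longleftrightarrow> ((\<lambda>k. nrm A (X k \<ominus> x)) \<longlongrightarrow> 0) F"

lemma tends0F: 
  assumes "\<And>k. 0 \<le> f k" "\<And>k. f k \<le> g k" "(g \<longlongrightarrow> (0::real)) F" shows "(f \<longlongrightarrow> 0) F"
  by (rule tendsto_sandwich[of "\<lambda>_. 0" f _ g]) (use assms in auto)

lemma cv_unique: assumes "\<And>k. X k \<in> carrier A" "x \<in> carrier A" "y \<in> carrier A" "cv X x F" "cv X y F" "F \<noteq> bot"
  shows "x = y"
proof -
  have "((\<lambda>k. nrm A (X k \<ominus> x) + nrm A (X k \<ominus> y)) \<longlongrightarrow> 0) F"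
    using tendsto_add[OF assms(4,5)[unfolded cv_def]] by simp
  moreover have "nrm A (x \<ominus> y) \<le> nrm A (X k \<ominus> x) + nrm A (X k \<ominus> y)" for k
    using d_tri[of x "X k" y] d_comm[of x "X k"] assms by simp
  ultimately have "nrm A (x \<ominus> y) \<le> 0" using tendsto_lowerbound[of _ 0 F "nrm A (x \<ominus> y)"] assms(6) by (simp add: always_eventually)
  then show ?thesis using d_eq0 nrm_nonneg assms by (metis antisym minus_closed)
qed
lemma cv_add: assumes "\<And>k. X k \<in> carrier A" "\<And>k. Y k \<in> carrier A" "x \<in> carrier A" "y \<in> carrier A" "cv X x F" "cv Y y F"
  shows "cv (\<lambda>k. X k \<oplus> Y k) (x \<oplus> y) F"
  unfolding cv_def
  by (rule tends0F[OF _ _ tendsto_add_zero[OF assms(5,6)[unfolded cv_def]]]) (use assms d_add nrm_nonneg in auto)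
lemma cv_smult: assumes "\<And>k. X k \<in> carrier A" "x \<in> carrier A" "cv X x F"
  shows "cv (\<lambda>k. c \<odot> X k) (c \<odot> x) F"
  using tendsto_mult_right_zero[OF assms(3)[unfolded cv_def], of "cmod c"] assms d_smult by (simp add: cv_def)
lemma cv_adj: assumes "\<And>k. X k \<in> carrier A" "x \<in> carrier A" "cv X x F"
  shows "cv (\<lambda>k. adj A (X k)) (adj A x) F"
  using assms d_adj by (simp add: cv_def)
lemma cv_mult: assumes "\<And>k. X k \<in> carrier A" "\<And>k. Y k \<in> carrier A" "x \<in> carrier A" "y \<in> carrier A" "cv X x F" "cv Y y F"
  shows "cv (\<lambda>k. X k \<otimes> Y k) (x \<otimes> y) F"
  unfolding cv_def
proof (rule tends0F)
  fix k
  have "nrm A (Y k) \<le> nrm A (Y k \<ominus> y) + nrm A y" using nrm_le_d assms by simp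
  then have "nrm A (X k \<ominus> x) * nrm A (Y k) \<le> nrm A (X k \<ominus> x) * (nrm A (Y k \<ominus> y) + nrm A y)"
    using nrm_nonneg assms by (intro mult_left_mono) auto
  then show "nrm A (X k \<otimes> Y k \<ominus> x \<otimes> y) \<le> nrm A (X k \<ominus> x) * (nrm A (Y k \<ominus> y) + nrm A y) + nrm A x * nrm A (Y k \<ominus> y)"
    using d_mult[of "X k" "Y k" x y] assms by simp
  note a = assms(5,6)[unfolded cv_def]
  show "((\<lambda>k. nrm A (X k \<ominus> x) * (nrm A (Y k \<ominus> y) + nrm A y) + nrm A x * nrm A (Y k \<ominus> y)) \<longlongrightarrow> 0) F"
    using tendsto_add[OF tendsto_mult[OF a(1) tendsto_add[OF a(2) tendsto_const[of "nrm A y"]]] tendsto_mult[OF tendsto_const[of "nrm A x"] a(2)]] by simp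
qed (use assms nrm_nonneg in auto)
lemma cv_const: "x \<in> carrier A \<Longrightarrow> cv (\<lambda>k. x) x F" by (simp add: cv_def d_self)
lemma cv_nrm: assumes "\<And>k. X k \<in> carrier A" "x \<in> carrier A" "cv X x F" shows "((\<lambda>k. nrm A (X k)) \<longlongrightarrow> nrm A x) F"
proof -
  have "((\<lambda>k. \<bar>nrm A (X k) - nrm A x\<bar>) \<longlongrightarrow> 0) F"
  proof (rule tends0F[OF _ _ assms(3)[unfolded cv_def]])
    fix k show "\<bar>nrm A (X k) - nrm A x\<bar> \<le> nrm A (X k \<ominus> x)"
      using nrm_le_d[of "X k" x] nrm_le_d[of x "X k"] d_comm[of x "X k"] assms by simp
  qed auto
  then have "((\<lambda>k. nrm A (X k) - nrm A x) \<longlongrightarrow> 0) F" by (rule tendsto_rabs_zero_cancel)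
  then show ?thesis by (simp add: LIM_zero_iff)
qed

end

definition pin :: "('p, 'm) monoid_scheme \<Rightarrow> 'p star_poly \<Rightarrow> (nat \<Rightarrow> 'p star_poly) set" where
  "pin P f = cauchy_class (star_polys P) (nica_norm P) (\<lambda>k. f)"

context fixes P :: "('p, 'm) monoid_scheme" begin
interpretation sn: cstar_seminormed "star_polys P" poly_scal poly_star "nica_norm P"
  by (rule seminormed[OF nica_norm_seminorm])
interpretation A: cstar_algebra "semigroup_cstar P" by (rule semigroup_cstar_is_cstar)

lemma sgc: "sn.A = semigroup_cstar P" by (simp add: semigroup_cstar_def)

lemma pin_in: "f \<in> star_polys P \<Longrightarrow> pin P f \<in> carrier (semigroup_cstar P)"
  by (simp add: sgc[symmetric] pin_def sn.car sn.const_C)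
lemma pin_add: "f \<in> star_polys P \<Longrightarrow> g \<in> star_polys P \<Longrightarrow> pin P (f + g) = pin P f \<oplus>\<^bsub>semigroup_cstar P\<^esub> pin P g"
  and pin_mult: "f \<in> star_polys P \<Longrightarrow> g \<in> star_polys P \<Longrightarrow> pin P (f * g) = pin P f \<otimes>\<^bsub>semigroup_cstar P\<^esub> pin P g"
  and pin_scal: "f \<in> star_polys P \<Longrightarrow> pin P (poly_scal c f) = c \<odot>\<^bsub>semigroup_cstar P\<^esub> pin P f"
  and pin_star: "f \<in> star_polys P \<Longrightarrow> pin P (poly_star f) = adj (semigroup_cstar P) (pin P f)"
  and pin_one: "pin P 1 = \<one>\<^bsub>semigroup_cstar P\<^esub>"
  and pin_diff: "f \<in> star_polys P \<Longrightarrow> g \<in> star_polys P \<Longrightarrow> pin P (f - g) = pin P f \<ominus>\<^bsub>semigroup_cstar P\<^esub> pin P g"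
  by (simp_all add: sgc[symmetric] pin_def sn.A_simps sn.A_diff)
lemma pin_gen: "pin P (gen p) = isom P p" by (simp add: pin_def isom_def)
lemma isom_in: "p \<in> carrier P \<Longrightarrow> isom P p \<in> carrier (semigroup_cstar P)"
  by (metis pin_gen pin_in sp_gen)
lemma pin_nrm: "f \<in> star_polys P \<Longrightarrow> nrm (semigroup_cstar P) (pin P f) = nica_norm P f"
  by (simp add: sgc[symmetric] pin_def sn.A_nrm sn.const_C)

lemma pin_eq: assumes "f \<in> star_polys P" "g \<in> star_polys P" "f - g \<in> nica_relators P" shows "pin P f = pin P g"
proof -
  have "nica_norm P (f - g) = 0" using assms nica_norm_seminorm by (auto simp: nica_seminorm_def)
  then show ?thesis using assms by (simp add: pin_def sn.cl_eq sn.const_C sn.eqv_def)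
qed

lemma pin_dense: assumes "a \<in> carrier (semigroup_cstar P)"
  shows "\<exists>f. (\<forall>k::nat. f k \<in> star_polys P) \<and> A.cv (\<lambda>k. pin P (f k)) a sequentially"
proof -
  obtain X where X: "X \<in> sn.C" "a = sn.cl X" using assms by (auto simp: sgc[symmetric] sn.car)
  have XS: "X k \<in> star_polys P" for k using sn.C_S X by auto
  have "A.cv (\<lambda>k. pin P (X k)) a sequentially"
    unfolding A.cv_def LIMSEQ_iff
  proof (intro allI impI)
    fix e :: real assume e: "e > 0"
    obtain M where M: "\<And>i j. i\<ge>M \<Longrightarrow> j\<ge>M \<Longrightarrow> nica_norm P (X i - X j) < e/2" using sn.C_cauchy[OF X(1), of "e/2"] e by auto
    have "norm (nrm (semigroup_cstar P) (pin P (X k) \<ominus>\<^bsub>semigroup_cstar P\<^esub> a) - 0) < e" if k: "k \<ge> M" for k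
    proof -
      have "pin P (X k) \<ominus>\<^bsub>semigroup_cstar P\<^esub> a = sn.cl (\<lambda>l. X k - X l)"
        unfolding pin_def X(2) sgc[symmetric] by (rule sn.A_diff[OF sn.const_C[OF XS] X(1)])
      then have l: "(\<lambda>l. nica_norm P (X k - X l)) \<longlonglongrightarrow> nrm (semigroup_cstar P) (pin P (X k) \<ominus>\<^bsub>semigroup_cstar P\<^esub> a)"
        using sn.A_nrm_lim[OF sn.diff_C[OF sn.const_C[OF XS[of k]] X(1)]] by (simp add: sgc)
      have "nrm (semigroup_cstar P) (pin P (X k) \<ominus>\<^bsub>semigroup_cstar P\<^esub> a) \<le> e/2"
        by (rule LIMSEQ_le_const2[OF l]) (use M k in \<open>auto intro!: exI[of _ M] less_imp_le\<close>)
      moreover have "0 \<le> nrm (semigroup_cstar P) (pin P (X k) \<ominus>\<^bsub>semigroup_cstar P\<^esub> a)"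
        by (rule A.nrm_nonneg) (use assms pin_in XS in auto)
      ultimately show ?thesis using e by simp
    qed
    then show "\<exists>M. \<forall>k\<ge>M. norm (nrm (semigroup_cstar P) (pin P (X k) \<ominus>\<^bsub>semigroup_cstar P\<^esub> a) - 0) < e" by blast
  qed
  then show ?thesis using XS by blast
qed

theorem isom_nica: assumes "Group.monoid P" shows "nica_representation P (semigroup_cstar P) (isom P)"
proof -
  have one: "\<one>\<^bsub>P\<^esub> \<in> carrier P" and m: "\<And>p q. p \<in> carrier P \<Longrightarrow> q \<in> carrier P \<Longrightarrow> p \<otimes>\<^bsub>P\<^esub> q \<in> carrier P"
    using Group.monoid.one_closed[OF assms] Group.monoid.m_closed[OF assms] by simp_all
  note [simp] = sp_gen sn.S_star sn.S_mult sn.S1 one m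
  show ?thesis unfolding nica_representation_def
  proof (intro conjI ballI allI impI)
    fix p assume p [simp]: "p \<in> carrier P"
    show "isom P p \<in> carrier (semigroup_cstar P)" by (simp add: isom_in)
    have "pin P (poly_star (gen p) * gen p) = pin P 1"
      by (rule pin_eq) (use p in \<open>auto simp: nica_relators_def\<close>)
    then show "adj (semigroup_cstar P) (isom P p) \<otimes>\<^bsub>semigroup_cstar P\<^esub> isom P p = \<one>\<^bsub>semigroup_cstar P\<^esub>"
      by (simp add: pin_mult pin_star pin_gen pin_one)
    fix q assume q [simp]: "q \<in> carrier P"
    have "pin P (gen p * gen q) = pin P (gen (p \<otimes>\<^bsub>P\<^esub> q))"
      by (rule pin_eq) (simp_all, unfold nica_relators_def, use p q in blast)
    then show "isom P p \<otimes>\<^bsub>semigroup_cstar P\<^esub> isom P q = isom P (p \<otimes>\<^bsub>P\<^esub> q)"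
      by (simp add: pin_mult pin_gen)
    fix r assume r: "is_rlcm P p q r"
    then have [simp]: "r \<in> carrier P" by (simp add: is_rlcm_def)
    have "pin P (gen p * poly_star (gen p) * gen q * poly_star (gen q)) = pin P (gen r * poly_star (gen r))"
      by (rule pin_eq) (simp_all, unfold nica_relators_def, use p q r in blast)
    then show "isom P p \<otimes>\<^bsub>semigroup_cstar P\<^esub> adj (semigroup_cstar P) (isom P p) \<otimes>\<^bsub>semigroup_cstar P\<^esub>
        isom P q \<otimes>\<^bsub>semigroup_cstar P\<^esub> adj (semigroup_cstar P) (isom P q) =
        isom P r \<otimes>\<^bsub>semigroup_cstar P\<^esub> adj (semigroup_cstar P) (isom P r)"
      by (simp add: pin_mult pin_star pin_gen)
  next
    have "pin P (gen \<one>\<^bsub>P\<^esub>) = pin P 1"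
      by (rule pin_eq) (auto simp: nica_relators_def)
    then show "isom P \<one>\<^bsub>P\<^esub> = \<one>\<^bsub>semigroup_cstar P\<^esub>" by (simp add: pin_gen pin_one)
  qed
qed
end


section \<open>Universal property\<close>

lemma poly_ind [case_names zero single add]:
  fixes f :: "'p star_poly"
  assumes "Q 0" "\<And>u c. Q (Poly_Mapping.single u c)" "\<And>f g. Q f \<Longrightarrow> Q g \<Longrightarrow> Q (f + g)"
  shows "Q f"
proof -
  have "finite I \<Longrightarrow> Q (\<Sum>u\<in>I. Poly_Mapping.single u (lookup f u))" for I
    by (induction I rule: finite_induct) (auto intro: assms)
  then show ?thesis using poly_sum[of f] finite_keys[of f] by metis
qed

locale nica_rep = cstar_algebra B for B :: "('b, 'k) star_algebra_scheme" (structure) +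
  fixes P :: "('p, 'm) monoid_scheme" and w
  assumes mon: "Group.monoid P" and rep: "nica_representation P B w"
begin

definition w' where "w' p = (if p \<in> carrier P then w p else \<one>)"
primrec lv where "lv (Isom p) = w' p" | "lv (Coisom p) = adj B (w' p)"
primrec evl where "evl [] = \<one>" | "evl (l # ls) = lv l \<otimes> evl ls"
definition ev where "ev f = finsum B (\<lambda>u. lookup f u \<odot> evl (letters u)) (Poly_Mapping.keys f)"

lemma w'_in [simp]: "w' p \<in> carrier B" using rep by (simp add: w'_def nica_representation_def)
lemma lv_in [simp]: "lv l \<in> carrier B" by (cases l) (auto intro: adj_closed)
lemma evl_in [simp]: "evl ls \<in> carrier B" by (induction ls) auto
lemma sm_in [simp]: "x \<in> carrier B \<Longrightarrow> c \<odot> x \<in> carrier B" by (rule smult_in)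
lemma ev_in [simp]: "ev f \<in> carrier B" unfolding ev_def by (rule finsum_closed) auto
lemma evl_app: "evl (ls @ ms) = evl ls \<otimes> evl ms" by (induction ls) (auto simp: m_assoc)
lemma sm0: "x \<in> carrier B \<Longrightarrow> 0 \<odot> x = \<zero>" using scalar.smult_l_null[of x] by (simp add: complex_ring_def)
lemma sm_add: "x \<in> carrier B \<Longrightarrow> (c + d) \<odot> x = c \<odot> x \<oplus> d \<odot> x" using scalar.smult_l_distr[of c d x] by (simp add: complex_ring_def)
lemma sm_add_r: "x \<in> carrier B \<Longrightarrow> y \<in> carrier B \<Longrightarrow> c \<odot> (x \<oplus> y) = c \<odot> x \<oplus> c \<odot> y" using scalar.smult_r_distr[of c x y] by (simp add: complex_ring_def)
lemma sm_sm: "x \<in> carrier B \<Longrightarrow> (c * d) \<odot> x = c \<odot> (d \<odot> x)" using scalar.smult_assoc1[of c d x] by (simp add: complex_ring_def)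
lemma sm_1: "x \<in> carrier B \<Longrightarrow> 1 \<odot> x = x" using scalar.smult_one[of x] by (simp add: complex_ring_def)
lemma sm_z: "c \<odot> \<zero> = \<zero>" using sm_sm[of \<zero> c 0] sm0[of \<zero>] by simp

lemma ev_super: assumes "finite I" "Poly_Mapping.keys f \<subseteq> I"
  shows "ev f = finsum B (\<lambda>u. lookup f u \<odot> evl (letters u)) I"
  unfolding ev_def
  by (rule add.finprod_mono_neutral_cong_left) (use assms in \<open>auto simp: in_keys_iff sm0\<close>)

lemma ev_add: "ev (f + g) = ev f \<oplus> ev g"
proof -
  let ?I = "Poly_Mapping.keys f \<union> Poly_Mapping.keys g"
  have "ev (f + g) = finsum B (\<lambda>u. lookup (f+g) u \<odot> evl (letters u)) ?I"
    by (rule ev_super) (use keys_add[of f g] in auto)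
  also have "\<dots> = finsum B (\<lambda>u. lookup f u \<odot> evl (letters u) \<oplus> lookup g u \<odot> evl (letters u)) ?I"
    by (simp add: lookup_add sm_add)
  also have "\<dots> = finsum B (\<lambda>u. lookup f u \<odot> evl (letters u)) ?I \<oplus> finsum B (\<lambda>u. lookup g u \<odot> evl (letters u)) ?I"
    by (rule finsum_addf) auto
  also have "\<dots> = ev f \<oplus> ev g" using ev_super[of ?I f] ev_super[of ?I g] by simp
  finally show ?thesis .
qed
lemma ev_single: "ev (Poly_Mapping.single u c) = c \<odot> evl (letters u)"
  by (cases "c = 0") (auto simp: ev_def sm0)
lemma ev_0: "ev 0 = \<zero>" by (simp add: ev_def)
lemma ev_1: "ev 1 = \<one>" using ev_single[of 0 1, unfolded single_one] by (simp add: zero_word_def sm_1)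
lemma ev_mult1: "ev (Poly_Mapping.single u c * g) = ev (Poly_Mapping.single u c) \<otimes> ev g"
proof (induction g rule: poly_ind)
  case zero show ?case by (simp add: ev_0)
next
  case (single v d) show ?case
    by (simp add: mult_single ev_single plus_word_def evl_app smult_mult_left smult_mult_right sm_sm[symmetric] mult.commute)
next
  case (add f g) then show ?case by (simp add: distrib_left ev_add r_distr)
qed
lemma ev_mult: "ev (f * g) = ev f \<otimes> ev g"
proof (induction f rule: poly_ind)
  case zero show ?case by (simp add: ev_0)
next
  case (single v d) show ?case by (rule ev_mult1)
next
  case (add f g) then show ?case by (simp add: distrib_right ev_add l_distr)
qed
lemma ev_scal: "ev (poly_scal c f) = c \<odot> ev f"
  using ev_mult[of "Poly_Mapping.single 0 c" f] by (simp add: poly_scal_def ev_single zero_word_def smult_mult_left)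
lemma lv_flip: "lv (flip_letter l) = adj B (lv l)" by (cases l) (auto simp: adj_adj)
lemma evl_rev: "evl (rev (map flip_letter ls)) = adj B (evl ls)"
  by (induction ls) (auto simp: adj_one evl_app adj_mult lv_flip adj_closed)
lemma adj_zero: "adj B \<zero> = \<zero>" using adj_smult[of \<zero> 0] sm0 adj_closed[of \<zero>] by simp
lemma ev_star: "ev (poly_star f) = adj B (ev f)"
proof (induction f rule: poly_ind)
  case zero show ?case by (simp add: ev_0 poly_star_0 adj_zero)
next
  case (single v d) show ?case by (simp add: poly_star_single ev_single word_adj_def evl_rev adj_smult)
next
  case (add f g) then show ?case by (simp add: poly_star_add ev_add adj_add)
qed
lemma ev_diff: "ev (f - g) = ev f \<ominus> ev g"
proof -
  have "ev (- g) = (-1) \<odot> ev g" using ev_scal[of "-1" g] by (simp add: poly_scal_def single_uminus)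
  then show ?thesis using ev_add[of f "- g"] by (simp add: a_minus_def smult_m1)
qed
lemma ev_gen: "p \<in> carrier P \<Longrightarrow> ev (gen p) = w p" 
  using w'_in[of p] by (simp add: gen_def ev_single w'_def sm_1)

lemma ev_seminorm: "nica_seminorm P (\<lambda>f. nrm B (ev f))"
proof -
  have one: "\<one>\<^bsub>P\<^esub> \<in> carrier P" and m: "\<And>p q. p \<in> carrier P \<Longrightarrow> q \<in> carrier P \<Longrightarrow> p \<otimes>\<^bsub>P\<^esub> q \<in> carrier P"
    using Group.monoid.one_closed[OF mon] Group.monoid.m_closed[OF mon] by simp_all
  have "nrm B (ev x) = 0" if "x \<in> nica_relators P" for x
  proof -
    have "\<exists>a b. x = a - b \<and> ev a = ev b" 
      using that rep unfolding nica_relators_def nica_representation_def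
    proof (elim UnE)
      assume "x \<in> {gen p * poly_star (gen p) * gen q * poly_star (gen q) - gen r * poly_star (gen r)
       | p q r. p \<in> carrier P \<and> q \<in> carrier P \<and> is_rlcm P p q r}"
      then obtain p q r where x: "x = gen p * poly_star (gen p) * gen q * poly_star (gen q) - gen r * poly_star (gen r)"
        and pq: "p \<in> carrier P" "q \<in> carrier P" and r: "is_rlcm P p q r" by blast
      have rc: "r \<in> carrier P" using r by (simp add: is_rlcm_def)
      have "ev (gen p * poly_star (gen p) * gen q * poly_star (gen q)) = ev (gen r * poly_star (gen r))"
        using rep pq r rc unfolding nica_representation_def by (simp add: ev_mult ev_star ev_gen)
      then show ?thesis using x by blast
    next
      assume "x \<in> {poly_star (gen p) * gen p - 1 |p. p \<in> carrier P}"
      then obtain p where x: "x = poly_star (gen p) * gen p - 1" and p: "p \<in> carrier P" by blast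
      have "ev (poly_star (gen p) * gen p) = ev 1" using p rep unfolding nica_representation_def by (simp add: ev_mult ev_star ev_gen ev_1)
      then show ?thesis using x by blast
    next
      assume x: "x \<in> {gen \<one>\<^bsub>P\<^esub> - 1}"
      have "ev (gen \<one>\<^bsub>P\<^esub>) = ev 1" using one rep unfolding nica_representation_def by (simp add: ev_gen ev_1)
      then show ?thesis using x by blast
    next
      assume "x \<in> {gen p * gen q - gen (p \<otimes>\<^bsub>P\<^esub> q) | p q. p \<in> carrier P \<and> q \<in> carrier P}"
      then obtain p q where x: "x = gen p * gen q - gen (p \<otimes>\<^bsub>P\<^esub> q)" and p: "p \<in> carrier P" "q \<in> carrier P" by blast
      have "ev (gen p * gen q) = ev (gen (p \<otimes>\<^bsub>P\<^esub> q))" using p m rep unfolding nica_representation_def by (simp add: ev_mult ev_gen)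
      then show ?thesis using x by blast
    qed
    then obtain a b where "x = a - b" "ev a = ev b" by blast
    then show ?thesis by (simp add: ev_diff d_self)
  qed
  then show ?thesis unfolding nica_seminorm_def cstar_seminorm_def
    by (auto simp: ev_add ev_mult ev_scal ev_star nrm_nonneg nrm_triangle nrm_smult nrm_mult nrm_cstar)
qed

sublocale sn: cstar_seminormed "star_polys P" poly_scal poly_star "nica_norm P"
  by (rule seminormed[OF nica_norm_seminorm])

lemma ev_le: "f \<in> star_polys P \<Longrightarrow> nrm B (ev f) \<le> nica_norm P f"
  using norm_ub[OF ev_seminorm] .

definition h where "h a = (SOME b. b \<in> carrier B \<and> cv (\<lambda>k. ev (class_rep a k)) b sequentially)"

lemma ev_conv: assumes "X \<in> sn.C" shows "\<exists>b. b \<in> carrier B \<and> cv (\<lambda>k. ev (X k)) b sequentially"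
proof -
  have "\<exists>b\<in>carrier B. (\<lambda>k. nrm B (ev (X k) \<ominus> b)) \<longlonglongrightarrow> 0"
  proof (rule complete)
    fix e :: real assume "e > 0"
    then obtain M where M: "\<forall>i\<ge>M. \<forall>j\<ge>M. nica_norm P (X i - X j) < e" using sn.C_cauchy[OF assms] by blast
    have "nrm B (ev (X i) \<ominus> ev (X j)) \<le> nica_norm P (X i - X j)" for i j
      using ev_le[of "X i - X j"] sn.S_diff sn.C_S[OF assms] by (simp add: ev_diff)
    then show "\<exists>M. \<forall>i\<ge>M. \<forall>j\<ge>M. nrm B (ev (X i) \<ominus> ev (X j)) < e" using M by (meson le_less_trans)
  qed auto
  then show ?thesis by (auto simp: cv_def)
qed

lemma h_cl: assumes X: "X \<in> sn.C" shows "h (sn.cl X) \<in> carrier B" "cv (\<lambda>k. ev (X k)) (h (sn.cl X)) sequentially"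
proof -
  let ?Y = "class_rep (sn.cl X)"
  have *: "h (sn.cl X) \<in> carrier B \<and> cv (\<lambda>k. ev (?Y k)) (h (sn.cl X)) sequentially"
    unfolding h_def by (rule someI_ex) (rule ev_conv[OF sn.rep_C[OF X]])
  then show "h (sn.cl X) \<in> carrier B" by blast
  show "cv (\<lambda>k. ev (X k)) (h (sn.cl X)) sequentially" unfolding cv_def
  proof (rule tends0F)
    fix k
    have "nrm B (ev (X k) \<ominus> h (sn.cl X)) \<le> nrm B (ev (X k) \<ominus> ev (?Y k)) + nrm B (ev (?Y k) \<ominus> h (sn.cl X))"
      using d_tri * by simp
    moreover have "nrm B (ev (X k) \<ominus> ev (?Y k)) \<le> nica_norm P (X k - ?Y k)"
      using ev_le[of "X k - ?Y k"] sn.S_diff sn.C_S[OF X] sn.C_S[OF sn.rep_C[OF X]] by (simp add: ev_diff)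
    ultimately show "nrm B (ev (X k) \<ominus> h (sn.cl X)) \<le> nica_norm P (X k - ?Y k) + nrm B (ev (?Y k) \<ominus> h (sn.cl X))" by simp
    show "((\<lambda>k. nica_norm P (X k - ?Y k) + nrm B (ev (?Y k) \<ominus> h (sn.cl X))) \<longlonglongrightarrow> 0)"
      using tendsto_add_zero[OF sn.rep_eqv[OF X, unfolded sn.eqv_def]] * by (simp add: cv_def)
  qed (use * nrm_nonneg in auto)
qed

lemma sg: "semigroup_cstar P = sn.A" by (simp add: semigroup_cstar_def)

lemma h_eqI: "X \<in> sn.C \<Longrightarrow> b \<in> carrier B \<Longrightarrow> cv (\<lambda>k. ev (X k)) b sequentially \<Longrightarrow> h (sn.cl X) = b"
  by (rule cv_unique[of "\<lambda>k. ev (X k)" _ _ sequentially]) (auto intro: h_cl)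

lemma h_isom: "p \<in> carrier P \<Longrightarrow> h (isom P p) = w p"
  unfolding isom_def using ev_gen[of p] ev_in[of "gen p"] by (intro h_eqI sn.const_C sp_gen) (auto intro: cv_const)

lemma h_contr: assumes "a \<in> carrier (semigroup_cstar P)" shows "nrm B (h a) \<le> nrm (semigroup_cstar P) a"
proof -
  obtain X where X: "X \<in> sn.C" "a = sn.cl X" using assms by (auto simp: sg sn.car)
  have "(\<lambda>k. nrm B (ev (X k))) \<longlonglongrightarrow> nrm B (h a)" unfolding X(2) by (rule cv_nrm) (use h_cl[OF X(1)] in auto)
  then show ?thesis unfolding sg X(2)
    by (rule LIMSEQ_le[OF _ sn.A_nrm_lim[OF X(1)]]) (use ev_le sn.C_S[OF X(1)] X in auto)
qed

lemma h_hom: "star_hom (semigroup_cstar P) B h"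
  unfolding star_hom_def
proof (intro conjI ballI allI)
  show "h \<one>\<^bsub>semigroup_cstar P\<^esub> = \<one>" unfolding sg sn.A_one
    by (rule h_eqI) (auto simp: ev_1 intro: cv_const sn.const_C sn.S1)
  fix x assume "x \<in> carrier (semigroup_cstar P)"
  then obtain X where X: "X \<in> sn.C" "x = sn.cl X" by (auto simp: sg sn.car)
  note hX = h_cl[OF X(1)]
  show "h x \<in> carrier B" using hX X by simp
  show "h (c \<odot>\<^bsub>semigroup_cstar P\<^esub> x) = c \<odot> h x" for c
    unfolding sg X(2) sn.A_smult[OF X(1)] using hX
    by (intro h_eqI sn.scal_C X) (auto simp: ev_scal intro!: cv_smult)
  show "h (adj (semigroup_cstar P) x) = adj B (h x)"
    unfolding sg X(2) sn.A_adj[OF X(1)] using hX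
    by (intro h_eqI sn.star_C X) (auto simp: ev_star intro!: cv_adj adj_closed)
  fix y assume "y \<in> carrier (semigroup_cstar P)"
  then obtain Y where Y: "Y \<in> sn.C" "y = sn.cl Y" by (auto simp: sg sn.car)
  note hY = h_cl[OF Y(1)]
  show "h (x \<oplus>\<^bsub>semigroup_cstar P\<^esub> y) = h x \<oplus> h y"
    unfolding sg X(2) Y(2) sn.A_add[OF X(1) Y(1)] using hX hY
    by (intro h_eqI sn.add_C X Y) (auto simp: ev_add intro!: cv_add)
  show "h (x \<otimes>\<^bsub>semigroup_cstar P\<^esub> y) = h x \<otimes> h y"
    unfolding sg X(2) Y(2) sn.A_mult[OF X(1) Y(1)] using hX hY
    by (intro h_eqI sn.mult_C X Y) (auto simp: ev_mult intro!: cv_mult)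
qed

end

theorem semigroup_cstar_universal:
  assumes "Group.monoid P" "cstar_algebra B" "nica_representation P B w"
  shows "\<exists>h. star_hom (semigroup_cstar P) B h \<and>
     (\<forall>a\<in>carrier (semigroup_cstar P). nrm B (h a) \<le> nrm (semigroup_cstar P) a) \<and>
     (\<forall>p\<in>carrier P. h (isom P p) = w p)"
proof -
  interpret nica_rep B P w using assms by (simp add: nica_rep_def nica_rep_axioms_def)
  show ?thesis using h_hom h_contr h_isom by blast
qed


section \<open>Existence of the dynamics; length on the braid monoid\<close>

locale semigroup_dynamics =
  fixes P :: "('p, 'm) monoid_scheme" and N :: "'p \<Rightarrow> real"
  assumes mon: "Group.monoid P" and Npos: "\<And>p. p \<in> carrier P \<Longrightarrow> N p > 0"
    and N1: "N \<one>\<^bsub>P\<^esub> = 1"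
    and Nmult: "\<And>p q. p \<in> carrier P \<Longrightarrow> q \<in> carrier P \<Longrightarrow> N (p \<otimes>\<^bsub>P\<^esub> q) = N p * N q"
begin

abbreviation "A \<equiv> semigroup_cstar P"
sublocale cstar_algebra A by (rule semigroup_cstar_is_cstar)

definition ch where "ch t p = complex_of_real (N p) powr (\<i> * complex_of_real t)"

lemma ch_eq: "p \<in> carrier P \<Longrightarrow> ch t p = cis (t * ln (N p))"
  using Npos[of p] by (simp add: ch_def powr_def cis_conv_exp Ln_of_real mult_ac)

lemma sm_m: "x \<in> carrier A \<Longrightarrow> (c * d) \<odot>\<^bsub>A\<^esub> x = c \<odot>\<^bsub>A\<^esub> (d \<odot>\<^bsub>A\<^esub> x)" using scalar.smult_assoc1[of c d x] by (simp add: complex_ring_def)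
lemma sm1: "x \<in> carrier A \<Longrightarrow> 1 \<odot>\<^bsub>A\<^esub> x = x" using scalar.smult_one[of x] by (simp add: complex_ring_def)

lemma rep_t: "nica_representation P A (\<lambda>p. ch t p \<odot>\<^bsub>A\<^esub> isom P p)"
proof -
  have one: "\<one>\<^bsub>P\<^esub> \<in> carrier P" and m: "\<And>p q. p \<in> carrier P \<Longrightarrow> q \<in> carrier P \<Longrightarrow> p \<otimes>\<^bsub>P\<^esub> q \<in> carrier P"
    using Group.monoid.one_closed[OF mon] Group.monoid.m_closed[OF mon] by simp_all
  note R = isom_nica[OF mon, unfolded nica_representation_def]
  have c1: "cnj (ch t p) * ch t p = 1" "ch t p * cnj (ch t p) = 1" if "p \<in> carrier P" for p
    using that by (simp_all add: ch_eq cis_cnj cis_mult)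
  have i: "\<And>p. p \<in> carrier P \<Longrightarrow> isom P p \<in> carrier A" using R by blast
  have pp: "(ch t p \<odot>\<^bsub>A\<^esub> isom P p) \<otimes>\<^bsub>A\<^esub> adj A (ch t p \<odot>\<^bsub>A\<^esub> isom P p) = isom P p \<otimes>\<^bsub>A\<^esub> adj A (isom P p)" if "p \<in> carrier P" for p
    using that i by (simp add: adj_smult smult_mult_left smult_mult_right adj_closed smult_in sm_m[symmetric] c1 sm1)
  show ?thesis unfolding nica_representation_def
  proof (intro conjI ballI allI impI)
    show "ch t \<one>\<^bsub>P\<^esub> \<odot>\<^bsub>A\<^esub> isom P \<one>\<^bsub>P\<^esub> = \<one>\<^bsub>A\<^esub>" using R one by (simp add: ch_eq N1 sm1)
    fix p assume p: "p \<in> carrier P"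
    show "ch t p \<odot>\<^bsub>A\<^esub> isom P p \<in> carrier A" using i p smult_in by blast
    show "adj A (ch t p \<odot>\<^bsub>A\<^esub> isom P p) \<otimes>\<^bsub>A\<^esub> (ch t p \<odot>\<^bsub>A\<^esub> isom P p) = \<one>\<^bsub>A\<^esub>"
      using p i R by (simp add: adj_smult smult_mult_left smult_mult_right adj_closed smult_in sm_m[symmetric] c1 sm1)
    fix q assume q: "q \<in> carrier P"
    have "ch t p * ch t q = ch t (p \<otimes>\<^bsub>P\<^esub> q)" using p q m Npos[OF p] Npos[OF q] by (simp add: ch_eq Nmult cis_mult ln_mult distrib_left)
    then show "(ch t p \<odot>\<^bsub>A\<^esub> isom P p) \<otimes>\<^bsub>A\<^esub> (ch t q \<odot>\<^bsub>A\<^esub> isom P q) = ch t (p \<otimes>\<^bsub>P\<^esub> q) \<odot>\<^bsub>A\<^esub> isom P (p \<otimes>\<^bsub>P\<^esub> q)"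
      using p q i[OF p] i[OF q] i[OF m[OF p q]] R by (simp add: smult_mult_left smult_mult_right smult_in sm_m[symmetric] mult.commute)
    fix r assume r: "is_rlcm P p q r"
    then have rc: "r \<in> carrier P" by (simp add: is_rlcm_def)
    have in': "ch t q \<odot>\<^bsub>A\<^esub> isom P q \<in> carrier A" "adj A (ch t q \<odot>\<^bsub>A\<^esub> isom P q) \<in> carrier A" using i q smult_in adj_closed by auto
    have "isom P p \<otimes>\<^bsub>A\<^esub> adj A (isom P p) \<otimes>\<^bsub>A\<^esub> (ch t q \<odot>\<^bsub>A\<^esub> isom P q) \<otimes>\<^bsub>A\<^esub> adj A (ch t q \<odot>\<^bsub>A\<^esub> isom P q)
       = isom P p \<otimes>\<^bsub>A\<^esub> adj A (isom P p) \<otimes>\<^bsub>A\<^esub> (isom P q \<otimes>\<^bsub>A\<^esub> adj A (isom P q))"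
      using in' i p q adj_closed pp[OF q] by (simp add: m_assoc)
    also have "\<dots> = isom P p \<otimes>\<^bsub>A\<^esub> adj A (isom P p) \<otimes>\<^bsub>A\<^esub> isom P q \<otimes>\<^bsub>A\<^esub> adj A (isom P q)" using i p q adj_closed by (simp add: m_assoc)
    also have "\<dots> = isom P r \<otimes>\<^bsub>A\<^esub> adj A (isom P r)" using R p q r by blast
    finally show "(ch t p \<odot>\<^bsub>A\<^esub> isom P p) \<otimes>\<^bsub>A\<^esub> adj A (ch t p \<odot>\<^bsub>A\<^esub> isom P p) \<otimes>\<^bsub>A\<^esub> (ch t q \<odot>\<^bsub>A\<^esub> isom P q) \<otimes>\<^bsub>A\<^esub> adj A (ch t q \<odot>\<^bsub>A\<^esub> isom P q)
     = (ch t r \<odot>\<^bsub>A\<^esub> isom P r) \<otimes>\<^bsub>A\<^esub> adj A (ch t r \<odot>\<^bsub>A\<^esub> isom P r)" using pp p rc by simp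
  qed
qed

definition sig where "sig = (\<lambda>t. SOME h. star_hom A A h \<and>
     (\<forall>a\<in>carrier A. nrm A (h a) \<le> nrm A a) \<and>
     (\<forall>p\<in>carrier P. h (isom P p) = ch t p \<odot>\<^bsub>A\<^esub> isom P p))"

lemma sig: "star_hom A A (sig t)" "a \<in> carrier A \<Longrightarrow> nrm A (sig t a) \<le> nrm A a"
  "p \<in> carrier P \<Longrightarrow> sig t (isom P p) = ch t p \<odot>\<^bsub>A\<^esub> isom P p"
  using someI_ex[OF semigroup_cstar_universal[OF mon semigroup_cstar_is_cstar rep_t[of t]]] unfolding sig_def by blast+

lemma sg: "a \<in> carrier A \<Longrightarrow> sig t a \<in> carrier A" "sig t \<one>\<^bsub>A\<^esub> = \<one>\<^bsub>A\<^esub>"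
  "a \<in> carrier A \<Longrightarrow> b \<in> carrier A \<Longrightarrow> sig t (a \<oplus>\<^bsub>A\<^esub> b) = sig t a \<oplus>\<^bsub>A\<^esub> sig t b"
  "a \<in> carrier A \<Longrightarrow> b \<in> carrier A \<Longrightarrow> sig t (a \<otimes>\<^bsub>A\<^esub> b) = sig t a \<otimes>\<^bsub>A\<^esub> sig t b"
  "a \<in> carrier A \<Longrightarrow> sig t (c \<odot>\<^bsub>A\<^esub> a) = c \<odot>\<^bsub>A\<^esub> sig t a"
  "a \<in> carrier A \<Longrightarrow> sig t (adj A a) = adj A (sig t a)"
  using sig(1)[of t] unfolding star_hom_def by blast+

lemma sig_diff: "a \<in> carrier A \<Longrightarrow> b \<in> carrier A \<Longrightarrow> nrm A (sig t a \<ominus>\<^bsub>A\<^esub> sig t b) \<le> nrm A (a \<ominus>\<^bsub>A\<^esub> b)"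
proof -
  assume a: "a \<in> carrier A" "b \<in> carrier A"
  have "sig t (a \<ominus>\<^bsub>A\<^esub> b) = sig t a \<ominus>\<^bsub>A\<^esub> sig t b"
    using a smult_m1[of b] smult_m1[of "sig t b"] sg(5)[of b t "-1"] sg(3)[of a "\<ominus>\<^bsub>A\<^esub> b" t] sg(1) by (simp add: a_minus_def)
  then show ?thesis using sig(2)[of "a \<ominus>\<^bsub>A\<^esub> b" t] a by simp
qed

lemma cv_sig: assumes "\<And>k. X k \<in> carrier A" "a \<in> carrier A" "cv X a F" shows "cv (\<lambda>k. sig t (X k)) (sig t a) F"
  unfolding cv_def by (rule tends0F[OF _ _ assms(3)[unfolded cv_def]]) (use assms sig_diff sg nrm_nonneg in auto)

lemma agree_pin: assumes f: "f \<in> star_polys P" shows "sig (s + t) (pin P f) = sig s (sig t (pin P f))" 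
  using f
proof (induction rule: star_polys_induct)
  case one show ?case by (simp add: pin_one sg)
next
  case (gen p)
  have i: "isom P p \<in> carrier A" using isom_in gen .
  have "ch (s + t) p = ch t p * ch s p" using gen by (simp add: ch_eq cis_mult distrib_right add.commute)
  then show ?case using gen i by (simp add: pin_gen sig sg smult_in sm_m)
next
  case (add f g) then show ?case by (simp add: pin_add pin_in sg)
next
  case (mult f g) then show ?case by (simp add: pin_mult pin_in sg)
next
  case (scal c f) then show ?case by (simp add: pin_scal pin_in sg)
next
  case (star f) then show ?case by (simp add: pin_star pin_in sg)
qed

lemma id_pin: assumes f: "f \<in> star_polys P" shows "sig 0 (pin P f) = pin P f" 
  using f
proof (induction rule: star_polys_induct)
  case one show ?case by (simp add: pin_one sg)
next
  case (gen p)
  have i: "isom P p \<in> carrier A" using isom_in gen .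
  then show ?case using gen by (simp add: pin_gen sig sm1 ch_eq)
next
  case (add f g) then show ?case by (simp add: pin_add pin_in sg)
next
  case (mult f g) then show ?case by (simp add: pin_mult pin_in sg)
next
  case (scal c f) then show ?case by (simp add: pin_scal pin_in sg)
next
  case (star f) then show ?case by (simp add: pin_star pin_in sg)
qed

lemma cont_pin: assumes f: "f \<in> star_polys P" shows "cv (\<lambda>s. sig s (pin P f)) (sig t (pin P f)) (at t)" 
  using f
proof (induction rule: star_polys_induct)
  case one show ?case by (simp add: pin_one sg cv_const)
next
  case (gen p)
  have i: "isom P p \<in> carrier A" using isom_in gen .
  have d: "nrm A (c \<odot>\<^bsub>A\<^esub> isom P p \<ominus>\<^bsub>A\<^esub> d \<odot>\<^bsub>A\<^esub> isom P p) = cmod (c - d) * nrm A (isom P p)" for c d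
  proof -
    have "(c - d) \<odot>\<^bsub>A\<^esub> isom P p = c \<odot>\<^bsub>A\<^esub> isom P p \<oplus>\<^bsub>A\<^esub> (- d) \<odot>\<^bsub>A\<^esub> isom P p"
      using scalar.smult_l_distr[of c "-d" "isom P p"] i by (simp add: complex_ring_def)
    also have "(- d) \<odot>\<^bsub>A\<^esub> isom P p = \<ominus>\<^bsub>A\<^esub> (d \<odot>\<^bsub>A\<^esub> isom P p)"
      using sm_m[OF i, of "-1" d] smult_m1[of "d \<odot>\<^bsub>A\<^esub> isom P p"] i smult_in by simp
    finally show ?thesis using nrm_smult[OF i, of "c - d"] by (simp add: a_minus_def)
  qed
  have "((\<lambda>s. cmod (cis (s * ln (N p)) - cis (t * ln (N p))) * nrm A (isom P p)) \<longlongrightarrow> cmod (cis (t * ln (N p)) - cis (t * ln (N p))) * nrm A (isom P p)) (at t)"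
    by (intro tendsto_intros tendsto_cis)
  then show ?case using gen by (simp add: pin_gen sig cv_def d ch_eq)
next
  case (add f g) then show ?case by (auto simp: pin_add pin_in sg intro!: cv_add)
next
  case (mult f g) then show ?case by (auto simp: pin_mult pin_in sg intro!: cv_mult)
next
  case (scal c f) then show ?case by (auto simp: pin_scal pin_in sg intro!: cv_smult)
next
  case (star f) then show ?case by (auto simp: pin_star pin_in sg intro!: cv_adj)
qed

lemma dyn: "dynamics A sig"
  unfolding dynamics_def
proof (intro conjI allI ballI)
  fix t show "star_hom A A (sig t)" by (rule sig)
next
  fix a assume a: "a \<in> carrier A"
  obtain f where f: "\<And>k::nat. f k \<in> star_polys P" "cv (\<lambda>k. pin P (f k)) a sequentially" using pin_dense[OF a] by blast
  note fc = pin_in[OF f(1)]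
  show "sig 0 a = a"
    by (rule cv_unique[of "\<lambda>k. sig 0 (pin P (f k))" _ _ sequentially]) 
      (use f fc a cv_sig[of "\<lambda>k. pin P (f k)" a sequentially 0] sg id_pin in auto)
  show "sig (s + t) a = sig s (sig t a)" for s t
    by (rule cv_unique[of "\<lambda>k. sig (s + t) (pin P (f k))" _ _ sequentially]) 
      (use f fc a cv_sig[of "\<lambda>k. pin P (f k)" a sequentially "s+t"] 
         cv_sig[of "\<lambda>k. sig t (pin P (f k))" "sig t a" sequentially s]
         cv_sig[of "\<lambda>k. pin P (f k)" a sequentially t] sg agree_pin in auto)
  show "((\<lambda>s. nrm A (sig s a \<ominus>\<^bsub>A\<^esub> sig t a)) \<longlongrightarrow> 0) (at t)" for t
  proof (rule tendstoI)
    fix e :: real assume e: "e > 0"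
    have "\<forall>\<^sub>F k in sequentially. nrm A (pin P (f k) \<ominus>\<^bsub>A\<^esub> a) < e/3" 
      using f(2) e unfolding cv_def by (intro order_tendstoD(2)[of _ 0]) simp_all
    then obtain k where k: "nrm A (pin P (f k) \<ominus>\<^bsub>A\<^esub> a) < e/3" using eventually_happens'[OF sequentially_bot] by blast
    let ?b = "pin P (f k)"
    have "\<forall>\<^sub>F s in at t. nrm A (sig s ?b \<ominus>\<^bsub>A\<^esub> sig t ?b) < e/3"
      using cont_pin[OF f(1)[of k], of t] e unfolding cv_def by (intro order_tendstoD(2)[of _ 0]) simp_all
    then show "\<forall>\<^sub>F s in at t. dist (nrm A (sig s a \<ominus>\<^bsub>A\<^esub> sig t a)) 0 < e"
    proof eventually_elim
      case (elim s)
      have "nrm A (sig s a \<ominus>\<^bsub>A\<^esub> sig t a) \<le> nrm A (sig s a \<ominus>\<^bsub>A\<^esub> sig s ?b) + nrm A (sig s ?b \<ominus>\<^bsub>A\<^esub> sig t a)"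
        using d_tri sg a fc by simp
      moreover have "nrm A (sig s ?b \<ominus>\<^bsub>A\<^esub> sig t a) \<le> nrm A (sig s ?b \<ominus>\<^bsub>A\<^esub> sig t ?b) + nrm A (sig t ?b \<ominus>\<^bsub>A\<^esub> sig t a)"
        using d_tri sg a fc by simp
      moreover have "nrm A (sig s a \<ominus>\<^bsub>A\<^esub> sig s ?b) \<le> nrm A (?b \<ominus>\<^bsub>A\<^esub> a)" using sig_diff[of a ?b s] d_comm[of a ?b] a fc by simp
      moreover have "nrm A (sig t ?b \<ominus>\<^bsub>A\<^esub> sig t a) \<le> nrm A (?b \<ominus>\<^bsub>A\<^esub> a)" using sig_diff a fc by simp
      moreover have "0 \<le> nrm A (sig s a \<ominus>\<^bsub>A\<^esub> sig t a)" using nrm_nonneg sg a by simp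
      ultimately show ?case using elim k by simp
    qed
  qed
qed

end

theorem dynamics_exists:
  assumes "Group.monoid P" "\<And>p. p \<in> carrier P \<Longrightarrow> N p > 0" "N \<one>\<^bsub>P\<^esub> = 1"
    "\<And>p q. p \<in> carrier P \<Longrightarrow> q \<in> carrier P \<Longrightarrow> N (p \<otimes>\<^bsub>P\<^esub> q) = N p * N q"
  shows "\<exists>\<sigma>. dynamics (semigroup_cstar P) \<sigma> \<and> (\<forall>t. \<forall>p\<in>carrier P.
     \<sigma> t (isom P p) = (complex_of_real (N p) powr (\<i> * complex_of_real t)) \<odot>\<^bsub>semigroup_cstar P\<^esub> isom P p)"
proof -
  interpret semigroup_dynamics P N by (rule semigroup_dynamics.intro) (use assms in auto)
  show ?thesis using dyn sig(3) unfolding ch_def by blast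
qed

lemma pe_app: "presented_eq R u w \<Longrightarrow> presented_eq R (a @ u @ b) (a @ w @ b)"
proof (induction rule: presented_eq.induct)
  case (rel x y u w) then show ?case using presented_eq.rel[of x y R "a @ u" "w @ b"] by simp
qed (auto intro: presented_eq.refl presented_eq.sym presented_eq.trans)
lemma pe_app2: "presented_eq R u u' \<Longrightarrow> presented_eq R w w' \<Longrightarrow> presented_eq R (u @ w) (u' @ w')"
  using pe_app[of R u u' "[]" w] pe_app[of R w w' u' "[]"] presented_eq.trans by fastforce
lemma wc_eq: "word_class R u = word_class R w \<longleftrightarrow> presented_eq R u w"
  unfolding word_class_def using presented_eq.refl presented_eq.sym presented_eq.trans by (metis Collect_cong mem_Collect_eq)
lemma wc_mult: "word_class R u \<otimes>\<^bsub>presented_monoid G R\<^esub> word_class R w = word_class R (u @ w)"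
proof -
  have "\<And>a b. a \<in> word_class R u \<Longrightarrow> b \<in> word_class R w \<Longrightarrow> word_class R (a @ b) = word_class R (u @ w)"
    using pe_app2 wc_eq unfolding word_class_def by (metis mem_Collect_eq presented_eq.sym)
  then have "(\<Union>a\<in>word_class R u. \<Union>b\<in>word_class R w. word_class R (a @ b)) =
     (\<Union>a\<in>word_class R u. \<Union>b\<in>word_class R w. word_class R (u @ w))" by (intro SUP_cong refl) (erule (1) meta_mp, assumption | simp)+
  moreover have "word_class R u \<noteq> {}" "word_class R w \<noteq> {}" by (auto simp: word_class_def intro: presented_eq.refl)
  ultimately show ?thesis by (simp add: presented_monoid_def)
qed
lemma presented_monoid: "Group.monoid (presented_monoid G R)"
proof -
  have c: "carrier (presented_monoid G R) = word_class R ` lists G" and o: "\<one>\<^bsub>presented_monoid G R\<^esub> = word_class R []" by (simp_all add: presented_monoid_def)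
  show ?thesis by (rule monoidI) (auto simp: c o wc_mult intro!: imageI)
qed

lemma braid_len: "presented_eq (braid_relations n) u w \<Longrightarrow> length u = length w"
  by (induction rule: presented_eq.induct) (auto simp: braid_relations_def)
lemma braid_length_class: "braid_length (word_class (braid_relations n) u) = length u"
  unfolding braid_length_def
proof (rule the_equality)
  show "\<forall>w\<in>word_class (braid_relations n) u. length w = length u" using braid_len by (auto simp: word_class_def)
qed (auto simp: word_class_def presented_eq.refl)

lemma braid_length_mult:
  assumes "p \<in> carrier (braid_monoid n)" "q \<in> carrier (braid_monoid n)"
  shows "braid_length (p \<otimes>\<^bsub>braid_monoid n\<^esub> q) = braid_length p + braid_length q"
proof -
  obtain u w where "p = word_class (braid_relations n) u" "q = word_class (braid_relations n) w"
    using assms by (auto simp: braid_monoid_def presented_monoid_def)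
  then show ?thesis by (simp add: braid_monoid_def wc_mult braid_length_class)
qed

theorem braid_dynamics_exists: "\<exists>\<sigma>. dynamics (semigroup_cstar (braid_monoid n)) \<sigma> \<and> (\<forall>t. \<forall>p\<in>carrier (braid_monoid n).
     \<sigma> t (isom (braid_monoid n) p) = (complex_of_real (braid_N p) powr (\<i> * complex_of_real t)) \<odot>\<^bsub>semigroup_cstar (braid_monoid n)\<^esub> isom (braid_monoid n) p)"
proof (rule dynamics_exists)
  show "Group.monoid (braid_monoid n)" by (simp add: braid_monoid_def presented_monoid)
  show "braid_N \<one>\<^bsub>braid_monoid n\<^esub> = 1" by (simp add: braid_N_def braid_monoid_def presented_monoid_def braid_length_class)
  fix p q assume "p \<in> carrier (braid_monoid n)" "q \<in> carrier (braid_monoid n)"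
  then obtain u w where "p = word_class (braid_relations n) u" "q = word_class (braid_relations n) w"
    by (auto simp: braid_monoid_def presented_monoid_def)
  then show "braid_N (p \<otimes>\<^bsub>braid_monoid n\<^esub> q) = braid_N p * braid_N q"
    by (simp add: braid_N_def braid_monoid_def wc_mult braid_length_class exp_add)
qed (simp add: braid_N_def)

end

theory Submission
  imports Defs
begin

text \<open>
  The two halves of the theorem are independent of each other, and both rest on Garside's theorem
  \<open>garside\<close>: if \<open>s\<^sub>i X = s\<^sub>j Y\<close> in the braid monoid, then both sides are right multiples of the least
  common multiple of \<open>s\<^sub>i\<close> and \<open>s\<^sub>j\<close> that the relations suggest.

  Small positive \<open>\<beta>\<close>. A \<open>KMS\<^sub>\<beta>\<close>-state takes the value \<open>N(p)\<^bsup>-\<beta>\<^esup>\<close> on the range projection of \<open>v\<^sub>p\<close>. The range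
  projections of \<open>v\<^sub>p\<close> and \<open>v\<^sub>q\<close> commute, and their product belongs to \<open>p \<or> q\<close>; hence
  \<open>1 - N(p)\<^bsup>-\<beta>\<^esup> - N(q)\<^bsup>-\<beta>\<^esup> + N(p \<or> q)\<^bsup>-\<beta>\<^esup>\<close>, the value on the product of the complementary
  projections, is nonnegative (\<open>KMS_rlcm_bound\<close>). For \<open>p = s\<^sub>1\<close> and \<open>q = s\<^sub>2\<close>, with least common multiple
  \<open>s\<^sub>1 s\<^sub>2 s\<^sub>1\<close> of length three, and \<open>x = e\<^bsup>-\<beta>\<^esup>\<close>, this reads \<open>1 - 2x + x\<^sup>3 = (1 - x) (1 - x - x\<^sup>2) \<ge> 0\<close>. So
  \<open>x < 1\<close> forces \<open>x\<close> to be at most the positive root of \<open>x\<^sup>2 + x = 1\<close>, which is \<open>e\<^bsup>-a\<^esup>\<close>.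

  The value \<open>\<beta> = 0\<close>. A \<open>KMS\<^sub>0\<close>-state is a tracial state, and one that vanishes on \<open>v\<^sub>p v\<^sub>q\<^sup>*\<close> for \<open>p \<noteq> q\<close> comes
  from the canonical trace of the braid group, provided that the braid monoid embeds into the
  group. Garside's theorem shows that the monoid is cancellative. The full twist
  \<open>(s\<^sub>1 s\<^sub>2 \<dots> s\<^sub>n\<^sub>-\<^sub>1)\<^sup>n\<close> is central, and every positive braid divides one of its powers
  (\<open>divides_full_twist_pow\<close>). Therefore it suffices to invert one central element to obtain a group that
  contains the monoid. The canonical trace of that group is a positive functional on words in the
  letters \<open>v\<^sub>p\<close>, \<open>v\<^sub>p\<^sup>*\<close>, its GNS representation is unitary and satisfies the defining relations, and so
  the trace is bounded by the universal norm and extends to the \<open>C\<^sup>*\<close>-algebra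
  (\<open>tracial_gauge_invariant_state\<close>).
\<close>

section \<open>Garside's theorem on positive braids\<close>

locale positive_braids = fixes n :: nat
begin

abbreviation S where "S \<equiv> {1..<n}"
abbreviation cls where "cls \<equiv> word_class (braid_relations n)"
abbreviation M where "M \<equiv> braid_monoid n"
abbreviation B where "B \<equiv> carrier M"
abbreviation far :: "nat \<Rightarrow> nat \<Rightarrow> bool" where "far i j \<equiv> \<bar>int i - int j\<bar> \<ge> 2"
abbreviation near :: "nat \<Rightarrow> nat \<Rightarrow> bool" where "near i j \<equiv> \<bar>int i - int j\<bar> = 1"

text \<open>Left multiplication by \<open>s\<^sub>i\<close>, defined on arbitrary sets of words so that the braid
relations become identities between operators without side
conditions on the argument, and computations with braids become rewriting of composed operators.\<close>

definition prepend :: "nat \<Rightarrow> nat list set \<Rightarrow> nat list set"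
  where "prepend i X = (\<Union>u\<in>X. cls (i # u))"

lemma B_eq: "B = cls ` lists S"
  by (simp add: braid_monoid_def presented_monoid_def)

lemma cls_mult: "cls u \<otimes>\<^bsub>M\<^esub> cls v = cls (u @ v)"
  by (simp add: braid_monoid_def wc_mult)

lemma cls_cong: "cls u = cls v \<Longrightarrow> cls (a @ u @ b) = cls (a @ v @ b)"
  by (simp add: wc_eq pe_app)

lemma cls_rel: "(a, b) \<in> braid_relations n \<Longrightarrow> cls (u @ a @ v) = cls (u @ b @ v)"
  by (simp add: wc_eq presented_eq.rel)

lemma cls_far: "i \<in> S \<Longrightarrow> j \<in> S \<Longrightarrow> far i j \<Longrightarrow> cls (u @ i # j # v) = cls (u @ j # i # v)"
  using cls_rel[of "[i, j]" "[j, i]" u v] by (auto simp: braid_relations_def)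

lemma cls_near: "i \<in> S \<Longrightarrow> j \<in> S \<Longrightarrow> near i j \<Longrightarrow> cls (u @ i # j # i # v) = cls (u @ j # i # j # v)"
  using cls_rel[of "[i, j, i]" "[j, i, j]" u v] by (auto simp: braid_relations_def)

lemma prepend_cls: "prepend i (cls u) = cls (i # u)"
proof -
  have "cls (i # v) = cls (i # u)" if "v \<in> cls u" for v
  proof -
    have "cls u = cls v" unfolding wc_eq using that by (simp add: word_class_def)
    then show ?thesis using cls_cong[of v u "[i]" "[]"] by simp
  qed
  moreover have "u \<in> cls u" by (simp add: word_class_def presented_eq.refl)
  ultimately show ?thesis unfolding prepend_def by blast
qed

lemma prepend_UN: "prepend i (\<Union>u\<in>X. F u) = (\<Union>u\<in>X. prepend i (F u))"
  by (auto simp: prepend_def)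

lemma prepend_far:
  assumes "i \<in> S" "j \<in> S" "far i j"
  shows "prepend i (prepend j X) = prepend j (prepend i X)"
  unfolding prepend_def[of j X] prepend_def[of i X]
  using cls_far[OF assms, of "[]"] by (simp add: prepend_UN prepend_cls)

lemma prepend_near:
  assumes "i \<in> S" "j \<in> S" "near i j"
  shows "prepend i (prepend j (prepend i X)) = prepend j (prepend i (prepend j X))"
  unfolding prepend_def[of j X] prepend_def[of i X]
  using cls_near[OF assms, of "[]"] by (simp add: prepend_UN prepend_cls)

lemma prepend_in: "i \<in> S \<Longrightarrow> X \<in> B \<Longrightarrow> prepend i X \<in> B"
  by (auto simp: B_eq prepend_cls simp del: One_nat_def intro!: imageI)

lemma length_prepend: "X \<in> B \<Longrightarrow> braid_length (prepend i X) = Suc (braid_length X)"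
  by (auto simp: B_eq prepend_cls braid_length_class)

text \<open>For \<open>X\<close> and \<open>Y\<close> with \<open>s\<^sub>i X = s\<^sub>j Y\<close> this says that the common value is a right multiple of the
expected least common multiple of \<open>s\<^sub>i\<close> and \<open>s\<^sub>j\<close>, which is \<open>s\<^sub>i\<close>, \<open>s\<^sub>i s\<^sub>j\<close> or \<open>s\<^sub>i s\<^sub>j s\<^sub>i\<close>; the quotient is
\<open>Z\<close>. For \<open>i = j\<close> it is left cancellation.\<close>

definition lcm_split :: "nat \<Rightarrow> nat \<Rightarrow> nat list set \<Rightarrow> nat list set \<Rightarrow> bool" where
  "lcm_split i j X Y \<longleftrightarrow> (i = j \<and> X = Y) \<or>
     (far i j \<and> (\<exists>Z\<in>B. X = prepend j Z \<and> Y = prepend i Z)) \<or>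
     (near i j \<and> (\<exists>Z\<in>B. X = prepend j (prepend i Z) \<and> Y = prepend i (prepend j Z)))"

lemma lcm_split_sym: "lcm_split i j X Y \<Longrightarrow> lcm_split j i Y X"
  unfolding lcm_split_def by (auto simp: abs_minus_commute)

lemma lcm_splitE:
  assumes "lcm_split i j X Y"
  obtains "i = j" "X = Y"
  | Z where "far i j" "Z \<in> B" "X = prepend j Z" "Y = prepend i Z"
  | Z where "near i j" "Z \<in> B" "X = prepend j (prepend i Z)" "Y = prepend i (prepend j Z)"
  using assms unfolding lcm_split_def by blast

text \<open>The heart of Garside's argument: if \<open>s\<^sub>i X = s\<^sub>m W = s\<^sub>j Y\<close>, and the two outer equalities split, then
so does \<open>s\<^sub>i X = s\<^sub>j Y\<close>. The two given splittings write \<open>W\<close> in two ways, and comparing them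
only involves equalities between shorter braids, for which the splitting is assumed. What remains
is one computation for every way in which \<open>i\<close>, \<open>m\<close> and \<open>j\<close> can be near or far; exchanging \<open>i\<close> and
\<open>j\<close> saves one of them, and three pairwise adjacent indices do not exist.\<close>

lemma lcm_split_trans:
  assumes IH: "\<And>i j X Y. \<lbrakk>i \<in> S; j \<in> S; X \<in> B; Y \<in> B; braid_length X < k;
      prepend i X = prepend j Y\<rbrakk> \<Longrightarrow> lcm_split i j X Y"
    and i: "i \<in> S" and j: "j \<in> S" and m: "m \<in> S" and W: "W \<in> B" and k: "braid_length W = k"
    and XW: "lcm_split i m X W" and WY: "lcm_split m j W Y"
  shows "lcm_split i j X Y"
proof -
  note [simp] = prepend_in length_prepend
  have far_IH: "\<exists>Z\<in>B. X = prepend j Z \<and> Y = prepend i Z"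
    if "prepend i X = prepend j Y" "far i j" "i \<in> S" "j \<in> S" "X \<in> B" "Y \<in> B" "braid_length X < k"
    for i j X Y using IH[of i j X Y] that by (auto simp: lcm_split_def)
  have near_IH: "\<exists>Z\<in>B. X = prepend j (prepend i Z) \<and> Y = prepend i (prepend j Z)"
    if "prepend i X = prepend j Y" "near i j" "i \<in> S" "j \<in> S" "X \<in> B" "Y \<in> B" "braid_length X < k"
    for i j X Y using IH[of i j X Y] that by (auto simp: lcm_split_def)
  have cancel: "X = Y"
    if "prepend i X = prepend i Y" "i \<in> S" "X \<in> B" "Y \<in> B" "braid_length X < k"
    for i X Y using IH[of i i X Y] that by (auto simp: lcm_split_def)
  have far_near: "lcm_split i j X Y"
    if XW: "lcm_split i m X W" and WY: "lcm_split m j W Y" and i: "i \<in> S" and j: "j \<in> S"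
      and far: "far i m" and near: "near m j" for i j X Y
  proof -
    obtain Z1 where Z1: "Z1 \<in> B" "X = prepend m Z1" "W = prepend i Z1"
      using XW far by (auto elim!: lcm_splitE)
    obtain Z2 where Z2: "Z2 \<in> B" "W = prepend j (prepend m Z2)" "Y = prepend m (prepend j Z2)"
      using WY near by (auto elim!: lcm_splitE)
    note im = prepend_far[OF i m far] and mj = prepend_near[OF m j near]
    have len: "Suc (braid_length Z1) = k" "Suc (Suc (braid_length Z2)) = k"
      using k Z1(3) Z2(2) length_prepend[OF Z1(1)] length_prepend[OF Z2(1)]
        length_prepend[OF prepend_in[OF m Z2(1)]] by metis+
    have "lcm_split i j Z1 (prepend m Z2)" using IH[of i j] Z1 Z2 i j m len by simp
    then show ?thesis
    proof (cases rule: lcm_splitE)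
      case 1 then show ?thesis using far near by simp
    next
      case (2 Z3)
      obtain Z4 where Z4: "Z4 \<in> B" "Z2 = prepend i Z4" "Z3 = prepend m Z4"
        using far_IH[of m Z2 i Z3] 2 Z1 Z2 i j m len far by (auto simp: abs_minus_commute)
      note ij = prepend_far[OF i j 2(1)]
      have "X = prepend j (prepend m (prepend j Z4))" using Z1 2 Z4 mj by simp
      moreover have "Y = prepend i (prepend m (prepend j Z4))" using Z2 Z4 im ij by simp
      ultimately show ?thesis using 2 Z4 m j by (auto simp: lcm_split_def)
    next
      case (3 Z3)
      obtain Z4 where Z4: "Z4 \<in> B" "Z2 = prepend i Z4" "prepend j Z3 = prepend m Z4"
        using far_IH[of m Z2 i "prepend j Z3"] 3 Z1 Z2 i j m len far by (auto simp: abs_minus_commute)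
      have "Suc (braid_length Z4) = braid_length Z2" using Z4 by simp
      then have l3: "braid_length Z3 < k" using Z4 3 len length_prepend[of Z3 j] length_prepend[of Z4 m] by simp
      obtain Z5 where Z5: "Z5 \<in> B" "Z3 = prepend m (prepend j Z5)"
        using near_IH[OF Z4(3) _ j m 3(2) Z4(1) l3] near by (auto simp: abs_minus_commute)
      have "prepend j Z3 = prepend m (prepend j (prepend m Z5))" using Z5 mj by simp
      then have "prepend m Z4 = prepend m (prepend j (prepend m Z5))" using Z4 by simp
      then have Z4': "Z4 = prepend j (prepend m Z5)"
        using cancel[of m Z4] Z4 Z5 m j len \<open>Suc (braid_length Z4) = braid_length Z2\<close> by simp
      note ij = prepend_near[OF i j 3(1)]
      let ?T = "prepend m (prepend j (prepend i Z5))"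
      \<comment> \<open>With \<open>i\<close>, \<open>m\<close> commuting: \<open>m j i m j = m j m i j = j m j i j = j m i j i = j i m j i\<close>
         and \<open>m j i j m = m i j i m = i m j m i = i j m j i\<close>.\<close>
      have "X = prepend m (prepend j (prepend m (prepend i (prepend j Z5))))"
        using Z1 3 Z5 im by simp
      also have "\<dots> = prepend j (prepend m (prepend i (prepend j (prepend i Z5))))" by (simp add: mj ij)
      finally have "X = prepend j (prepend i ?T)" using im by simp
      moreover have "Y = prepend m (prepend i (prepend j (prepend i (prepend m Z5))))"
        using Z2 Z4 Z4' ij by simp
      then have "Y = prepend i (prepend m (prepend j (prepend m (prepend i Z5))))" by (simp add: im)
      then have "Y = prepend i (prepend j ?T)" by (simp add: mj)
      ultimately show ?thesis using 3 Z5 m j i by (auto simp: lcm_split_def)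
    qed
  qed
  consider "i = m" | "m = j" | "far i m" "near m j" | "near i m" "far m j" | "far i m" "far m j"
    | "near i m" "near m j"
    using XW WY by (auto elim!: lcm_splitE)
  then show ?thesis
  proof cases
    case 1 then show ?thesis using XW WY by (auto elim: lcm_splitE)
  next
    case 2 then show ?thesis using XW WY by (auto elim: lcm_splitE)
  next
    case 3 then show ?thesis using far_near[OF XW WY i j] by simp
  next
    case 4
    then show ?thesis using far_near[OF lcm_split_sym[OF WY] lcm_split_sym[OF XW] j i]
      by (auto simp: abs_minus_commute intro: lcm_split_sym)
  next
    case 5
    obtain Z1 where Z1: "Z1 \<in> B" "X = prepend m Z1" "W = prepend i Z1"
      using XW 5 by (auto elim!: lcm_splitE)
    obtain Z2 where Z2: "Z2 \<in> B" "W = prepend j Z2" "Y = prepend m Z2"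
      using WY 5 by (auto elim!: lcm_splitE)
    note im = prepend_far[OF i m 5(1)] and mj = prepend_far[OF m j 5(2)]
    have "lcm_split i j Z1 Z2" using IH[of i j Z1 Z2] Z1 Z2 i j k by auto
    then show ?thesis
    proof (cases rule: lcm_splitE)
      case 1 then show ?thesis using Z1 Z2 by (simp add: lcm_split_def)
    next
      case (2 Z)
      then have "X = prepend j (prepend m Z)" "Y = prepend i (prepend m Z)" using Z1 Z2 im mj by simp_all
      then show ?thesis using 2 m by (auto simp: lcm_split_def)
    next
      case (3 Z)
      then have "X = prepend j (prepend i (prepend m Z))" "Y = prepend i (prepend j (prepend m Z))"
        using Z1(2) Z2(3) by (simp_all add: im[symmetric] mj)
      then show ?thesis using 3 m by (auto simp: lcm_split_def)
    qed
  next
    case 6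
    obtain Z1 where Z1: "Z1 \<in> B" "X = prepend m (prepend i Z1)" "W = prepend i (prepend m Z1)"
      using XW 6 by (auto elim!: lcm_splitE)
    obtain Z2 where Z2: "Z2 \<in> B" "W = prepend j (prepend m Z2)" "Y = prepend m (prepend j Z2)"
      using WY 6 by (auto elim!: lcm_splitE)
    note im = prepend_near[OF i m 6(1)] and mj = prepend_near[OF m j 6(2)]
    have len: "Suc (Suc (braid_length Z1)) = k" "Suc (Suc (braid_length Z2)) = k"
      using k Z1(3) Z2(2) length_prepend[OF Z1(1)] length_prepend[OF Z2(1)]
        length_prepend[OF prepend_in[OF m Z1(1)]] length_prepend[OF prepend_in[OF m Z2(1)]] by metis+
    have "lcm_split i j (prepend m Z1) (prepend m Z2)" using IH[of i j] Z1 Z2 i j m len by simp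
    then show ?thesis
    proof (cases rule: lcm_splitE)
      case 1
      then have "Z1 = Z2" using cancel[of m Z1 Z2] Z1 Z2 m len by simp
      then show ?thesis using 1 Z1 Z2 by (simp add: lcm_split_def)
    next
      case (2 Z3)
      obtain Z4 where Z4: "Z4 \<in> B" "Z1 = prepend j (prepend m Z4)" "Z3 = prepend m (prepend j Z4)"
        using near_IH[of m Z1 j Z3] 2 Z1 Z2 i j m len 6 by auto
      obtain Z5 where Z5: "Z5 \<in> B" "Z2 = prepend i (prepend m Z5)" "Z3 = prepend m (prepend i Z5)"
        using near_IH[of m Z2 i Z3] 2 Z1 Z2 i j m len 6 by (auto simp: abs_minus_commute)
      have "Suc (Suc (braid_length Z4)) = braid_length Z1" using Z4 j m by simp
      then have l4: "Suc (braid_length Z4) < k" using len by simp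
      have "prepend j Z4 = prepend i Z5"
        using cancel[of m "prepend j Z4"] Z4 Z5 i j m l4 by simp
      then obtain Z6 where Z6: "Z6 \<in> B" "Z4 = prepend i Z6" "Z5 = prepend j Z6"
        using far_IH[of j Z4 i Z5] Z4 Z5 i j 2 l4 by (auto simp: abs_minus_commute)
      note ij = prepend_far[OF i j 2(1)]
      let ?T = "prepend m (prepend i (prepend j (prepend m Z6)))"
      \<comment> \<open>With \<open>i\<close>, \<open>j\<close> commuting: \<open>m i j m i = m j i m i = m j m i m = j m j i m\<close>, and the same
         with \<open>i\<close>, \<open>j\<close> exchanged.\<close>
      have "X = prepend m (prepend j (prepend i (prepend m (prepend i Z6))))"
        using Z1 Z4 Z6 ij by simp
      also have "\<dots> = prepend m (prepend j (prepend m (prepend i (prepend m Z6))))" by (simp add: im)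
      also have "\<dots> = prepend j (prepend m (prepend j (prepend i (prepend m Z6))))" by (simp add: mj)
      finally have "X = prepend j ?T" by (simp add: ij)
      moreover have "Y = prepend m (prepend i (prepend j (prepend m (prepend j Z6))))"
        using Z2 Z5 Z6 ij by simp
      then have "Y = prepend m (prepend i (prepend m (prepend j (prepend m Z6))))" by (simp add: mj)
      then have "Y = prepend i ?T" by (simp add: im)
      ultimately show ?thesis using 2 Z6 m j i by (auto simp: lcm_split_def)
    next
      case (3 Z3) then show ?thesis using 6 by linarith
    qed
  qed
qed

lemma presented_lists: "presented_eq (braid_relations n) u v \<Longrightarrow> u \<in> lists S \<longleftrightarrow> v \<in> lists S"
  by (induction rule: presented_eq.induct) (auto simp: braid_relations_def)

lemma lcm_split_refl: "lcm_split i i X X" by (simp add: lcm_split_def)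

text \<open>Two equal words are joined by a chain of elementary relations. A single relation either leaves
the first letter alone or is itself a splitting at the front, and \<open>lcm_split_trans\<close> composes
splittings along the chain.\<close>

lemma presented_lcm_split:
  assumes IH: "\<And>i j X Y. \<lbrakk>i \<in> S; j \<in> S; X \<in> B; Y \<in> B; braid_length X < k;
      prepend i X = prepend j Y\<rbrakk> \<Longrightarrow> lcm_split i j X Y"
    and "presented_eq (braid_relations n) u v" "u \<in> lists S" "length u = Suc k"
  shows "lcm_split (hd u) (hd v) (cls (tl u)) (cls (tl v))"
  using assms(2-)
proof (induction rule: presented_eq.induct)
  case (rel a b u w)
  show ?case
  proof (cases u)
    case (Cons i u')
    then show ?thesis using cls_rel[OF rel(1), of u' w] by (simp add: lcm_split_refl)
  next
    case Nil
    have w: "cls w \<in> B" using rel by (simp add: B_eq)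
    have "far i j \<Longrightarrow> lcm_split i j (cls (j # w)) (cls (i # w))" for i j
      using w by (auto simp: lcm_split_def intro!: bexI[of _ "cls w"] simp: prepend_cls)
    moreover have "near i j \<Longrightarrow> lcm_split i j (cls (j # i # w)) (cls (i # j # w))" for i j
      using w by (auto simp: lcm_split_def intro!: bexI[of _ "cls w"] simp: prepend_cls)
    ultimately show ?thesis using rel(1) Nil unfolding braid_relations_def by auto
  qed
next
  case (refl u) show ?case by (rule lcm_split_refl)
next
  case (sym u w) then show ?case using presented_lists braid_len lcm_split_sym by metis
next
  case (trans u w z)
  have w: "w \<in> lists S" "length w = Suc k" using trans presented_lists braid_len by metis+
  then have z: "z \<in> lists S" "length z = Suc k" using trans presented_lists braid_len by metis+
  note [simp] = w z trans.prems
  have h: "hd y \<in> S" "cls (tl y) \<in> B" if "y \<in> lists S" "length y = Suc k" for y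
    using that by (cases y; simp add: B_eq)+
  show ?case
  proof (rule lcm_split_trans[where m = "hd w" and W = "cls (tl w)" and k = k])
    show "braid_length (cls (tl w)) = k" by (simp add: braid_length_class)
  qed (use IH trans.IH h w z trans.prems in auto)
qed

theorem garside:
  "\<lbrakk>i \<in> S; j \<in> S; X \<in> B; Y \<in> B; prepend i X = prepend j Y\<rbrakk> \<Longrightarrow> lcm_split i j X Y"
proof (induction "braid_length X" arbitrary: i j X Y rule: less_induct)
  case less
  obtain u v where uv: "X = cls u" "u \<in> lists S" "Y = cls v" "v \<in> lists S"
    using less.prems unfolding B_eq by blast
  have eq: "presented_eq (braid_relations n) (i # u) (j # v)"
    using less.prems(5) uv(1,3) by (simp add: prepend_cls wc_eq)
  have k: "length (i # u) = Suc (braid_length X)" "i # u \<in> lists S"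
    using uv less.prems(1) by (simp_all add: braid_length_class)
  have "lcm_split (hd (i # u)) (hd (j # v)) (cls (tl (i # u))) (cls (tl (j # v)))"
    by (rule presented_lcm_split[OF _ eq k(2,1)]) (rule less.hyps)
  then show ?case by (simp add: uv)
qed

end

section \<open>Cancellation and least common multiples of generators\<close>

context positive_braids
begin

sublocale Group.monoid M by (simp add: braid_monoid_def presented_monoid)

(* Indices such as 1 stay numerals, so that intervals of generators keep their shape. *)
declare One_nat_def [simp del]

lemma cls_in: "u \<in> lists S \<Longrightarrow> cls u \<in> B" by (auto simp: B_eq)

lemma one_cls: "\<one>\<^bsub>M\<^esub> = cls []"
  by (simp add: braid_monoid_def presented_monoid_def)

lemma gen_mult: "X \<in> B \<Longrightarrow> cls [i] \<otimes>\<^bsub>M\<^esub> X = prepend i X"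
  by (auto simp: B_eq cls_mult prepend_cls)

lemma braid_induct [consumes 1, case_names one gen]:
  assumes "X \<in> B" "Q \<one>\<^bsub>M\<^esub>" "\<And>i X. i \<in> S \<Longrightarrow> X \<in> B \<Longrightarrow> Q X \<Longrightarrow> Q (cls [i] \<otimes>\<^bsub>M\<^esub> X)"
  shows "Q X"
proof -
  obtain u where "X = cls u" "u \<in> lists S" using assms(1) unfolding B_eq by blast
  then show ?thesis
  proof (induction u arbitrary: X)
    case Nil then show ?case using assms(2) by (simp add: one_cls)
  next
    case (Cons i u)
    then show ?case using assms(3)[of i "cls u"] cls_in[of u] by (simp add: cls_mult)
  qed
qed

lemma braid_left_cancel:
  assumes "P \<in> B" "X \<in> B" "Y \<in> B" "P \<otimes>\<^bsub>M\<^esub> X = P \<otimes>\<^bsub>M\<^esub> Y"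
  shows "X = Y"
  using assms
proof (induction arbitrary: X Y rule: braid_induct)
  case one then show ?case by simp
next
  case (gen i P)
  have "cls [i] \<otimes>\<^bsub>M\<^esub> (P \<otimes>\<^bsub>M\<^esub> X) = cls [i] \<otimes>\<^bsub>M\<^esub> (P \<otimes>\<^bsub>M\<^esub> Y)"
    using gen cls_in[of "[i]"] by (simp add: m_assoc)
  then have "prepend i (P \<otimes>\<^bsub>M\<^esub> X) = prepend i (P \<otimes>\<^bsub>M\<^esub> Y)"
    using gen by (simp add: gen_mult)
  then have "lcm_split i i (P \<otimes>\<^bsub>M\<^esub> X) (P \<otimes>\<^bsub>M\<^esub> Y)"
    using garside gen by simp
  then show ?case using gen by (auto simp: lcm_split_def)
qed

text \<open>The relations are invariant under reversal of words, which turns left cancellation into right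
cancellation.\<close>

lemma presented_rev:
  "presented_eq (braid_relations n) u v \<Longrightarrow> presented_eq (braid_relations n) (rev u) (rev v)"
proof (induction rule: presented_eq.induct)
  case (rel a b u w)
  then have "(rev a, rev b) \<in> braid_relations n"
    unfolding braid_relations_def by (auto simp: abs_minus_commute)
  then show ?case using presented_eq.rel[of "rev a" "rev b" _ "rev w" "rev u"] by simp
qed (auto intro: presented_eq.refl presented_eq.sym presented_eq.trans)

lemma cls_rev: "cls (rev u) = cls (rev v) \<longleftrightarrow> cls u = cls v"
  using presented_rev[of u v] presented_rev[of "rev u" "rev v"] by (auto simp: wc_eq)

lemma braid_right_cancel:
  assumes "P \<in> B" "X \<in> B" "Y \<in> B" "X \<otimes>\<^bsub>M\<^esub> P = Y \<otimes>\<^bsub>M\<^esub> P"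
  shows "X = Y"
proof -
  obtain p x y where w: "P = cls p" "p \<in> lists S" "X = cls x" "x \<in> lists S" "Y = cls y" "y \<in> lists S"
    using assms unfolding B_eq by blast
  then have "cls (rev (x @ p)) = cls (rev (y @ p))"
    using assms(4) unfolding cls_rev by (simp add: cls_mult)
  then have "cls (rev p) \<otimes>\<^bsub>M\<^esub> cls (rev x) = cls (rev p) \<otimes>\<^bsub>M\<^esub> cls (rev y)" by (simp add: cls_mult)
  moreover have "rev p \<in> lists S" "rev x \<in> lists S" "rev y \<in> lists S" using w(2,4,6) by (simp_all add: in_lists_conv_set)
  ultimately have "cls (rev x) = cls (rev y)" using braid_left_cancel[OF cls_in cls_in cls_in] by blast
  then show ?thesis using w by (simp add: cls_rev)
qed

text \<open>A word of length three for two generators of length one: with \<open>x = e\<^bsup>-\<beta>\<^esup>\<close> this is what makes the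
bound on KMS states the cubic \<open>1 - 2x + x\<^sup>3\<close>.\<close>

lemma adjacent_generators_rlcm:
  assumes ij: "i \<in> S" "j \<in> S" "near i j"
  shows "is_rlcm M (cls [i]) (cls [j]) (cls [i, j, i])"
proof -
  have coset: "cls u <#\<^bsub>M\<^esub> B = (\<lambda>X. cls u \<otimes>\<^bsub>M\<^esub> X) ` B" for u by (auto simp: l_coset_def)
  have pre: "cls [i, j, i] \<otimes>\<^bsub>M\<^esub> Z = prepend i (prepend j (prepend i Z))" if "Z \<in> B" for Z
    using that by (auto simp: B_eq cls_mult prepend_cls)
  have "(cls [i] <#\<^bsub>M\<^esub> B) \<inter> (cls [j] <#\<^bsub>M\<^esub> B) = cls [i, j, i] <#\<^bsub>M\<^esub> B"
  proof (intro subset_antisym subsetI)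
    fix V assume "V \<in> (cls [i] <#\<^bsub>M\<^esub> B) \<inter> (cls [j] <#\<^bsub>M\<^esub> B)"
    then obtain X Y where V: "X \<in> B" "Y \<in> B" "V = prepend i X" "V = prepend j Y"
      unfolding coset by (auto simp: gen_mult)
    then have "lcm_split i j X Y" using garside ij by simp
    then obtain Z where "Z \<in> B" "X = prepend j (prepend i Z)" using ij by (auto elim!: lcm_splitE)
    then show "V \<in> cls [i, j, i] <#\<^bsub>M\<^esub> B" unfolding coset using V pre by (metis imageI)
  next
    fix V assume "V \<in> cls [i, j, i] <#\<^bsub>M\<^esub> B"
    then obtain Z where Z: "Z \<in> B" "V = prepend i (prepend j (prepend i Z))"
      unfolding coset by (auto simp: pre)
    have "V = cls [i] \<otimes>\<^bsub>M\<^esub> prepend j (prepend i Z)" "prepend j (prepend i Z) \<in> B"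
      using Z ij by (simp_all add: gen_mult prepend_in)
    moreover have "V = cls [j] \<otimes>\<^bsub>M\<^esub> prepend i (prepend j Z)" "prepend i (prepend j Z) \<in> B"
      using Z ij prepend_near[OF ij] by (simp_all add: gen_mult prepend_in)
    ultimately show "V \<in> (cls [i] <#\<^bsub>M\<^esub> B) \<inter> (cls [j] <#\<^bsub>M\<^esub> B)" unfolding coset by blast
  qed
  then show ?thesis using ij cls_in[of "[i, j, i]"] by (simp add: is_rlcm_def)
qed

end

section \<open>The full twist\<close>

context positive_braids
begin

lemma cls_far_word:
  assumes "i \<in> S" "u \<in> lists S" "\<And>j. j \<in> set u \<Longrightarrow> far i j"
  shows "cls (x @ i # u @ v) = cls (x @ u @ i # v)"
  using assms(2,3)
proof (induction u arbitrary: x rule: list.induct)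
  case (Cons j u)
  have "j \<in> S" using Cons.prems(1) by simp
  moreover have "far i j" using Cons.prems(2) by simp
  ultimately have "cls (x @ i # j # u @ v) = cls (x @ j # i # u @ v)"
    using cls_far[OF assms(1), of j x "u @ v"] by blast
  also have "\<dots> = cls ((x @ [j]) @ u @ i # v)" using Cons.IH[of "x @ [j]"] Cons.prems by simp
  finally show ?case by simp
qed simp

text \<open>The braid \<open>s\<^sub>1 s\<^sub>2 \<dots> s\<^sub>n\<^sub>-\<^sub>1\<close>, a rotation of the strands by one position. Its \<open>n\<close>-th power is the
full twist.\<close>

definition \<delta> where "\<delta> = cls [1..<n]"

lemma upt_in: "1 \<le> a \<Longrightarrow> b \<le> n \<Longrightarrow> cls [a..<b] \<in> B"
  by (rule cls_in) auto

lemma \<delta>_in: "\<delta> \<in> B" unfolding \<delta>_def by (rule upt_in) auto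

lemma g_in: "i \<in> S \<Longrightarrow> cls [i] \<in> B" by (rule cls_in) auto

text \<open>In \<open>s\<^sub>i\<^sub>+\<^sub>1 \<delta>\<close> the first letter moves right until it meets \<open>s\<^sub>i s\<^sub>i\<^sub>+\<^sub>1\<close>, the braid relation turns it into
a final \<open>s\<^sub>i\<close>, and that moves to the right end.\<close>

lemma \<delta>_gen:
  assumes "1 \<le> i" "Suc i < n"
  shows "\<delta> \<otimes>\<^bsub>M\<^esub> cls [i] = cls [Suc i] \<otimes>\<^bsub>M\<^esub> \<delta>"
proof -
  let ?a = "[1..<i]" and ?b = "[Suc (Suc i)..<n]"
  have split: "[1..<n] = ?a @ [i, Suc i] @ ?b"
    using assms upt_add_eq_append[of 1 i "n - i"] by (simp add: upt_conv_Cons)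
  have in_S: "i \<in> S" "Suc i \<in> S" "?a \<in> lists S" "?b \<in> lists S" using assms by auto
  have "cls (Suc i # ?a @ [i, Suc i] @ ?b) = cls (?a @ [Suc i, i, Suc i] @ ?b)"
    using cls_far_word[OF in_S(2,3), of "[]" "[i, Suc i] @ ?b"] by simp
  also have "\<dots> = cls (?a @ [i, Suc i, i] @ ?b)"
    using cls_near[OF in_S(2,1), of ?a ?b] by simp
  also have "\<dots> = cls (?a @ [i, Suc i] @ ?b @ [i])"
    using cls_far_word[OF in_S(1,4), of "?a @ [i, Suc i]" "[]"] by simp
  finally show ?thesis unfolding \<delta>_def cls_mult split by simp
qed

lemma \<delta>_pow_gen:
  "1 \<le> i \<Longrightarrow> i + k < n \<Longrightarrow> \<delta> [^]\<^bsub>M\<^esub> k \<otimes>\<^bsub>M\<^esub> cls [i] = cls [i + k] \<otimes>\<^bsub>M\<^esub> \<delta> [^]\<^bsub>M\<^esub> k"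
proof (induction k arbitrary: i)
  case 0 then show ?case by (simp add: g_in)
next
  case (Suc k)
  have [simp]: "cls [i] \<in> B" "cls [Suc i] \<in> B" "cls [Suc (i + k)] \<in> B" "\<delta> \<in> B"
    using Suc.prems by (auto intro!: g_in \<delta>_in)
  have "\<delta> [^]\<^bsub>M\<^esub> Suc k \<otimes>\<^bsub>M\<^esub> cls [i] = \<delta> [^]\<^bsub>M\<^esub> k \<otimes>\<^bsub>M\<^esub> (\<delta> \<otimes>\<^bsub>M\<^esub> cls [i])"
    by (simp add: m_assoc)
  also have "\<dots> = (\<delta> [^]\<^bsub>M\<^esub> k \<otimes>\<^bsub>M\<^esub> cls [Suc i]) \<otimes>\<^bsub>M\<^esub> \<delta>"
    using Suc.prems \<delta>_gen[of i] by (simp add: m_assoc)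
  also have "\<dots> = cls [i + Suc k] \<otimes>\<^bsub>M\<^esub> \<delta> [^]\<^bsub>M\<^esub> Suc k"
    using Suc.prems Suc.IH[of "Suc i"] by (simp add: m_assoc)
  finally show ?case .
qed

text \<open>The rotation carries \<open>s\<^sub>n\<^sub>-\<^sub>1\<close> around to \<open>s\<^sub>1\<close> in two steps instead of one. It shifts
\<open>s\<^sub>1 \<dots> s\<^sub>n\<^sub>-\<^sub>2\<close> to \<open>s\<^sub>2 \<dots> s\<^sub>n\<^sub>-\<^sub>1\<close>; these are \<open>\<delta>\<close> without its last and without its first letter.\<close>

lemma \<delta>_sq_last:
  assumes "2 \<le> n"
  shows "\<delta> \<otimes>\<^bsub>M\<^esub> \<delta> \<otimes>\<^bsub>M\<^esub> cls [n - 1] = cls [1] \<otimes>\<^bsub>M\<^esub> \<delta> \<otimes>\<^bsub>M\<^esub> \<delta>"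
proof -
  have shift: "\<delta> \<otimes>\<^bsub>M\<^esub> cls [1..<Suc k] = cls [2..<Suc (Suc k)] \<otimes>\<^bsub>M\<^esub> \<delta>" if "Suc k < n" for k
    using that
  proof (induction k)
    case 0 then show ?case using \<delta>_in by (simp add: one_cls[symmetric])
  next
    case (Suc k)
    have e: "cls [1..<Suc (Suc k)] = cls [1..<Suc k] \<otimes>\<^bsub>M\<^esub> cls [Suc k]"
      "cls [2..<Suc (Suc (Suc k))] = cls [2..<Suc (Suc k)] \<otimes>\<^bsub>M\<^esub> cls [Suc (Suc k)]"
      by (simp_all add: cls_mult)
    have [simp]: "cls [1..<Suc k] \<in> B" "cls [2..<Suc (Suc k)] \<in> B" "cls [Suc k] \<in> B" "cls [Suc (Suc k)] \<in> B"
      using Suc.prems by (auto intro!: cls_in)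
    note [simp del] = upt_Suc
    have "\<delta> \<otimes>\<^bsub>M\<^esub> cls [1..<Suc (Suc k)] = (\<delta> \<otimes>\<^bsub>M\<^esub> cls [1..<Suc k]) \<otimes>\<^bsub>M\<^esub> cls [Suc k]"
      unfolding e using \<delta>_in by (simp add: m_assoc)
    also have "\<dots> = cls [2..<Suc (Suc k)] \<otimes>\<^bsub>M\<^esub> (\<delta> \<otimes>\<^bsub>M\<^esub> cls [Suc k])"
      using Suc \<delta>_in by (simp add: m_assoc)
    also have "\<dots> = cls [2..<Suc (Suc (Suc k))] \<otimes>\<^bsub>M\<^esub> \<delta>"
      unfolding e using \<delta>_gen[of "Suc k"] Suc.prems \<delta>_in by (simp add: m_assoc)
    finally show ?case .
  qed
  have first: "\<delta> = cls [1] \<otimes>\<^bsub>M\<^esub> cls [2..<n]" and last: "\<delta> = cls [1..<n - 1] \<otimes>\<^bsub>M\<^esub> cls [n - 1]"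
    using assms upt_conv_Cons[of 1 n] upt_Suc_append[of 1 "n - 1"]
    by (simp_all add: \<delta>_def cls_mult numeral_2_eq_2)
  have i: "cls [1] \<in> B" "cls [2..<n] \<in> B" "cls [1..<n - 1] \<in> B" "cls [n - 1] \<in> B"
    using assms by (auto intro!: cls_in)
  have "cls [1] \<otimes>\<^bsub>M\<^esub> \<delta> \<otimes>\<^bsub>M\<^esub> \<delta> = cls [1] \<otimes>\<^bsub>M\<^esub> (\<delta> \<otimes>\<^bsub>M\<^esub> cls [1..<n - 1]) \<otimes>\<^bsub>M\<^esub> cls [n - 1]"
    by (subst (2) last) (use i \<delta>_in in \<open>simp add: m_assoc\<close>)
  also have "\<delta> \<otimes>\<^bsub>M\<^esub> cls [1..<n - 1] = cls [2..<n] \<otimes>\<^bsub>M\<^esub> \<delta>"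
  proof -
    have "Suc (n - 2) = n - 1" "Suc (Suc (n - 2)) = n" "Suc (n - 2) < n" using assms by simp_all
    then show ?thesis using shift[of "n - 2"] by simp
  qed
  also have "cls [1] \<otimes>\<^bsub>M\<^esub> (cls [2..<n] \<otimes>\<^bsub>M\<^esub> \<delta>) \<otimes>\<^bsub>M\<^esub> cls [n - 1]
      = (cls [1] \<otimes>\<^bsub>M\<^esub> cls [2..<n]) \<otimes>\<^bsub>M\<^esub> \<delta> \<otimes>\<^bsub>M\<^esub> cls [n - 1]"
    using i \<delta>_in by (simp add: m_assoc)
  finally show ?thesis by (simp add: first[symmetric])
qed

definition full_twist where "full_twist = \<delta> [^]\<^bsub>M\<^esub> n"

lemma full_twist_in: "full_twist \<in> B" by (simp add: full_twist_def \<delta>_in)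

text \<open>Pushing \<open>s\<^sub>i\<close> leftwards through \<open>\<delta>\<^sup>n\<close> shifts its index up to \<open>n - 1\<close>, then around to \<open>1\<close>, and then up
to \<open>i\<close> again, which uses up all the factors.\<close>

lemma full_twist_gen:
  assumes "i \<in> S"
  shows "full_twist \<otimes>\<^bsub>M\<^esub> cls [i] = cls [i] \<otimes>\<^bsub>M\<^esub> full_twist"
proof -
  let ?p = "\<lambda>k::nat. \<delta> [^]\<^bsub>M\<^esub> k"
  have i: "1 \<le> i" "i < n" using assms by auto
  have [simp]: "\<delta> \<in> B" "cls [i] \<in> B" "cls [1] \<in> B" "cls [n - 1] \<in> B" "?p k \<in> B" for k
    using i by (auto intro!: \<delta>_in g_in)
  have n: "full_twist = ?p (i - 1) \<otimes>\<^bsub>M\<^esub> (\<delta> \<otimes>\<^bsub>M\<^esub> \<delta>) \<otimes>\<^bsub>M\<^esub> ?p (n - 1 - i)"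
  proof -
    have "full_twist = ?p ((i - 1) + 2 + (n - 1 - i))" using i by (simp add: full_twist_def)
    also have "\<dots> = ?p (i - 1) \<otimes>\<^bsub>M\<^esub> ?p 2 \<otimes>\<^bsub>M\<^esub> ?p (n - 1 - i)"
      by (simp only: nat_pow_mult[OF \<delta>_in])
    finally show ?thesis by (simp add: numeral_2_eq_2)
  qed
  have "full_twist \<otimes>\<^bsub>M\<^esub> cls [i]
      = ?p (i - 1) \<otimes>\<^bsub>M\<^esub> (\<delta> \<otimes>\<^bsub>M\<^esub> \<delta>) \<otimes>\<^bsub>M\<^esub> (?p (n - 1 - i) \<otimes>\<^bsub>M\<^esub> cls [i])"
    unfolding n by (simp add: m_assoc)
  also have "?p (n - 1 - i) \<otimes>\<^bsub>M\<^esub> cls [i] = cls [n - 1] \<otimes>\<^bsub>M\<^esub> ?p (n - 1 - i)"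
    using \<delta>_pow_gen[of i "n - 1 - i"] i by simp
  also have "?p (i - 1) \<otimes>\<^bsub>M\<^esub> (\<delta> \<otimes>\<^bsub>M\<^esub> \<delta>) \<otimes>\<^bsub>M\<^esub> (cls [n - 1] \<otimes>\<^bsub>M\<^esub> ?p (n - 1 - i))
      = ?p (i - 1) \<otimes>\<^bsub>M\<^esub> (\<delta> \<otimes>\<^bsub>M\<^esub> \<delta> \<otimes>\<^bsub>M\<^esub> cls [n - 1]) \<otimes>\<^bsub>M\<^esub> ?p (n - 1 - i)"
    by (simp add: m_assoc)
  also have "\<dots> = (?p (i - 1) \<otimes>\<^bsub>M\<^esub> cls [1]) \<otimes>\<^bsub>M\<^esub> (\<delta> \<otimes>\<^bsub>M\<^esub> \<delta>) \<otimes>\<^bsub>M\<^esub> ?p (n - 1 - i)"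
    using \<delta>_sq_last i by (simp add: m_assoc)
  also have "?p (i - 1) \<otimes>\<^bsub>M\<^esub> cls [1] = cls [i] \<otimes>\<^bsub>M\<^esub> ?p (i - 1)"
    using \<delta>_pow_gen[of 1 "i - 1"] i by simp
  also have "cls [i] \<otimes>\<^bsub>M\<^esub> ?p (i - 1) \<otimes>\<^bsub>M\<^esub> (\<delta> \<otimes>\<^bsub>M\<^esub> \<delta>) \<otimes>\<^bsub>M\<^esub> ?p (n - 1 - i) = cls [i] \<otimes>\<^bsub>M\<^esub> full_twist"
    unfolding n by (simp add: m_assoc)
  finally show ?thesis .
qed

lemma full_twist_central: "X \<in> B \<Longrightarrow> full_twist \<otimes>\<^bsub>M\<^esub> X = X \<otimes>\<^bsub>M\<^esub> full_twist"
proof (induction rule: braid_induct)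
  case (gen i X)
  have [simp]: "cls [i] \<in> B" using gen g_in by simp
  have "full_twist \<otimes>\<^bsub>M\<^esub> (cls [i] \<otimes>\<^bsub>M\<^esub> X) = (full_twist \<otimes>\<^bsub>M\<^esub> cls [i]) \<otimes>\<^bsub>M\<^esub> X"
    using gen full_twist_in by (simp add: m_assoc)
  also have "\<dots> = cls [i] \<otimes>\<^bsub>M\<^esub> (full_twist \<otimes>\<^bsub>M\<^esub> X)"
    using gen full_twist_in full_twist_gen by (simp add: m_assoc)
  finally show ?case using gen full_twist_in by (simp add: m_assoc)
qed (simp add: full_twist_in)

text \<open>The first letter \<open>s\<^sub>1\<close> of a factor \<open>\<delta>\<close> becomes \<open>s\<^sub>i\<close> when it is pulled to the left of \<open>i - 1\<close> other
factors.\<close>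

lemma gen_divides_full_twist:
  assumes "i \<in> S"
  shows "\<exists>Y\<in>B. cls [i] \<otimes>\<^bsub>M\<^esub> Y = full_twist"
proof -
  let ?p = "\<lambda>k::nat. \<delta> [^]\<^bsub>M\<^esub> k"
  have i: "1 \<le> i" "i < n" using assms by auto
  have [simp]: "\<delta> \<in> B" "cls [i] \<in> B" "cls [1] \<in> B" "cls [2..<n] \<in> B" "?p k \<in> B" for k
    using i by (auto intro!: \<delta>_in cls_in)
  have d: "\<delta> = cls [1] \<otimes>\<^bsub>M\<^esub> cls [2..<n]"
    using i upt_conv_Cons[of 1 n] by (simp add: \<delta>_def cls_mult numeral_2_eq_2)
  have "full_twist = ?p ((i - 1) + 1 + (n - i))" using i by (simp add: full_twist_def)
  also have "\<dots> = ?p (i - 1) \<otimes>\<^bsub>M\<^esub> \<delta> \<otimes>\<^bsub>M\<^esub> ?p (n - i)"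
    by (simp only: nat_pow_mult[OF \<delta>_in, symmetric]) (simp add: One_nat_def)
  also have "\<dots> = (?p (i - 1) \<otimes>\<^bsub>M\<^esub> cls [1]) \<otimes>\<^bsub>M\<^esub> (cls [2..<n] \<otimes>\<^bsub>M\<^esub> ?p (n - i))"
    by (subst (2) d) (simp add: m_assoc del: One_nat_def)
  also have "?p (i - 1) \<otimes>\<^bsub>M\<^esub> cls [1] = cls [i] \<otimes>\<^bsub>M\<^esub> ?p (i - 1)"
    using \<delta>_pow_gen[of 1 "i - 1"] i by simp
  finally show ?thesis by (intro bexI[of _ "?p (i - 1) \<otimes>\<^bsub>M\<^esub> (cls [2..<n] \<otimes>\<^bsub>M\<^esub> ?p (n - i))"])
    (simp_all add: m_assoc)
qed

lemma divides_full_twist_pow: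
  "X \<in> B \<Longrightarrow> \<exists>Y\<in>B. \<exists>k::nat. X \<otimes>\<^bsub>M\<^esub> Y = full_twist [^]\<^bsub>M\<^esub> k"
proof (induction rule: braid_induct)
  case one then show ?case by (intro bexI[of _ "\<one>\<^bsub>M\<^esub>"] exI[of _ 0]) simp_all
next
  case (gen i X)
  obtain Y k where Y: "Y \<in> B" "X \<otimes>\<^bsub>M\<^esub> Y = full_twist [^]\<^bsub>M\<^esub> (k::nat)" using gen by blast
  obtain T where T: "T \<in> B" "cls [i] \<otimes>\<^bsub>M\<^esub> T = full_twist" using gen_divides_full_twist gen by blast
  have [simp]: "cls [i] \<in> B" "full_twist \<in> B" using gen g_in full_twist_in by simp_all
  have "cls [i] \<otimes>\<^bsub>M\<^esub> X \<otimes>\<^bsub>M\<^esub> (Y \<otimes>\<^bsub>M\<^esub> T) = cls [i] \<otimes>\<^bsub>M\<^esub> (X \<otimes>\<^bsub>M\<^esub> Y) \<otimes>\<^bsub>M\<^esub> T"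
    using gen Y(1) T(1) by (simp add: m_assoc)
  also have "\<dots> = cls [i] \<otimes>\<^bsub>M\<^esub> full_twist [^]\<^bsub>M\<^esub> k \<otimes>\<^bsub>M\<^esub> T" by (simp only: Y(2))
  also have "\<dots> = full_twist [^]\<^bsub>M\<^esub> k \<otimes>\<^bsub>M\<^esub> (cls [i] \<otimes>\<^bsub>M\<^esub> T)"
  proof -
    have "cls [i] \<otimes>\<^bsub>M\<^esub> full_twist [^]\<^bsub>M\<^esub> k = full_twist [^]\<^bsub>M\<^esub> k \<otimes>\<^bsub>M\<^esub> cls [i]"
      by (rule group_commutes_pow[OF full_twist_gen[OF gen(1)] full_twist_in g_in[OF gen(1)], symmetric])
    then have "cls [i] \<otimes>\<^bsub>M\<^esub> full_twist [^]\<^bsub>M\<^esub> k \<otimes>\<^bsub>M\<^esub> T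
        = full_twist [^]\<^bsub>M\<^esub> k \<otimes>\<^bsub>M\<^esub> cls [i] \<otimes>\<^bsub>M\<^esub> T" by (simp only:)
    then show ?thesis by (simp add: m_assoc T(1))
  qed
  finally have "cls [i] \<otimes>\<^bsub>M\<^esub> X \<otimes>\<^bsub>M\<^esub> (Y \<otimes>\<^bsub>M\<^esub> T) = full_twist [^]\<^bsub>M\<^esub> Suc k"
    by (simp only: T(2) nat_pow_Suc)
  then show ?case using m_closed[OF Y(1) T(1)]
    by (intro bexI[of _ "Y \<otimes>\<^bsub>M\<^esub> T"] exI[of _ "Suc k"])
qed

end

section \<open>The canonical trace of a group on the semigroup C*-algebra\<close>

lemma poly_scal_single: "Poly_Mapping.single u c = poly_scal c (Poly_Mapping.single u 1)"
  by (simp add: poly_scal_def mult_single)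

lemma poly_scal_1: "poly_scal 1 f = f"
  by (simp add: poly_scal_def)

lemma poly_scal_laws:
  fixes f g :: "'p star_poly"
  shows "poly_scal c f * g = poly_scal c (f * g)" "f * poly_scal c g = poly_scal c (f * g)"
    "poly_star (poly_scal c f) = poly_scal (cnj c) (poly_star f)"
    "poly_scal c (poly_scal d f) = poly_scal (c * d) f"
    "poly_scal c (f + g) = poly_scal c f + poly_scal c g"
proof -
  (* A monoid whose carrier is the whole type makes all *-polynomials available. *)
  have all: "star_polys \<lparr>carrier = UNIV, monoid.mult = undefined, one = undefined\<rparr> = (UNIV :: 'p star_poly set)"
    by (simp add: star_polys_def)
  note sub = sp_subalgebra[of "\<lparr>carrier = UNIV, monoid.mult = undefined, one = undefined\<rparr> :: 'p monoid",
    unfolded all star_subalgebra_def ball_UNIV]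
  show "f * poly_scal c g = poly_scal c (f * g)" using sub by blast
  show "poly_star (poly_scal c f) = poly_scal (cnj c) (poly_star f)"
    by (rule poly_mapping_eqI) (simp add: lookup_poly_star lookup_poly_scal)
qed (simp_all add: poly_scal_def mult.assoc distrib_left mult_single flip: mult.assoc)

lemma poly_star_diff: "poly_star (f - g) = poly_star f - poly_star g"
  using poly_star_add[of "f - g" g] by simp

text \<open>A homomorphism from the words to a group that sends adjoint letters to inverses is determined, up
to isomorphism of its image, by the set \<open>T\<close> of words with value one. Working with \<open>T\<close> instead of the
group avoids constructing the group: two words \<open>u\<close> and \<open>w\<close> have the same value iff \<open>u\<^sup>* w\<close> lies in
\<open>T\<close>, and all that matters is that inserting a word from \<open>T\<close> does not affect membership in \<open>T\<close>.\<close>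

locale group_kernel =
  fixes P :: "('p, 'm) monoid_scheme" and T :: "'p word \<Rightarrow> bool"
  assumes T_adj: "T (u + word_adj u)"
    and T_insert: "T u \<Longrightarrow> T (a + u + b) \<longleftrightarrow> T (a + b)"
    and T_one: "T (Word [Isom \<one>\<^bsub>P\<^esub>])"
    and T_mult: "\<lbrakk>p \<in> carrier P; q \<in> carrier P\<rbrakk> \<Longrightarrow> T (Word [Isom p, Isom q, Coisom (p \<otimes>\<^bsub>P\<^esub> q)])"
begin

lemma T_adj': "T (word_adj u + u)" using T_adj[of "word_adj u"] by simp
lemma T_0: "T 0" using T_adj[of 0] by simp

lemma T_swap: "T (u + w) \<Longrightarrow> T (w + u)"
  using T_insert[of "u + w" w "word_adj w"] T_insert[OF T_adj[of w], of "w + u" 0] T_adj[of w]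
  by (simp add: add.assoc)

lemma T_star: "T (word_adj u) \<longleftrightarrow> T u"
proof -
  have "T u \<Longrightarrow> T (word_adj u)" for u using T_insert[of u 0 "word_adj u"] T_adj[of u] by simp
  from this[of u] this[of "word_adj u"] show ?thesis by auto
qed

abbreviation eqT where "eqT u w \<equiv> T (word_adj u + w)"

lemma eqT_sym: "eqT u w \<Longrightarrow> eqT w u"
  using T_star[of "word_adj u + w"] by (simp add: word_adj_plus)

lemma eqT_trans: "eqT u v \<Longrightarrow> eqT v w \<Longrightarrow> eqT u w"
  using T_insert[of "word_adj u + v" 0 "word_adj v + w"] T_insert[OF T_adj[of v], of "word_adj u" w]
  by (simp add: add.assoc)

text \<open>The canonical trace of the group, pulled back to \<open>*\<close>-polynomials.\<close>

definition \<tau> :: "'p star_poly \<Rightarrow> complex"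
  where "\<tau> f = (\<Sum>u\<in>Poly_Mapping.keys f. lookup f u * of_bool (T u))"

lemma \<tau>_super:
  "finite I \<Longrightarrow> Poly_Mapping.keys f \<subseteq> I \<Longrightarrow> \<tau> f = (\<Sum>u\<in>I. lookup f u * of_bool (T u))"
  unfolding \<tau>_def by (rule sum.mono_neutral_left) (auto simp: in_keys_iff)

lemma \<tau>_add: "\<tau> (f + g) = \<tau> f + \<tau> g"
proof -
  let ?I = "Poly_Mapping.keys f \<union> Poly_Mapping.keys g"
  have "\<tau> (f + g) = (\<Sum>u\<in>?I. lookup (f + g) u * of_bool (T u))"
    by (rule \<tau>_super) (use keys_add[of f g] in auto)
  then show ?thesis using \<tau>_super[of ?I f] \<tau>_super[of ?I g]
    by (simp add: lookup_add distrib_right sum.distrib)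
qed

lemma \<tau>_single: "\<tau> (Poly_Mapping.single u c) = c * of_bool (T u)"
  by (cases "c = 0") (simp_all add: \<tau>_def)

lemma \<tau>_0: "\<tau> 0 = 0" by (simp add: \<tau>_def)
lemma \<tau>_1: "\<tau> 1 = 1" using \<tau>_single[of 0 1] T_0 by simp

lemma \<tau>_scal: "\<tau> (poly_scal c f) = c * \<tau> f"
proof (induction f rule: poly_ind)
  case zero show ?case by (simp add: poly_scal_def \<tau>_0)
next
  case (single u d) show ?case by (simp add: poly_scal_def mult_single \<tau>_single)
next
  case (add f g) then show ?case by (simp add: poly_scal_laws \<tau>_add distrib_left)
qed

lemma \<tau>_minus: "\<tau> (- f) = - \<tau> f"
  using \<tau>_add[of f "- f"] by (simp add: \<tau>_0 eq_neg_iff_add_eq_0 add.commute)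

lemma \<tau>_diff: "\<tau> (f - g) = \<tau> f - \<tau> g"
  using \<tau>_add[of f "- g"] by (simp add: \<tau>_minus)

lemma \<tau>_star: "\<tau> (poly_star f) = cnj (\<tau> f)"
  by (induction f rule: poly_ind)
    (simp_all add: poly_star_0 \<tau>_0 poly_star_single \<tau>_single T_star poly_star_add \<tau>_add)

lemma \<tau>_trace: "\<tau> (f * g) = \<tau> (g * f)"
proof (induction f rule: poly_ind)
  case (single u c)
  show ?case
  proof (induction g rule: poly_ind)
    case (single w d)
    have "T (u + w) \<longleftrightarrow> T (w + u)" using T_swap by blast
    then show ?case by (simp add: mult_single \<tau>_single)
  qed (simp_all add: distrib_left distrib_right \<tau>_add)
qed (simp_all add: distrib_left distrib_right \<tau>_add)

lemma \<tau>_insert: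
  assumes "T u"
  shows "\<tau> (f * Poly_Mapping.single u 1 * g) = \<tau> (f * g)"
proof (induction f rule: poly_ind)
  case (single a c)
  show ?case
  proof (induction g rule: poly_ind)
    case (single b d) show ?case using T_insert[OF assms, of a b]
      by (simp add: mult_single \<tau>_single)
  qed (simp_all add: distrib_left distrib_right \<tau>_add)
qed (simp_all add: distrib_left distrib_right \<tau>_add)

text \<open>Grouping the words of \<open>f\<close> by their value in the group turns \<open>\<tau> (f\<^sup>* f)\<close> into the sum, over the
values, of the squared moduli of the collected coefficients. The representative \<open>r u\<close> names the
value of \<open>u\<close>.\<close>

lemma \<tau>_nonneg: "\<tau> (poly_star f * f) \<in> \<real>\<^sub>\<ge>\<^sub>0"
proof -
  let ?K = "Poly_Mapping.keys f" and ?s = Poly_Mapping.single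
  define r where "r u = (SOME v. eqT u v)" for u
  have r: "eqT u (r u)" for u unfolding r_def by (rule someI[of _ u]) (rule T_adj')
  have class_iff: "eqT u w \<longleftrightarrow> r w = r u" for u w
  proof
    assume "eqT u w"
    then have "eqT u = eqT w" using eqT_trans eqT_sym by blast
    then show "r w = r u" by (simp add: r_def)
  qed (metis r eqT_trans eqT_sym)
  define F where "F c = (\<Sum>u\<in>{u\<in>?K. r u = c}. lookup f u)" for c
  have "poly_star f * f
      = poly_star (\<Sum>u\<in>?K. ?s u (lookup f u)) * (\<Sum>w\<in>?K. ?s w (lookup f w))"
    using poly_sum[of f] by simp
  also have "\<dots> = (\<Sum>u\<in>?K. \<Sum>w\<in>?K. ?s (word_adj u + w) (cnj (lookup f u) * lookup f w))"
    by (simp add: poly_star_sum poly_star_single sum_product mult_single)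
  finally have ff: "poly_star f * f
      = (\<Sum>u\<in>?K. \<Sum>w\<in>?K. ?s (word_adj u + w) (cnj (lookup f u) * lookup f w))" .
  have \<tau>_sum: "\<tau> (sum h I) = (\<Sum>i\<in>I. \<tau> (h i))" for h and I :: "'p word set"
    by (induction I rule: infinite_finite_induct) (simp_all add: \<tau>_0 \<tau>_add)
  have "\<tau> (poly_star f * f) =
      (\<Sum>u\<in>?K. \<Sum>w\<in>?K. cnj (lookup f u) * lookup f w * of_bool (eqT u w))"
    unfolding ff by (simp add: \<tau>_sum \<tau>_single)
  also have "\<dots> = (\<Sum>u\<in>?K. cnj (lookup f u) * F (r u))"
    unfolding F_def class_iff sum_distrib_left
    by (rule sum.cong[OF HOL.refl]) (simp add: sum.inter_filter[symmetric] of_bool_def if_distrib cong: if_cong)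
  also have "\<dots> = (\<Sum>c\<in>r ` ?K. \<Sum>u\<in>{u\<in>?K. r u = c}. cnj (lookup f u) * F (r u))"
    by (rule sum.image_gen) simp
  also have "\<dots> = (\<Sum>c\<in>r ` ?K. cnj (F c) * F c)"
    by (rule sum.cong[OF HOL.refl]) (simp add: F_def sum_distrib_right)
  also have "\<dots> = complex_of_real (\<Sum>c\<in>r ` ?K. (cmod (F c))\<^sup>2)"
    by (simp add: complex_norm_square mult.commute del: of_real_power)
  also have "\<dots> \<in> \<real>\<^sub>\<ge>\<^sub>0"
    by (simp only: nonneg_Reals_of_real_iff) (simp add: sum_nonneg)
  finally show ?thesis .
qed

text \<open>The GNS construction for \<open>\<tau>\<close>, carried out with seminorms: \<open>op_norm f\<close> is the operator norm of
left multiplication by \<open>f\<close> on the pre-Hilbert space of \<open>*\<close>-polynomials with the inner product \<open>ip\<close>. It is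
finite because every word acts isometrically.\<close>

definition ip where "ip f g = \<tau> (poly_star f * g)"
definition nrm2 :: "'p star_poly \<Rightarrow> real" where "nrm2 f = sqrt (Re (ip f f))"

lemma ip_add: "ip f (g + h) = ip f g + ip f h" "ip (g + h) f = ip g f + ip h f"
  by (simp_all add: ip_def distrib_left distrib_right \<tau>_add poly_star_add)
lemma ip_scal: "ip f (poly_scal c g) = c * ip f g" "ip (poly_scal c f) g = cnj c * ip f g"
  by (simp_all add: ip_def poly_scal_laws \<tau>_scal)
lemma ip_sym: "ip g f = cnj (ip f g)"
  using \<tau>_star[of "poly_star f * g"] by (simp add: ip_def poly_star_mult poly_star_star)
lemma ip_nonneg: "ip f f \<in> \<real>\<^sub>\<ge>\<^sub>0" by (simp add: ip_def \<tau>_nonneg)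
lemma nrm2_ge: "0 \<le> nrm2 f" using ip_nonneg[of f] by (simp add: nrm2_def complex_nonneg_Reals_iff)
lemma ip_self: "ip f f = complex_of_real ((nrm2 f)\<^sup>2)"
  using ip_nonneg[of f] by (simp add: nrm2_def complex_nonneg_Reals_iff complex_eq_iff)

lemma cauchy_schwarz: "cmod (ip f g) \<le> nrm2 f * nrm2 g"
proof -
  define c where "c = ip f g"
  define a b C where "a = (nrm2 f)\<^sup>2" and "b = (nrm2 g)\<^sup>2" and "C = (cmod c)\<^sup>2"
  (* Positivity of the form at x f - y (cnj c) g. The pairs (b, 1), (C, a) and (1, 1) for (x, y)
     cover the cases that b is positive, that a is positive, and that both vanish. *)
  have ge: "0 \<le> x\<^sup>2 * a + C * y\<^sup>2 * b - 2 * x * y * C" for x y :: real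
  proof -
    let ?h = "poly_scal (of_real x) f + poly_scal (- of_real y * cnj c) g"
    have "ip ?h ?h = of_real (x\<^sup>2 * a) + of_real (y\<^sup>2 * b) * (c * cnj c) - 2 * of_real (x * y) * (c * cnj c)"
      using ip_sym[of g f] ip_self[of f] ip_self[of g]
      by (simp add: ip_add ip_scal a_def b_def c_def[symmetric] algebra_simps power2_eq_square)
    also have "c * cnj c = of_real C" unfolding C_def by (rule complex_norm_square[symmetric])
    also have "of_real (x\<^sup>2 * a) + of_real (y\<^sup>2 * b) * of_real C - 2 * of_real (x * y) * of_real C
        = complex_of_real (x\<^sup>2 * a + C * y\<^sup>2 * b - 2 * x * y * C)" by simp
    finally have "Re (ip ?h ?h) = x\<^sup>2 * a + C * y\<^sup>2 * b - 2 * x * y * C" by (simp only: Re_complex_of_real)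
    then show ?thesis using ip_nonneg[of ?h] by (simp add: complex_nonneg_Reals_iff)
  qed
  have "C \<le> a * b"
  proof (rule ccontr)
    assume less: "\<not> C \<le> a * b"
    have ab: "0 \<le> a" "0 \<le> b" by (simp_all add: a_def b_def)
    then have C: "0 < C" using less by (smt (verit) mult_nonneg_nonneg)
    have "0 \<le> b * (a * b - C)" using ge[of b 1] by (simp add: algebra_simps power2_eq_square)
    then have b: "b = 0" using less ab by (auto simp: zero_le_mult_iff)
    have "0 \<le> C * (a * (- C))" using ge[of C a] b by (simp add: algebra_simps power2_eq_square)
    then have "a = 0" using C ab by (auto simp: zero_le_mult_iff mult_le_0_iff)
    then show False using ge[of 1 1] b C by simp
  qed
  then have "(cmod c)\<^sup>2 \<le> (nrm2 f * nrm2 g)\<^sup>2" by (simp add: C_def a_def b_def power_mult_distrib)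
  then show ?thesis unfolding c_def by (rule power2_le_imp_le) (simp add: nrm2_ge)
qed

lemma nrm2_add: "nrm2 (f + g) \<le> nrm2 f + nrm2 g"
proof (rule power2_le_imp_le)
  have "Re (ip (f + g) (f + g)) = (nrm2 f)\<^sup>2 + (nrm2 g)\<^sup>2 + 2 * Re (ip f g)"
    using ip_sym[of g f] ip_self[of f] ip_self[of g] by (simp add: ip_add)
  also have "Re (ip f g) \<le> nrm2 f * nrm2 g"
    using cauchy_schwarz[of f g] complex_Re_le_cmod order_trans by blast
  finally have "Re (ip (f + g) (f + g)) \<le> (nrm2 f)\<^sup>2 + (nrm2 g)\<^sup>2 + 2 * (nrm2 f * nrm2 g)" by simp
  then show "(nrm2 (f + g))\<^sup>2 \<le> (nrm2 f + nrm2 g)\<^sup>2"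
    by (simp add: ip_self power2_sum)
qed (simp add: nrm2_ge)

lemma nrm2_scal: "nrm2 (poly_scal c f) = cmod c * nrm2 f"
proof -
  have "Re (ip (poly_scal c f) (poly_scal c f)) = (cmod c)\<^sup>2 * (nrm2 f)\<^sup>2"
  proof -
    have "ip (poly_scal c f) (poly_scal c f) = (c * cnj c) * ip f f" by (simp add: ip_scal)
    then show ?thesis by (simp add: ip_self complex_norm_square[symmetric] del: of_real_power flip: of_real_mult)
  qed
  then show ?thesis by (simp add: nrm2_def[of "poly_scal c f"] real_sqrt_mult nrm2_ge)
qed

lemma nrm2_0: "nrm2 0 = 0" by (simp add: nrm2_def ip_def \<tau>_0)
lemma poly_star_1: "poly_star 1 = (1 :: 'p star_poly)"
  using poly_star_single[of "0 :: 'p word" 1] by simp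
lemma nrm2_1: "nrm2 1 = 1"
  by (simp add: nrm2_def ip_def poly_star_1 \<tau>_1)

lemma adj_word_mult:
  "Poly_Mapping.single (word_adj u + w) (1::complex)
    = Poly_Mapping.single (word_adj u) 1 * Poly_Mapping.single w 1"
  by (simp add: mult_single)

lemma nrm2_word: "nrm2 (Poly_Mapping.single u 1 * g) = nrm2 g"
proof -
  have "poly_star (Poly_Mapping.single u 1 * g) * (Poly_Mapping.single u 1 * g)
      = poly_star g * Poly_Mapping.single (word_adj u + u) 1 * g"
    by (simp add: poly_star_mult poly_star_single adj_word_mult mult.assoc)
  then show ?thesis using \<tau>_insert[OF T_adj', of "poly_star g" u g] by (simp add: nrm2_def ip_def)
qed

lemma nrm2_mult_l1: "nrm2 (f * g) \<le> l1 f * nrm2 g"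
proof -
  have "nrm2 ((\<Sum>u\<in>I. Poly_Mapping.single u (c u)) * g) \<le> (\<Sum>u\<in>I. cmod (c u)) * nrm2 g"
    if "finite I" for I and c :: "'p word \<Rightarrow> complex"
    using that
  proof (induction I rule: finite_induct)
    case (insert u I)
    have "nrm2 (Poly_Mapping.single u (c u) * g) = cmod (c u) * nrm2 g"
      by (subst poly_scal_single) (simp add: poly_scal_laws nrm2_scal nrm2_word)
    then show ?case
      using insert nrm2_add[of "Poly_Mapping.single u (c u) * g" "(\<Sum>u\<in>I. Poly_Mapping.single u (c u)) * g"]
      by (simp add: distrib_right)
  qed (simp add: nrm2_0)
  from this[of "Poly_Mapping.keys f" "lookup f"] show ?thesis
    using poly_sum[of f] by (simp add: l1_def)
qed

definition op_norm :: "'p star_poly \<Rightarrow> real"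
  where "op_norm f = (SUP g\<in>{g. nrm2 g \<le> 1}. nrm2 (f * g))"

lemma op_norm_bdd: "bdd_above ((\<lambda>g. nrm2 (f * g)) ` {g. nrm2 g \<le> 1})"
proof (rule bdd_aboveI2)
  fix g assume "g \<in> {g. nrm2 g \<le> 1}"
  moreover have "0 \<le> l1 f" by (simp add: l1_def sum_nonneg)
  ultimately show "nrm2 (f * g) \<le> l1 f"
    using nrm2_mult_l1[of f g] mult_left_mono[of "nrm2 g" 1 "l1 f"] by simp
qed

lemma op_norm_upper: "nrm2 (f * g) \<le> op_norm f * nrm2 g"
proof (cases "nrm2 g = 0")
  case True
  then show ?thesis using nrm2_mult_l1[of f g] nrm2_ge[of "f * g"] by simp
next
  case False
  then have pos: "0 < nrm2 g" using nrm2_ge[of g] by simp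
  define g' where "g' = poly_scal (of_real (inverse (nrm2 g))) g"
  have g': "nrm2 g' = 1" using pos by (simp add: g'_def nrm2_scal norm_inverse del: of_real_inverse)
  then have "nrm2 (f * g') \<le> op_norm f"
    unfolding op_norm_def by (intro cSUP_upper op_norm_bdd) simp
  moreover have "nrm2 (f * g') = inverse (nrm2 g) * nrm2 (f * g)"
    using pos by (simp add: g'_def poly_scal_laws nrm2_scal norm_inverse del: of_real_inverse)
  ultimately show ?thesis using pos by (simp add: field_simps)
qed

lemma op_norm_least:
  assumes "0 \<le> K" "\<And>g. nrm2 (f * g) \<le> K * nrm2 g"
  shows "op_norm f \<le> K"
  unfolding op_norm_def
proof (rule cSUP_least)
  show "{g. nrm2 g \<le> 1} \<noteq> {}" using nrm2_0 by (auto intro!: exI[of _ 0])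
  fix g assume "g \<in> {g. nrm2 g \<le> 1}"
  then show "nrm2 (f * g) \<le> K" using assms(2)[of g] mult_left_mono[of "nrm2 g" 1 K] assms(1) by simp
qed

lemma op_norm_ge: "0 \<le> op_norm f"
  using op_norm_upper[of f 1] nrm2_ge[of f] by (simp add: nrm2_1)

lemma op_norm_scal: "op_norm (poly_scal c f) = cmod c * op_norm f"
proof -
  have le: "op_norm (poly_scal c f) \<le> cmod c * op_norm f" for c f
    by (rule op_norm_least)
      (simp_all add: op_norm_ge poly_scal_laws nrm2_scal mult.assoc op_norm_upper mult_left_mono)
  show ?thesis
  proof (cases "c = 0")
    case True then show ?thesis using le[of c f] op_norm_ge[of "poly_scal c f"] by simp
  next
    case False
    then have "op_norm f \<le> cmod (inverse c) * op_norm (poly_scal c f)"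
      using le[of "inverse c" "poly_scal c f"] by (simp add: poly_scal_laws poly_scal_1)
    then have "cmod c * op_norm f \<le> op_norm (poly_scal c f)"
      using False by (simp add: norm_inverse norm_divide field_simps)
    then show ?thesis using le[of c f] by simp
  qed
qed

lemma op_norm_mult: "op_norm (f * g) \<le> op_norm f * op_norm g"
proof (rule op_norm_least)
  fix h
  have "nrm2 (f * (g * h)) \<le> op_norm f * nrm2 (g * h)" by (rule op_norm_upper)
  also have "\<dots> \<le> op_norm f * (op_norm g * nrm2 h)"
    by (intro mult_left_mono op_norm_upper op_norm_ge)
  finally show "nrm2 (f * g * h) \<le> op_norm f * op_norm g * nrm2 h" by (simp add: mult.assoc)
qed (simp add: op_norm_ge)

lemma op_norm_star: "op_norm (poly_star f * f) = (op_norm f)\<^sup>2"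
proof -
  have le: "(op_norm f)\<^sup>2 \<le> op_norm (poly_star f * f)" for f
  proof -
    have "op_norm f \<le> sqrt (op_norm (poly_star f * f))"
    proof (rule op_norm_least)
      fix g
      have "(nrm2 (f * g))\<^sup>2 = Re (ip g (poly_star f * f * g))"
        using ip_self[of "f * g"] by (simp add: ip_def poly_star_mult mult.assoc)
      also have "\<dots> \<le> nrm2 g * nrm2 (poly_star f * f * g)"
        using cauchy_schwarz complex_Re_le_cmod order_trans by blast
      also have "\<dots> \<le> nrm2 g * (op_norm (poly_star f * f) * nrm2 g)"
        by (intro mult_left_mono op_norm_upper nrm2_ge)
      also have "\<dots> = (sqrt (op_norm (poly_star f * f)) * nrm2 g)\<^sup>2"
        by (simp add: power_mult_distrib op_norm_ge power2_eq_square[of "nrm2 g"])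
      finally show "nrm2 (f * g) \<le> sqrt (op_norm (poly_star f * f)) * nrm2 g"
        by (rule power2_le_imp_le) (simp add: op_norm_ge nrm2_ge)
    qed (simp add: op_norm_ge)
    then show ?thesis using power_mono[OF _ op_norm_ge, of f _ 2] by (fastforce simp: op_norm_ge)
  qed
  have "op_norm f \<le> op_norm (poly_star f)" for f
  proof (cases "op_norm f = 0")
    case False
    have "op_norm f * op_norm f \<le> op_norm (poly_star f) * op_norm f"
      using le[of f] op_norm_mult[of "poly_star f" f] by (simp add: power2_eq_square)
    then show ?thesis using False op_norm_ge[of f] by simp
  qed (simp add: op_norm_ge)
  from this[of f] this[of "poly_star f"] have "op_norm (poly_star f) = op_norm f"
    by (simp add: poly_star_star)
  then have "op_norm (poly_star f * f) \<le> (op_norm f)\<^sup>2"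
    using op_norm_mult[of "poly_star f" f] by (simp add: power2_eq_square)
  then show ?thesis using le[of f] by simp
qed

text \<open>Words with the same value in the group act by the same operator. As the letters act by unitary
operators, this includes the relation for least common multiples: all range projections are one.\<close>

lemma op_norm_kills:
  assumes "eqT a b"
  shows "op_norm (Poly_Mapping.single a 1 - Poly_Mapping.single b 1) = 0"
proof -
  let ?s = "\<lambda>u. Poly_Mapping.single u (1::complex)"
  have "nrm2 ((?s a - ?s b) * g) = 0" for g
  proof -
    have "poly_star ((?s a - ?s b) * g) * ((?s a - ?s b) * g)
        = poly_star g * ?s (word_adj a + a) * g - poly_star g * ?s (word_adj a + b) * g
          - (poly_star g * ?s (word_adj b + a) * g - poly_star g * ?s (word_adj b + b) * g)"
      by (simp add: poly_star_mult poly_star_diff poly_star_single adj_word_mult algebra_simps)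
    then show ?thesis
      using \<tau>_insert[OF assms] \<tau>_insert[OF eqT_sym[OF assms]] \<tau>_insert[OF T_adj']
      by (simp add: nrm2_def ip_def \<tau>_diff)
  qed
  then have "op_norm (?s a - ?s b) \<le> 0" by (intro op_norm_least) (simp_all add: nrm2_ge)
  then show ?thesis using op_norm_ge[of "?s a - ?s b"] by simp
qed

lemma op_norm_nica: "nica_seminorm P op_norm"
proof -
  have "op_norm (f + g) \<le> op_norm f + op_norm g" for f g
  proof (rule op_norm_least)
    fix h
    show "nrm2 ((f + g) * h) \<le> (op_norm f + op_norm g) * nrm2 h"
      using nrm2_add[of "f * h" "g * h"] op_norm_upper[of f h] op_norm_upper[of g h]
      by (simp add: distrib_right)
  qed (simp add: op_norm_ge)
  moreover have "op_norm x = 0" if "x \<in> nica_relators P" for x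
  proof -
    have pp: "T (Word [Isom p, Coisom p])" for p
      using T_adj[of "Word [Isom p]"] by (simp add: word_adj_def plus_word_def)
    have "T (Word [Isom p, Coisom p] + Word [Isom q, Coisom q])" for p q
      using T_insert[OF pp[of p], of 0 "Word [Isom q, Coisom q]"] pp[of q] by simp
    then have "T (Word [Isom p, Coisom p, Isom q, Coisom q])" for p q
      by (simp add: plus_word_def)
    then have ppqq: "eqT (Word [Isom p, Coisom p, Isom q, Coisom q]) (Word [Isom r, Coisom r])" for p q r
      using pp[of r] T_star[of "Word [Isom p, Coisom p, Isom q, Coisom q]"]
        T_insert[of "Word [Isom r, Coisom r]" "word_adj (Word [Isom p, Coisom p, Isom q, Coisom q])" 0]
      by simp
    have "\<exists>a b. x = Poly_Mapping.single a 1 - Poly_Mapping.single b 1 \<and> eqT a b"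
      using that unfolding nica_relators_def
    proof (elim UnE)
      assume "x \<in> {poly_star (gen p) * gen p - 1 | p. p \<in> carrier P}"
      then obtain p where x: "x = poly_star (gen p) * gen p - 1" by blast
      have "eqT (Word [Coisom p, Isom p]) 0"
        using T_adj[of "Word [Coisom p]"] by (simp add: word_adj_def plus_word_def zero_word_def)
      moreover have "x = Poly_Mapping.single (Word [Coisom p, Isom p]) 1 - Poly_Mapping.single 0 1"
        by (simp add: x gen_def poly_star_single mult_single word_adj_def plus_word_def)
      ultimately show ?thesis by blast
    next
      assume "x \<in> {gen \<one>\<^bsub>P\<^esub> - 1}"
      then have "x = Poly_Mapping.single (Word [Isom \<one>\<^bsub>P\<^esub>]) 1 - Poly_Mapping.single 0 1"
        by (simp add: gen_def)
      moreover have "eqT (Word [Isom \<one>\<^bsub>P\<^esub>]) 0" using T_one T_star by simp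
      ultimately show ?thesis by blast
    next
      assume "x \<in> {gen p * gen q - gen (p \<otimes>\<^bsub>P\<^esub> q) | p q. p \<in> carrier P \<and> q \<in> carrier P}"
      then obtain p q where x: "x = gen p * gen q - gen (p \<otimes>\<^bsub>P\<^esub> q)" and "p \<in> carrier P" "q \<in> carrier P"
        by blast
      then have "T (Word [Isom p, Isom q] + word_adj (Word [Isom (p \<otimes>\<^bsub>P\<^esub> q)]))"
        using T_mult by (simp add: plus_word_def word_adj_def)
      then have "eqT (Word [Isom p, Isom q]) (Word [Isom (p \<otimes>\<^bsub>P\<^esub> q)])"
        using T_swap eqT_sym by blast
      moreover have "x = Poly_Mapping.single (Word [Isom p, Isom q]) 1
          - Poly_Mapping.single (Word [Isom (p \<otimes>\<^bsub>P\<^esub> q)]) 1"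
        by (simp add: x gen_def mult_single plus_word_def)
      ultimately show ?thesis by blast
    next
      assume "x \<in> {gen p * poly_star (gen p) * gen q * poly_star (gen q) - gen r * poly_star (gen r)
        | p q r. p \<in> carrier P \<and> q \<in> carrier P \<and> is_rlcm P p q r}"
      then obtain p q r where
        x: "x = gen p * poly_star (gen p) * gen q * poly_star (gen q) - gen r * poly_star (gen r)"
        by blast
      then have "x = Poly_Mapping.single (Word [Isom p, Coisom p, Isom q, Coisom q]) 1
          - Poly_Mapping.single (Word [Isom r, Coisom r]) 1"
        by (simp add: gen_def poly_star_single mult_single word_adj_def plus_word_def)
      then show ?thesis using ppqq by blast
    qed
    then show ?thesis using op_norm_kills by blast
  qed
  ultimately show ?thesis
    by (auto simp: nica_seminorm_def cstar_seminorm_def op_norm_ge op_norm_scal op_norm_mult op_norm_star)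
qed

text \<open>The vector \<open>1\<close> is a unit vector that implements \<open>\<tau>\<close>, and the universal norm dominates \<open>op_norm\<close>; so \<open>\<tau>\<close>
extends to the completion by continuity.\<close>

lemma \<tau>_le_nica_norm:
  assumes "f \<in> star_polys P"
  shows "cmod (\<tau> f) \<le> nica_norm P f"
proof -
  have "ip 1 f = \<tau> f" by (simp add: ip_def poly_star_1)
  then have "cmod (\<tau> f) \<le> nrm2 f" using cauchy_schwarz[of 1 f] by (simp add: nrm2_1)
  also have "\<dots> \<le> op_norm f" using op_norm_upper[of f 1] by (simp add: nrm2_1)
  also have "\<dots> \<le> nica_norm P f" by (rule norm_ub[OF op_norm_nica assms])
  finally show ?thesis .
qed

abbreviation A where "A \<equiv> semigroup_cstar P"

sublocale sn: cstar_seminormed "star_polys P" poly_scal poly_star "nica_norm P"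
  by (rule seminormed[OF nica_norm_seminorm])

definition trace_state :: "(nat \<Rightarrow> 'p star_poly) set \<Rightarrow> complex"
  where "trace_state a = lim (\<lambda>k. \<tau> (class_rep a k))"

lemma trace_state_lim:
  assumes X: "X \<in> sn.C"
  shows "(\<lambda>k. \<tau> (X k)) \<longlonglongrightarrow> trace_state (sn.cl X)"
proof -
  let ?Y = "class_rep (sn.cl X)"
  note Y = sn.rep_C[OF X]
  have "Cauchy (\<lambda>k. \<tau> (?Y k))"
  proof (rule CauchyI)
    fix e :: real assume "e > 0"
    then obtain K where K: "\<forall>i\<ge>K. \<forall>j\<ge>K. nica_norm P (?Y i - ?Y j) < e"
      using sn.C_cauchy[OF Y] by blast
    have "cmod (\<tau> (?Y i) - \<tau> (?Y j)) \<le> nica_norm P (?Y i - ?Y j)" for i j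
      using \<tau>_le_nica_norm[OF sn.S_diff[OF sn.C_S[OF Y] sn.C_S[OF Y]]] by (simp add: \<tau>_diff)
    then show "\<exists>K. \<forall>i\<ge>K. \<forall>j\<ge>K. cmod (\<tau> (?Y i) - \<tau> (?Y j)) < e"
      using K le_less_trans by blast
  qed
  then have lim: "(\<lambda>k. \<tau> (?Y k)) \<longlonglongrightarrow> trace_state (sn.cl X)"
    unfolding trace_state_def by (simp add: Cauchy_convergent_iff convergent_LIMSEQ_iff)
  have "(\<lambda>k. \<tau> (X k) - \<tau> (?Y k)) \<longlonglongrightarrow> 0"
  proof (rule Lim_null_comparison)
    show "\<forall>\<^sub>F k in sequentially. norm (\<tau> (X k) - \<tau> (?Y k)) \<le> nica_norm P (X k - ?Y k)"
      using \<tau>_le_nica_norm[OF sn.S_diff[OF sn.C_S[OF X] sn.C_S[OF Y]]] by (simp add: \<tau>_diff)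
    show "(\<lambda>k. nica_norm P (X k - ?Y k)) \<longlonglongrightarrow> 0"
      using sn.rep_eqv[OF X] by (simp add: sn.eqv_def)
  qed
  then show ?thesis using Lim_transform[OF lim, of "\<lambda>k. \<tau> (X k)"] by simp
qed

lemma trace_state_eqI: "X \<in> sn.C \<Longrightarrow> (\<lambda>k. \<tau> (X k)) \<longlonglongrightarrow> c \<Longrightarrow> trace_state (sn.cl X) = c"
  using trace_state_lim LIMSEQ_unique by blast

lemma trace_state_pin: "f \<in> star_polys P \<Longrightarrow> trace_state (pin P f) = \<tau> f"
  unfolding pin_def by (rule trace_state_eqI) (auto intro: sn.const_C)

lemma trace_state_state: "state A trace_state"
  unfolding state_def
proof (intro conjI ballI allI)
  show "trace_state \<one>\<^bsub>A\<^esub> = 1"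
    using trace_state_pin[OF sn.S1] by (simp add: pin_one \<tau>_1)
  fix x assume "x \<in> carrier A"
  then obtain X where X: "X \<in> sn.C" "x = sn.cl X" by (auto simp: sgc[symmetric] sn.car)
  note lx = trace_state_lim[OF X(1)]
  show "trace_state (c \<odot>\<^bsub>A\<^esub> x) = c * trace_state x" for c
    unfolding X(2) sgc[symmetric] sn.A_smult[OF X(1)]
    by (rule trace_state_eqI[OF sn.scal_C[OF X(1)]]) (simp add: \<tau>_scal tendsto_mult_left lx)
  have "sn.cl (\<lambda>k. poly_star (X k) * X k) = adj A x \<otimes>\<^bsub>A\<^esub> x"
    unfolding X(2) sgc[symmetric] using X(1) by (simp add: sn.A_adj sn.A_mult sn.star_C)
  then have "(\<lambda>k. \<tau> (poly_star (X k) * X k)) \<longlonglongrightarrow> trace_state (adj A x \<otimes>\<^bsub>A\<^esub> x)"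
    using trace_state_lim[OF sn.mult_C[OF sn.star_C[OF X(1)] X(1)]] by simp
  then show "trace_state (adj A x \<otimes>\<^bsub>A\<^esub> x) \<in> \<real>\<^sub>\<ge>\<^sub>0"
    by (rule closed_sequentially[OF closed_nonneg_Reals_complex, rotated]) (rule \<tau>_nonneg)
  fix y assume "y \<in> carrier A"
  then obtain Y where Y: "Y \<in> sn.C" "y = sn.cl Y" by (auto simp: sgc[symmetric] sn.car)
  show "trace_state (x \<oplus>\<^bsub>A\<^esub> y) = trace_state x + trace_state y"
    unfolding X(2) Y(2) sgc[symmetric] sn.A_add[OF X(1) Y(1)]
    by (rule trace_state_eqI[OF sn.add_C[OF X(1) Y(1)]])
      (simp add: \<tau>_add tendsto_add trace_state_lim X Y)
qed

lemma trace_state_trace: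
  assumes "x \<in> carrier A" "y \<in> carrier A"
  shows "trace_state (x \<otimes>\<^bsub>A\<^esub> y) = trace_state (y \<otimes>\<^bsub>A\<^esub> x)"
proof -
  obtain X Y where X: "X \<in> sn.C" "x = sn.cl X" and Y: "Y \<in> sn.C" "y = sn.cl Y"
    using assms by (auto simp: sgc[symmetric] sn.car)
  have "(\<lambda>k. \<tau> (X k * Y k)) \<longlonglongrightarrow> trace_state (y \<otimes>\<^bsub>A\<^esub> x)"
    using trace_state_lim[OF sn.mult_C[OF Y(1) X(1)]] \<tau>_trace X Y
    by (simp add: sgc[symmetric] sn.A_mult)
  then show ?thesis
    using trace_state_eqI[OF sn.mult_C[OF X(1) Y(1)]] X Y by (simp add: sgc[symmetric] sn.A_mult)
qed

lemma trace_state_gens: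
  assumes "p \<in> carrier P" "q \<in> carrier P"
  shows "trace_state (isom P p \<otimes>\<^bsub>A\<^esub> adj A (isom P q)) = of_bool (T (Word [Isom p, Coisom q]))"
proof -
  have "isom P p \<otimes>\<^bsub>A\<^esub> adj A (isom P q) = pin P (gen p * poly_star (gen q))"
    using assms by (simp add: pin_mult pin_star pin_gen sp_gen sn.S_star)
  moreover have "gen p * poly_star (gen q) = Poly_Mapping.single (Word [Isom p, Coisom q]) 1"
    by (simp add: gen_def poly_star_single mult_single word_adj_def plus_word_def)
  ultimately show ?thesis using assms
    by (simp add: trace_state_pin \<tau>_single sp_single)
qed

end

section \<open>Groups of fractions with a central denominator\<close>

text \<open>If every element of a cancellative monoid divides a power of a central element \<open>z\<close>, then
inverting \<open>z\<close> alone gives its group of fractions: the inverse of \<open>p\<close> is \<open>q / z\<^sup>k\<close> whenever \<open>p q = z\<^sup>k\<close>.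
A word is evaluated as a fraction by multiplying numerators and adding the exponents of \<open>z\<close> in
the denominators; it has value one iff the numerator is that power of \<open>z\<close>.\<close>

locale central_fractions = Group.monoid M for M :: "('p, 'm) monoid_scheme" (structure) +
  fixes z :: 'p
  assumes z_in: "z \<in> carrier M"
    and z_central: "p \<in> carrier M \<Longrightarrow> z \<otimes> p = p \<otimes> z"
    and left_cancel: "\<lbrakk>p \<in> carrier M; x \<in> carrier M; y \<in> carrier M; p \<otimes> x = p \<otimes> y\<rbrakk> \<Longrightarrow> x = y"
    and right_cancel: "\<lbrakk>p \<in> carrier M; x \<in> carrier M; y \<in> carrier M; x \<otimes> p = y \<otimes> p\<rbrakk> \<Longrightarrow> x = y"
    and divides: "p \<in> carrier M \<Longrightarrow> \<exists>q\<in>carrier M. \<exists>k::nat. p \<otimes> q = z [^] k"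
begin

lemma zpow_in [simp]: "z [^] (k::nat) \<in> carrier M" by (simp add: z_in)

lemma zpow_central: "p \<in> carrier M \<Longrightarrow> z [^] (k::nat) \<otimes> p = p \<otimes> z [^] k"
  by (rule group_commutes_pow) (simp_all add: z_central z_in)

definition cofactor :: "'p \<Rightarrow> 'p"
  where "cofactor p = (SOME q. q \<in> carrier M \<and> (\<exists>k::nat. p \<otimes> q = z [^] k))"
definition depth :: "'p \<Rightarrow> nat"
  where "depth p = (SOME k. p \<otimes> cofactor p = z [^] k)"

lemma cofactor:
  assumes p: "p \<in> carrier M"
  shows cofactor_in: "cofactor p \<in> carrier M"
    and cofactor_right: "p \<otimes> cofactor p = z [^] depth p"
    and cofactor_left: "cofactor p \<otimes> p = z [^] depth p"
proof -
  have ex: "cofactor p \<in> carrier M \<and> (\<exists>k::nat. p \<otimes> cofactor p = z [^] k)"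
    unfolding cofactor_def by (rule someI_ex) (use divides[OF p] in blast)
  then show c: "cofactor p \<in> carrier M" by blast
  show right: "p \<otimes> cofactor p = z [^] depth p"
    unfolding depth_def by (rule someI_ex) (use ex in blast)
  have "p \<otimes> (cofactor p \<otimes> p) = z [^] depth p \<otimes> p" using p c right by (simp add: m_assoc[symmetric])
  also have "\<dots> = p \<otimes> z [^] depth p" using p by (rule zpow_central)
  finally show "cofactor p \<otimes> p = z [^] depth p"
    by (rule left_cancel[OF p m_closed[OF c p] zpow_in])
qed

text \<open>Letters outside the monoid get the value one, so that evaluation is multiplicative on all
words.\<close>

primrec num :: "'p letter \<Rightarrow> 'p" where
  "num (Isom p) = (if p \<in> carrier M then p else \<one>)"
| "num (Coisom p) = (if p \<in> carrier M then cofactor p else \<one>)"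

primrec den :: "'p letter \<Rightarrow> nat" where
  "den (Isom p) = 0"
| "den (Coisom p) = (if p \<in> carrier M then depth p else 0)"

primrec nums :: "'p letter list \<Rightarrow> 'p" where
  "nums [] = \<one>"
| "nums (l # ls) = num l \<otimes> nums ls"

definition dens :: "'p letter list \<Rightarrow> nat" where "dens ls = sum_list (map den ls)"

definition trivial :: "'p word \<Rightarrow> bool"
  where "trivial u \<longleftrightarrow> nums (letters u) = z [^] dens (letters u)"

lemma num_in [simp]: "num l \<in> carrier M" by (cases l) (simp_all add: cofactor_in)
lemma nums_in [simp]: "nums ls \<in> carrier M" by (induction ls) simp_all
lemma nums_append: "nums (ls @ ms) = nums ls \<otimes> nums ms"
  by (induction ls) (simp_all add: m_assoc)
lemma dens_append: "dens (ls @ ms) = dens ls + dens ms" by (simp add: dens_def)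

lemma num_flip: "num l \<otimes> num (flip_letter l) = z [^] (den l + den (flip_letter l))"
  by (cases l) (simp_all add: cofactor_right cofactor_left)

lemma nums_flip:
  "nums (ls @ rev (map flip_letter ls)) = z [^] dens (ls @ rev (map flip_letter ls))"
proof (induction ls)
  case (Cons l ls)
  let ?m = "ls @ rev (map flip_letter ls)"
  have "nums ((l # ls) @ rev (map flip_letter (l # ls))) = num l \<otimes> (nums ?m \<otimes> num (flip_letter l))"
    by (simp add: nums_append m_assoc)
  also have "\<dots> = num l \<otimes> (num (flip_letter l) \<otimes> z [^] dens ?m)"
    unfolding Cons.IH by (simp only: zpow_central num_in)
  also have "\<dots> = z [^] (den l + den (flip_letter l) + dens ?m)"
    by (simp add: m_assoc[symmetric] num_flip nat_pow_mult z_in)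
  also have "den l + den (flip_letter l) + dens ?m = dens ((l # ls) @ rev (map flip_letter (l # ls)))"
    by (simp add: dens_def)
  finally show ?case .
qed (simp add: dens_def)

lemma trivial_insert:
  assumes "trivial u"
  shows "trivial (a + u + b) \<longleftrightarrow> trivial (a + b)"
proof -
  let ?a = "letters a" and ?u = "letters u" and ?b = "letters b"
  have "nums (?a @ ?u @ ?b) = nums ?a \<otimes> z [^] dens ?u \<otimes> nums ?b"
    using assms by (simp add: trivial_def nums_append m_assoc)
  also have "\<dots> = z [^] dens ?u \<otimes> nums (?a @ ?b)"
    by (simp add: zpow_central[symmetric] nums_append m_assoc)
  finally have n: "nums (?a @ ?u @ ?b) = z [^] dens ?u \<otimes> nums (?a @ ?b)" .
  have d: "z [^] dens (?a @ ?u @ ?b) = z [^] dens ?u \<otimes> z [^] dens (?a @ ?b)"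
    by (simp add: nat_pow_mult z_in dens_append ac_simps)
  have "nums (?a @ ?u @ ?b) = z [^] dens (?a @ ?u @ ?b) \<longleftrightarrow> nums (?a @ ?b) = z [^] dens (?a @ ?b)"
    unfolding n d using left_cancel by (metis zpow_in nums_in)
  then show ?thesis by (simp add: trivial_def plus_word_def)
qed

sublocale group_kernel M trivial
proof
  show "trivial (u + word_adj u)" for u
    using nums_flip[of "letters u"] by (simp add: trivial_def plus_word_def word_adj_def)
  show "trivial u \<Longrightarrow> trivial (a + u + b) \<longleftrightarrow> trivial (a + b)" for u a b by (rule trivial_insert)
  show "trivial (Word [Isom \<one>])" by (simp add: trivial_def dens_def)
  show "trivial (Word [Isom p, Isom q, Coisom (p \<otimes> q)])"
    if "p \<in> carrier M" "q \<in> carrier M" for p q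
    using that by (simp add: trivial_def dens_def m_assoc[symmetric] cofactor_in cofactor_right)
qed

text \<open>Right cancellation makes the monoid embed into its group of fractions.\<close>

lemma trivial_quotient:
  assumes "p \<in> carrier M" "q \<in> carrier M"
  shows "trivial (Word [Isom p, Coisom q]) \<longleftrightarrow> p = q"
proof -
  have "trivial (Word [Isom p, Coisom q]) \<longleftrightarrow> p \<otimes> cofactor q = q \<otimes> cofactor q"
    using assms by (simp add: trivial_def dens_def cofactor_in cofactor_right)
  then show ?thesis using right_cancel[OF cofactor_in[OF assms(2)] assms] by blast
qed

theorem tracial_gauge_invariant_state:
  "\<exists>\<phi>. state A \<phi> \<and> (\<forall>x\<in>carrier A. \<forall>y\<in>carrier A. \<phi> (x \<otimes>\<^bsub>A\<^esub> y) = \<phi> (y \<otimes>\<^bsub>A\<^esub> x)) \<and>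
     gauge_invariant M \<phi>"
  using trace_state_state trace_state_trace
  by (auto simp: gauge_invariant_def trace_state_gens trivial_quotient intro!: exI[of _ trace_state])

end

section \<open>Values of KMS states on range projections\<close>

context cstar_algebra
begin

lemma smult_laws: "x \<in> carrier A \<Longrightarrow> (c * d) \<odot> x = c \<odot> (d \<odot> x)"
    "x \<in> carrier A \<Longrightarrow> (c + d) \<odot> x = c \<odot> x \<oplus> d \<odot> x"
    "x \<in> carrier A \<Longrightarrow> 1 \<odot> x = x"
  using scalar.smult_assoc1[of c d x] scalar.smult_l_distr[of c d x] scalar.smult_one[of x]
  by (simp_all add: complex_ring_def)

lemma smult_diff: "x \<in> carrier A \<Longrightarrow> c \<odot> x \<ominus> d \<odot> x = (c - d) \<odot> x"
  using smult_laws(2)[of x c "- d"] smult_m1[of "d \<odot> x"] smult_laws(1)[of x "-1" d] smult_in[of x d]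
  by (simp add: a_minus_def)

lemma entire_scalar_curve:
  assumes x: "x \<in> carrier A" and f: "\<And>z. (f has_field_derivative f' z) (at z)"
  shows "entire_map A (\<lambda>z. f z \<odot> x)"
  unfolding entire_map_def
proof (intro conjI allI)
  fix z show "f z \<odot> x \<in> carrier A" using x by (rule smult_in)
  have "((\<lambda>w. cmod ((f w - f z) / (w - z) - f' z) * nrm A x) \<longlongrightarrow> cmod (f' z - f' z) * nrm A x) (at z)"
    by (intro tendsto_intros) (use f[of z] in \<open>simp add: has_field_derivative_iff\<close>)
  moreover have "nrm A (inverse (w - z) \<odot> (f w \<odot> x \<ominus> f z \<odot> x) \<ominus> f' z \<odot> x)
      = cmod ((f w - f z) / (w - z) - f' z) * nrm A x" for w
  proof -
    have "inverse (w - z) \<odot> (f w \<odot> x \<ominus> f z \<odot> x) = ((f w - f z) / (w - z)) \<odot> x"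
      using x by (simp add: smult_diff smult_laws(1)[symmetric] divide_inverse mult.commute)
    then show ?thesis using x by (simp add: smult_diff nrm_smult)
  qed
  ultimately show "\<exists>D\<in>carrier A.
      ((\<lambda>w. nrm A (inverse (w - z) \<odot> (f w \<odot> x \<ominus> f z \<odot> x) \<ominus> D)) \<longlongrightarrow> 0) (at z)"
    using smult_in[OF x] by (intro bexI[of _ "f' z \<odot> x"]) simp_all
qed

text \<open>The product of the complementary projections \<open>1 - e\<close> and \<open>1 - f\<close> is again a projection because they
commute, so a state is nonnegative on it.\<close>

lemma state_commuting_projections:
  assumes \<phi>: "state A \<phi>" and e: "e \<in> carrier A" "adj A e = e" "e \<otimes> e = e"
    and f: "f \<in> carrier A" "adj A f = f" "f \<otimes> f = f" and ef: "e \<otimes> f = f \<otimes> e"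
  shows "1 - \<phi> e - \<phi> f + \<phi> (e \<otimes> f) \<in> \<real>\<^sub>\<ge>\<^sub>0"
proof -
  have compl: "\<one> \<ominus> p \<in> carrier A" "adj A (\<one> \<ominus> p) = \<one> \<ominus> p" "(\<one> \<ominus> p) \<otimes> (\<one> \<ominus> p) = \<one> \<ominus> p"
    if p: "p \<in> carrier A" "adj A p = p" "p \<otimes> p = p" for p
  proof -
    show "\<one> \<ominus> p \<in> carrier A" using p by simp
    have "adj A (\<ominus> p) = \<ominus> p" using adj_smult[OF p(1), of "-1"] p by (simp add: smult_m1)
    then show "adj A (\<one> \<ominus> p) = \<one> \<ominus> p" using p by (simp add: a_minus_def adj_add adj_one)
    show "(\<one> \<ominus> p) \<otimes> (\<one> \<ominus> p) = \<one> \<ominus> p"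
      using p by (simp add: a_minus_def l_distr r_distr l_minus r_minus r_neg)
  qed
  note e' = compl[OF e] and f' = compl[OF f]
  let ?x = "(\<one> \<ominus> e) \<otimes> (\<one> \<ominus> f)"
  have exp: "(\<one> \<ominus> p) \<otimes> (\<one> \<ominus> q) = \<one> \<oplus> (-1) \<odot> p \<oplus> (-1) \<odot> q \<oplus> p \<otimes> q"
    if "p \<in> carrier A" "q \<in> carrier A" for p q
    using that by (simp add: smult_m1 a_minus_def l_distr r_distr l_minus r_minus minus_add a_ac)
  have comm: "(\<one> \<ominus> f) \<otimes> (\<one> \<ominus> e) = ?x"
    using e f ef smult_in by (simp add: exp a_ac)
  have "adj A ?x \<otimes> ?x = (\<one> \<ominus> f) \<otimes> (\<one> \<ominus> e) \<otimes> ((\<one> \<ominus> e) \<otimes> (\<one> \<ominus> f))"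
    using e' f' by (simp add: adj_mult)
  also have "\<dots> = (\<one> \<ominus> f) \<otimes> ((\<one> \<ominus> e) \<otimes> (\<one> \<ominus> e)) \<otimes> (\<one> \<ominus> f)"
    using e'(1) f'(1) by (simp add: m_assoc)
  also have "\<dots> = (\<one> \<ominus> e) \<otimes> ((\<one> \<ominus> f) \<otimes> (\<one> \<ominus> f))"
    unfolding e'(3) comm using e'(1) f'(1) by (simp add: m_assoc)
  finally have "adj A ?x \<otimes> ?x = ?x" unfolding f'(3) .
  then have "\<phi> ?x \<in> \<real>\<^sub>\<ge>\<^sub>0"
    using \<phi> e'(1) f'(1) m_closed unfolding state_def by metis
  moreover have "\<phi> ?x = 1 - \<phi> e - \<phi> f + \<phi> (e \<otimes> f)"
    using \<phi> e(1) f(1) smult_in unfolding state_def exp[OF e(1) f(1)] by simp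
  ultimately show ?thesis by simp
qed

end

lemma is_rlcm_sym: "is_rlcm P p q r \<Longrightarrow> is_rlcm P q p r"
  by (simp add: is_rlcm_def Int_commute)

text \<open>The function \<open>s \<mapsto> N\<^bsup>is\<^esup> v\<^sub>p\<close> extends \<open>t \<mapsto> \<sigma>\<^sub>t v\<^sub>p\<close>, so the KMS condition moves \<open>v\<^sub>p\<close> to the right of its adjoint
at the price of the factor \<open>N\<^bsup>-\<beta>\<^esup>\<close>, and \<open>v\<^sub>p\<^sup>* v\<^sub>p = 1\<close>.\<close>

lemma KMS_range_projection:
  assumes P: "Group.monoid P" and p: "p \<in> carrier P" and N: "N > 0"
    and \<sigma>: "\<And>t. \<sigma> t (isom P p) = (complex_of_real N powr (\<i> * complex_of_real t))
      \<odot>\<^bsub>semigroup_cstar P\<^esub> isom P p"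
    and KMS: "KMS_state (semigroup_cstar P) \<sigma> \<beta> \<phi>"
  shows "\<phi> (isom P p \<otimes>\<^bsub>semigroup_cstar P\<^esub> adj (semigroup_cstar P) (isom P p))
    = complex_of_real (N powr (- \<beta>))"
proof -
  interpret A: cstar_algebra "semigroup_cstar P" by (rule semigroup_cstar_is_cstar)
  note rep = isom_nica[OF P, unfolded nica_representation_def]
  let ?A = "semigroup_cstar P" and ?v = "isom P p"
  have v: "?v \<in> carrier ?A" "adj ?A ?v \<in> carrier ?A" "adj ?A ?v \<otimes>\<^bsub>?A\<^esub> ?v = \<one>\<^bsub>?A\<^esub>"
    using rep p A.adj_closed by auto
  define F where "F s = exp (\<i> * of_real (ln N) * s) \<odot>\<^bsub>?A\<^esub> ?v" for s
  have "entire_map ?A F"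
    unfolding F_def
    by (rule A.entire_scalar_curve[OF v(1), where f' = "\<lambda>s. \<i> * of_real (ln N) * exp (\<i> * of_real (ln N) * s)"])
      (auto intro!: derivative_eq_intros)
  moreover have "F (complex_of_real t) = \<sigma> t ?v" for t
    using N by (simp add: F_def \<sigma> powr_def Ln_of_real mult_ac)
  ultimately have "analytic_extension ?A \<sigma> ?v F" using v by (simp add: analytic_extension_def)
  then have "\<phi> (?v \<otimes>\<^bsub>?A\<^esub> adj ?A ?v) = \<phi> (adj ?A ?v \<otimes>\<^bsub>?A\<^esub> F (\<i> * complex_of_real \<beta>))"
    using KMS v(2) unfolding KMS_state_def by blast
  also have "F (\<i> * complex_of_real \<beta>) = complex_of_real (N powr (- \<beta>)) \<odot>\<^bsub>?A\<^esub> ?v"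
  proof -
    have "\<i> * of_real (ln N) * (\<i> * complex_of_real \<beta>) = complex_of_real (- \<beta> * ln N)"
      by (simp add: algebra_simps)
    then show ?thesis using N by (simp add: F_def powr_def exp_of_real flip: of_real_mult of_real_minus)
  qed
  also have "adj ?A ?v \<otimes>\<^bsub>?A\<^esub> (complex_of_real (N powr (- \<beta>)) \<odot>\<^bsub>?A\<^esub> ?v)
      = complex_of_real (N powr (- \<beta>)) \<odot>\<^bsub>?A\<^esub> \<one>\<^bsub>?A\<^esub>"
    using v by (simp add: A.smult_mult_right)
  finally show ?thesis using KMS by (simp add: KMS_state_def state_def)
qed

text \<open>The bound is inclusion-exclusion for the range projections of \<open>v\<^sub>p\<close> and \<open>v\<^sub>q\<close>, whose product is the
range projection of \<open>v\<^sub>r\<close>.\<close>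

lemma KMS_rlcm_bound:
  assumes P: "Group.monoid P" and p: "p \<in> carrier P" and q: "q \<in> carrier P" and r: "is_rlcm P p q r"
    and N: "\<And>p. p \<in> carrier P \<Longrightarrow> N p > 0"
    and \<sigma>: "\<And>t p. p \<in> carrier P \<Longrightarrow> \<sigma> t (isom P p) =
      (complex_of_real (N p) powr (\<i> * complex_of_real t)) \<odot>\<^bsub>semigroup_cstar P\<^esub> isom P p"
    and KMS: "KMS_state (semigroup_cstar P) \<sigma> \<beta> \<phi>"
  shows "0 \<le> 1 - N p powr (- \<beta>) - N q powr (- \<beta>) + N r powr (- \<beta>)"
proof -
  interpret A: cstar_algebra "semigroup_cstar P" by (rule semigroup_cstar_is_cstar)
  note rep = isom_nica[OF P, unfolded nica_representation_def]
  let ?A = "semigroup_cstar P"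
  define e where "e p = isom P p \<otimes>\<^bsub>?A\<^esub> adj ?A (isom P p)" for p
  have v: "isom P p \<in> carrier ?A" "adj ?A (isom P p) \<in> carrier ?A"
    "adj ?A (isom P p) \<otimes>\<^bsub>?A\<^esub> isom P p = \<one>\<^bsub>?A\<^esub>" if "p \<in> carrier P" for p
    using rep that A.adj_closed by auto
  have e: "e p \<in> carrier ?A" "adj ?A (e p) = e p" "e p \<otimes>\<^bsub>?A\<^esub> e p = e p" if "p \<in> carrier P" for p
  proof -
    note v = v[OF that]
    show "e p \<in> carrier ?A" "adj ?A (e p) = e p"
      using v by (simp_all add: e_def A.adj_mult A.adj_adj)
    have "e p \<otimes>\<^bsub>?A\<^esub> e p = isom P p \<otimes>\<^bsub>?A\<^esub> (adj ?A (isom P p) \<otimes>\<^bsub>?A\<^esub> isom P p) \<otimes>\<^bsub>?A\<^esub> adj ?A (isom P p)"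
      using v(1,2) by (simp add: e_def A.m_assoc)
    then show "e p \<otimes>\<^bsub>?A\<^esub> e p = e p" using v by (simp add: e_def)
  qed
  have mult: "e p \<otimes>\<^bsub>?A\<^esub> e q = e r" if "p \<in> carrier P" "q \<in> carrier P" "is_rlcm P p q r" for p q
  proof -
    have "e p \<otimes>\<^bsub>?A\<^esub> e q = isom P p \<otimes>\<^bsub>?A\<^esub> adj ?A (isom P p) \<otimes>\<^bsub>?A\<^esub> isom P q \<otimes>\<^bsub>?A\<^esub> adj ?A (isom P q)"
      using v[OF that(1)] v[OF that(2)] by (simp add: e_def A.m_assoc)
    then show ?thesis using rep that unfolding e_def by simp
  qed
  have \<phi>: "\<phi> (e p) = complex_of_real (N p powr (- \<beta>))" if "p \<in> carrier P" for p
    unfolding e_def using KMS_range_projection[of P p "N p" \<sigma> \<beta> \<phi>, OF P that N[OF that] \<sigma>[OF that] KMS] .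
  have rc: "r \<in> carrier P" using r by (simp add: is_rlcm_def)
  have "state ?A \<phi>" using KMS by (simp add: KMS_state_def)
  from A.state_commuting_projections[OF this e[OF p] e[OF q]]
  have "1 - \<phi> (e p) - \<phi> (e q) + \<phi> (e r) \<in> \<real>\<^sub>\<ge>\<^sub>0"
    using mult[OF p q r] mult[OF q p is_rlcm_sym[OF r]] by simp
  then have "complex_of_real (1 - N p powr (- \<beta>) - N q powr (- \<beta>) + N r powr (- \<beta>)) \<in> \<real>\<^sub>\<ge>\<^sub>0"
    by (simp only: \<phi> p q rc of_real_diff of_real_add of_real_1)
  then show ?thesis by (simp only: nonneg_Reals_of_real_iff)
qed

section \<open>KMS states of the braid monoid\<close>

context positive_braids
begin

lemma braid_fractions: "central_fractions M full_twist"
  by unfold_locales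
    (fact full_twist_in full_twist_central braid_left_cancel braid_right_cancel
      divides_full_twist_pow)+

end

text \<open>The cubic \<open>1 - 2x + x\<^sup>3\<close> has the roots \<open>1\<close> and \<open>(-1 \<plusminus> \<surd>5) / 2\<close>, so it is negative between
the two positive ones, \<open>(\<surd>5 - 1) / 2\<close> and \<open>1\<close>.\<close>

lemma golden_cubic_neg:
  fixes x :: real
  assumes "sqrt 5 / 2 - 1 / 2 < x" "x < 1"
  shows "1 - x - x + x ^ 3 < 0"
proof -
  have "sqrt 5 < 2 * x + 1" using assms(1) by simp
  then have "(sqrt 5)\<^sup>2 < (2 * x + 1)\<^sup>2" by (intro power_strict_mono) simp_all
  then have "1 - x - x\<^sup>2 < 0" by (simp add: power2_eq_square algebra_simps)
  then have "(1 - x) * (1 - x - x\<^sup>2) < 0" using assms(2) by (simp add: mult_pos_neg)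
  then show ?thesis by (simp add: power2_eq_square power3_eq_cube algebra_simps)
qed

theorem proposition6p2:
  fixes n :: nat and a :: real
    and \<sigma> :: "real \<Rightarrow> (nat \<Rightarrow> nat list set star_poly) set \<Rightarrow> (nat \<Rightarrow> nat list set star_poly) set"
  assumes "n \<ge> 3"
    and "exp (- a) = sqrt 5 / 2 - 1 / 2"
    and "dynamics (semigroup_cstar (braid_monoid n)) \<sigma>"
    and "\<And>t p. p \<in> carrier (braid_monoid n) \<Longrightarrow>
           \<sigma> t (isom (braid_monoid n) p) =
             (complex_of_real (braid_N p) powr (\<i> * complex_of_real t))
               \<odot>\<^bsub>semigroup_cstar (braid_monoid n)\<^esub> isom (braid_monoid n) p"
  shows "(\<exists>\<phi>. KMS_state (semigroup_cstar (braid_monoid n)) \<sigma> 0 \<phi> \<and>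
              gauge_invariant (braid_monoid n) \<phi>) \<and>
         (\<forall>\<beta>. 0 < \<beta> \<and> \<beta> < a \<longrightarrow>
              \<not> (\<exists>\<phi>. KMS_state (semigroup_cstar (braid_monoid n)) \<sigma> \<beta> \<phi>))"
proof (intro conjI allI impI)
  interpret positive_braids n .
  interpret central_fractions M full_twist by (rule braid_fractions)
  obtain \<phi> where \<phi>: "state (semigroup_cstar M) \<phi>" "gauge_invariant M \<phi>"
    and trace: "\<And>x y. x \<in> carrier (semigroup_cstar M) \<Longrightarrow> y \<in> carrier (semigroup_cstar M) \<Longrightarrow>
      \<phi> (x \<otimes>\<^bsub>semigroup_cstar M\<^esub> y) = \<phi> (y \<otimes>\<^bsub>semigroup_cstar M\<^esub> x)"
    using tracial_gauge_invariant_state by blast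
  have "\<phi> (x \<otimes>\<^bsub>semigroup_cstar M\<^esub> y) = \<phi> (y \<otimes>\<^bsub>semigroup_cstar M\<^esub> F (\<i> * complex_of_real 0))"
    if "analytic_extension (semigroup_cstar M) \<sigma> x F" and y: "y \<in> carrier (semigroup_cstar M)" for x y F
  proof -
    have "F (complex_of_real 0) = \<sigma> 0 x" and x: "x \<in> carrier (semigroup_cstar M)"
      using that(1) unfolding analytic_extension_def by blast+
    then have "F (\<i> * complex_of_real 0) = x" using assms(3) by (simp add: dynamics_def)
    then show ?thesis using trace[OF x y] by simp
  qed
  then have "KMS_state (semigroup_cstar M) \<sigma> 0 \<phi>"
    using \<phi>(1) unfolding KMS_state_def by blast
  then show "\<exists>\<phi>. KMS_state (semigroup_cstar M) \<sigma> 0 \<phi> \<and> gauge_invariant M \<phi>" using \<phi>(2) by blast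
next
  interpret positive_braids n .
  fix \<beta> assume \<beta>: "0 < \<beta> \<and> \<beta> < a"
  show "\<not> (\<exists>\<phi>. KMS_state (semigroup_cstar M) \<sigma> \<beta> \<phi>)"
  proof
    assume "\<exists>\<phi>. KMS_state (semigroup_cstar M) \<sigma> \<beta> \<phi>"
    then obtain \<phi> where \<phi>: "KMS_state (semigroup_cstar M) \<sigma> \<beta> \<phi>" by blast
    have S: "1 \<in> S" "2 \<in> S" using assms(1) by simp_all
    have "is_rlcm M (cls [1]) (cls [2]) (cls [1, 2, 1])"
      by (rule adjacent_generators_rlcm[OF S]) simp
    from KMS_rlcm_bound[where N = braid_N, OF monoid_axioms g_in[OF S(1)] g_in[OF S(2)] this _ assms(4) \<phi>]
    have "0 \<le> 1 - exp 1 powr (- \<beta>) - exp 1 powr (- \<beta>) + exp 3 powr (- \<beta>)"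
      by (simp add: braid_N_def braid_length_class)
    also have "exp 3 powr (- \<beta>) = (exp (- \<beta>)) ^ 3"
      by (simp add: powr_def exp_of_nat_mult[symmetric])
    also have "exp 1 powr (- \<beta>) = exp (- \<beta>)" by (simp add: powr_def)
    finally have "0 \<le> 1 - exp (- \<beta>) - exp (- \<beta>) + exp (- \<beta>) ^ 3" .
    moreover have "sqrt 5 / 2 - 1 / 2 < exp (- \<beta>)" "exp (- \<beta>) < 1"
      using \<beta> by (simp_all flip: assms(2))
    ultimately show False using golden_cubic_neg by fastforce
  qed
qed

end
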